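(* Let $V:\mathbb{R}^d\to\mathbb{R}$, $\pi\propto e^{-V}$ and the symmetric positive-definite kernel $\mathsf{k}:\mathbb{R}^d\times\mathbb{R}^d\to\mathbb{R}$ be such that $\mathsf{k}$ and $V$ are $\mathcal{C}^3$, and suppose that (for each $N$ considered) the initial configuration $\underline{x}^N(0)=(x_1^N(0),\dots,x_N^N(0))$ has a $\mathcal{C}^2$ density $p^N(0)=p^N_0$ on $(\mathbb{R}^d)^N$. Let $\underline{x}^N(t)=(x_1(t),\dots,x_N(t))$ evolve by the continuous-time SVGD dynamics, with joint density $p^N(t)$ at time $t$, and let $\mu^N(t)=\frac1N\sum_{i=1}^N\delta_{x_i(t)}$. For $z\in\mathbb{R}^d$ put $$C^*(z) := \nabla_2\mathsf{k}(z,z)\cdot\nabla V(z)+\mathsf{k}(z,z)\Delta V(z)-\Delta_2\mathsf{k}(z,z).$$ Then for every $T>0$, $$\frac1T\int_0^T\mathbb{E}[\mathsf{KSD}^2(\mu^N(t)\|\pi)]\,dt\le\frac{\mathsf{KL}(p^N(0)\|\pi^{\otimes N})}{NT}+\frac{1}{N^2T}\int_0^T\mathbb{E}\Big[\sum_{k=1}^NC^*(x_k(t))\Big]dt,$$ where the expectation is with respect to $p^N(t)$. In addition, $$\mathsf{KL}(p^N(T)\|\pi^{\otimes N})\le\mathsf{KL}(p^N(0)\|\pi^{\otimes N})+\frac1N\int_0^T\mathbb{E}\Big[\sum_{k=1}^NC^*(x_k(t))\Big]dt.$$ Moreover, if $C^*:=\sup_{z\in\mathbb{R}^d}C^*(z)<\infty$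 and $\limsup_{N\to\infty}\mathsf{KL}(p^N(0)\|\pi^{\otimes N})/N<\infty$, then $$\big(\mathbb{E}[\mathsf{KSD}(\mu^N_{av}\|\pi)]\big)^2\le\frac1N\int_0^N\mathbb{E}[\mathsf{KSD}^2(\mu^N(t)\|\pi)]\,dt\le\frac{\sup_L\frac{\mathsf{KL}(p^L(0)\|\pi^{\otimes L})}{L}+C^*}{N},$$ where $\mu^N_{av}(dx):=\frac1N\int_0^N\mu^N(t,dx)\,dt$.
   Context: $\pi$ is the probability density on $\mathbb{R}^d$ proportional to $e^{-V}$, and $\pi^{\otimes N}$ is its $N$-fold product. The continuous-time $N$-particle SVGD dynamics is $$\dot x_i(t)=-\frac1N\sum_{j=1}^N\mathsf{k}(x_i(t),x_j(t))\nabla V(x_j(t))+\frac1N\sum_{j=1}^N\nabla_2\mathsf{k}(x_i(t),x_j(t)),\quad 1\le i\le N,$$ where $\nabla_1,\nabla_2$ denote gradients in the first, second argument. Standing assumption: a solution exists and the driving vector field on $(\mathbb{R}^d)^N$ is complete (under the hypotheses above, the joint density $p^N(t,\cdot)$ exists for all $t\ge0$). Notation: $\nabla_2\mathsf{k}(z,z)$ is the gradient of $\mathsf{k}(z,\cdot)$ evaluated at $z$, and $\Delta_2\mathsf{k}(z,z)$ is the Laplacian of $\mathsf{k}(z,\cdot)$ evaluated at $z$. Relative entropy: $\mathsf{KL}(p\|\pi^{\otimes N})=\int\log\big(p(\underline z)/\pi^{\otimes N}(\underline z)\big)p(\underline z)\,d\underline z$. Kernelized Stein Discrepancy: let $\mathcal{H}_0$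 be the RKHS of $\mathsf{k}$, $\mathcal{H}=\mathcal{H}_0\times\dots\times\mathcal{H}_0$ ($d$ copies, $\mathbb{R}^d$-valued functions), and $\mathcal{T}_\pi\phi(x)=-\nabla V(x)\cdot\phi(x)+\nabla\cdot\phi(x)$. Then $\mathsf{KSD}(P\|\pi)=\sup\{\mathbb{E}_{X\sim P}[\mathcal{T}_\pi\phi(X)]:\phi\in\mathcal{H},\|\phi\|_{\mathcal{H}}\le1\}$; it has the explicit form $$\mathsf{KSD}^2(P\|\pi)=\mathbb{E}_{(X,Y)\sim P\otimes P}\big[\nabla V(X)\cdot\mathsf{k}(X,Y)\nabla V(Y)-\nabla V(X)\cdot\nabla_2\mathsf{k}(X,Y)-\nabla V(Y)\cdot\nabla_1\mathsf{k}(X,Y)+\nabla_1\cdot\nabla_2\mathsf{k}(X,Y)\big].$$ *)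

theory Defs
  imports "HOL-Probability.Probability"
begin

section \<open>Differential operators on a Euclidean space\<close>

text \<open>
  Euclidean space \<open>\<real>\<^sup>d\<close> is rendered by a type \<open>'a :: euclidean_space\<close>; kernels are curried functions
  \<open>'a \<Rightarrow> 'a \<Rightarrow> real\<close>. Thus \<open>grad (k x) y\<close> is \<open>\<nabla>\<^sub>2k(x,y)\<close> and \<open>laplacian (k x) y\<close> is \<open>\<Delta>\<^sub>2k(x,y)\<close>.
\<close>

definition grad :: "('a::euclidean_space \<Rightarrow> real) \<Rightarrow> 'a \<Rightarrow> 'a" where
  "grad f x = (\<Sum>b\<in>Basis. frechet_derivative f (at x) b *\<^sub>R b)"

definition divergence :: "('a::euclidean_space \<Rightarrow> 'a) \<Rightarrow> 'a \<Rightarrow> real" where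
  "divergence \<phi> x = (\<Sum>b\<in>Basis. frechet_derivative (\<lambda>y. \<phi> y \<bullet> b) (at x) b)"

definition laplacian :: "('a::euclidean_space \<Rightarrow> real) \<Rightarrow> 'a \<Rightarrow> real" where
  "laplacian f = divergence (grad f)"

primrec Ck :: "nat \<Rightarrow> ('a::euclidean_space \<Rightarrow> real) \<Rightarrow> bool" where
  "Ck 0 f \<longleftrightarrow> continuous_on UNIV f"
| "Ck (Suc m) f \<longleftrightarrow>
     f differentiable_on UNIV \<and> (\<forall>b\<in>Basis. Ck m (\<lambda>x. frechet_derivative f (at x) b))"


section \<open>Configurations of \<open>N\<close> particles\<close>

text \<open>
  Since \<open>N\<close> varies, a point of \<open>(\<real>\<^sup>d)\<^sup>N\<close> is a function \<open>nat \<Rightarrow> 'a\<close> that matters only on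
  \<open>{..<N}\<close>; particle indices run over \<open>0, \<dots>, N - 1\<close>. Lebesgue measure on \<open>(\<real>\<^sup>d)\<^sup>N\<close> lives on the
  extensional functions, which form the set \<open>configs N\<close>. The function type carries the product
  topology but is not a normed space, so smoothness is expressed by
  existence and continuity of all iterated partial derivatives.
\<close>

definition configs :: "nat \<Rightarrow> (nat \<Rightarrow> 'a::euclidean_space) set" where
  "configs N = PiE {..<N} (\<lambda>_. UNIV)"

definition config_lborel :: "nat \<Rightarrow> (nat \<Rightarrow> 'a::euclidean_space) measure" where
  "config_lborel N = PiM {..<N} (\<lambda>_. lborel)"

definition config_partial ::
  "nat \<Rightarrow> 'a::euclidean_space \<Rightarrow> ((nat \<Rightarrow> 'a) \<Rightarrow> real) \<Rightarrow> (nat \<Rightarrow> 'a) \<Rightarrow> real" where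
  "config_partial i b f z = deriv (\<lambda>h. f (z(i := z i + h *\<^sub>R b))) 0"

primrec config_Ck :: "nat \<Rightarrow> nat \<Rightarrow> ((nat \<Rightarrow> 'a::euclidean_space) \<Rightarrow> real) \<Rightarrow> bool" where
  "config_Ck N 0 f \<longleftrightarrow> continuous_on (configs N) f"
| "config_Ck N (Suc m) f \<longleftrightarrow>
     continuous_on (configs N) f \<and>
     (\<forall>i<N. \<forall>b\<in>Basis.
        (\<forall>z\<in>configs N. (\<lambda>h::real. f (z(i := z i + h *\<^sub>R b))) differentiable (at 0)) \<and>
        config_Ck N m (config_partial i b f))"


section \<open>Kernels and reproducing kernel Hilbert spaces\<close>

definition pos_def_kernel :: "('a \<Rightarrow> 'a \<Rightarrow> real) \<Rightarrow> bool" where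
  "pos_def_kernel k \<longleftrightarrow>
     (\<forall>x y. k x y = k y x) \<and>
     (\<forall>S c. finite S \<longrightarrow> (\<Sum>x\<in>S. \<Sum>y\<in>S. c x * c y * k x y) \<ge> 0)"

text \<open>
  \<open>rkhs k H ip\<close>: the set \<open>H\<close> of functions, with inner product \<open>ip\<close>, is the reproducing kernel Hilbert
  space of \<open>k\<close>. By the Moore--Aronszajn theorem, each positive definite \<open>k\<close> has one
  and only one such pair (up to the irrelevant values of \<open>ip\<close> outside \<open>H\<close>).
\<close>

locale rkhs =
  fixes k :: "'a \<Rightarrow> 'a \<Rightarrow> real"
    and H :: "('a \<Rightarrow> real) set"
    and ip :: "('a \<Rightarrow> real) \<Rightarrow> ('a \<Rightarrow> real) \<Rightarrow> real"
  assumes zero_mem: "(\<lambda>x. 0) \<in> H"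
    and add_mem: "\<And>f g. f \<in> H \<Longrightarrow> g \<in> H \<Longrightarrow> (\<lambda>x. f x + g x) \<in> H"
    and scale_mem: "\<And>c f. f \<in> H \<Longrightarrow> (\<lambda>x. c * f x) \<in> H"
    and ip_sym: "\<And>f g. f \<in> H \<Longrightarrow> g \<in> H \<Longrightarrow> ip f g = ip g f"
    and ip_add: "\<And>f g h. f \<in> H \<Longrightarrow> g \<in> H \<Longrightarrow> h \<in> H \<Longrightarrow> ip (\<lambda>x. f x + g x) h = ip f h + ip g h"
    and ip_scale: "\<And>c f g. f \<in> H \<Longrightarrow> g \<in> H \<Longrightarrow> ip (\<lambda>x. c * f x) g = c * ip f g"
    and ip_nonneg: "\<And>f. f \<in> H \<Longrightarrow> ip f f \<ge> 0"
    and ip_definite: "\<And>f. f \<in> H \<Longrightarrow> ip f f = 0 \<Longrightarrow> f = (\<lambda>x. 0)"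
    and complete: "\<And>F. (\<And>n::nat. F n \<in> H) \<Longrightarrow>
        (\<And>e. e > 0 \<Longrightarrow>
          \<exists>n0. \<forall>m\<ge>n0. \<forall>n\<ge>n0. sqrt (ip (\<lambda>x. F m x - F n x) (\<lambda>x. F m x - F n x)) < e) \<Longrightarrow>
        \<exists>f\<in>H. (\<lambda>n. sqrt (ip (\<lambda>x. F n x - f x) (\<lambda>x. F n x - f x))) \<longlonglongrightarrow> 0"
    and kernel_mem: "\<And>x. k x \<in> H"
    and reproducing: "\<And>f x. f \<in> H \<Longrightarrow> f x = ip f (k x)"

text \<open>The space \<open>H \<times> \<dots> \<times> H\<close> (\<open>d\<close> copies) of vector fields whose components lie in \<open>H\<close>, and its norm.\<close>

definition vec_space :: "('a::euclidean_space \<Rightarrow> real) set \<Rightarrow> ('a \<Rightarrow> 'a) set" where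
  "vec_space H = {\<phi>. \<forall>b\<in>Basis. (\<lambda>x. \<phi> x \<bullet> b) \<in> H}"

definition vec_norm ::
  "(('a::euclidean_space \<Rightarrow> real) \<Rightarrow> ('a \<Rightarrow> real) \<Rightarrow> real) \<Rightarrow> ('a \<Rightarrow> 'a) \<Rightarrow> real" where
  "vec_norm ip \<phi> = sqrt (\<Sum>b\<in>Basis. ip (\<lambda>x. \<phi> x \<bullet> b) (\<lambda>x. \<phi> x \<bullet> b))"


section \<open>Kernelized Stein discrepancy\<close>

definition stein_op :: "('a::euclidean_space \<Rightarrow> real) \<Rightarrow> ('a \<Rightarrow> 'a) \<Rightarrow> 'a \<Rightarrow> real" where
  "stein_op V \<phi> x = - (grad V x \<bullet> \<phi> x) + divergence \<phi> x"

text \<open>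
  The supremum is taken in \<open>[0, \<infinity>]\<close>. Truncating the expectations at \<open>0\<close> does not change it, because
  \<open>\<phi> = 0\<close> is admissible. The target \<open>\<pi> \<propto> exp (- V)\<close> enters through \<open>V\<close> only.
\<close>

definition KSD ::
  "('a::euclidean_space \<Rightarrow> real) \<Rightarrow> ('a \<Rightarrow> real) set \<Rightarrow> (('a \<Rightarrow> real) \<Rightarrow> ('a \<Rightarrow> real) \<Rightarrow> real) \<Rightarrow>
     'a measure \<Rightarrow> ennreal" where
  "KSD V H ip P =
     (SUP \<phi>\<in>{\<phi> \<in> vec_space H. vec_norm ip \<phi> \<le> 1}. ennreal (\<integral>x. stein_op V \<phi> x \<partial>P))"

definition Cstar :: "('a::euclidean_space \<Rightarrow> real) \<Rightarrow> ('a \<Rightarrow> 'a \<Rightarrow> real) \<Rightarrow> 'a \<Rightarrow> real" where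
  "Cstar V k z = grad (k z) z \<bullet> grad V z + k z z * laplacian V z - laplacian (k z) z"


section \<open>Relative entropy\<close>

text \<open>
  Integral with values in the extended reals. It agrees with the Bochner integral for integrable
  functions, and is \<open>\<infinity>\<close> or \<open>-\<infinity>\<close> if exactly one of the two parts is infinite. The remaining case
  \<open>\<infinity> - \<infinity>\<close> has the value \<open>\<infinity>\<close> in type \<open>ereal\<close>, so an upper bound involving an integral that does not
  exist asserts nothing.
\<close>

definition ext_integral :: "'w measure \<Rightarrow> ('w \<Rightarrow> real) \<Rightarrow> ereal" where
  "ext_integral M f =
     enn2ereal (\<integral>\<^sup>+w. ennreal (f w) \<partial>M) - enn2ereal (\<integral>\<^sup>+w. ennreal (- f w) \<partial>M)"

text \<open>The integral over \<open>t \<in> [0, T]\<close> of the expectation of \<open>f t\<close>, with the same convention.\<close>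

definition time_expectation :: "real \<Rightarrow> 'w measure \<Rightarrow> (real \<Rightarrow> 'w \<Rightarrow> real) \<Rightarrow> ereal" where
  "time_expectation T M f =
     enn2ereal (\<integral>\<^sup>+t\<in>{0..T}. (\<integral>\<^sup>+w. ennreal (f t w) \<partial>M) \<partial>lborel) -
     enn2ereal (\<integral>\<^sup>+t\<in>{0..T}. (\<integral>\<^sup>+w. ennreal (- f t w) \<partial>M) \<partial>lborel)"

lemma ext_integral_eq_integral:
  assumes "integrable M f"
  shows "ext_integral M f = ereal (\<integral>w. f w \<partial>M)"
proof -
  have fin: "(\<integral>\<^sup>+w. ennreal (f w) \<partial>M) < \<infinity>" "(\<integral>\<^sup>+w. ennreal (- f w) \<partial>M) < \<infinity>"
    using assms by (auto simp: real_integrable_def less_top)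
  show ?thesis
    unfolding ext_integral_def real_lebesgue_integral_def[OF assms]
    using fin
    by (cases "\<integral>\<^sup>+w. ennreal (f w) \<partial>M"; cases "\<integral>\<^sup>+w. ennreal (- f w) \<partial>M")
       (auto simp: enn2ereal_ennreal)
qed

lemma time_expectation_eq_integral:
  fixes f :: "real \<Rightarrow> 'w \<Rightarrow> real"
  assumes "prob_space M"
    and int: "integrable (lborel \<Otimes>\<^sub>M M) (\<lambda>(t, w). indicator {0..T} t * f t w)"
  shows "time_expectation T M f = ereal (LINT t:{0..T}|lborel. (\<integral>w. f t w \<partial>M))"
proof -
  interpret M: prob_space M by fact
  interpret P: pair_sigma_finite lborel M ..
  let ?g = "\<lambda>(t, w). indicator {0..T} t * f t w"
  have [measurable]: "?g \<in> borel_measurable (lborel \<Otimes>\<^sub>M M)"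
    using int by auto
  have g: "(\<integral>\<^sup>+y. ennreal (s * ?g y) \<partial>(lborel \<Otimes>\<^sub>M M)) =
      (\<integral>\<^sup>+t\<in>{0..T}. (\<integral>\<^sup>+w. ennreal (s * f t w) \<partial>M) \<partial>lborel)" for s
  proof -
    have "(\<lambda>y. ennreal (s * ?g y)) \<in> borel_measurable (lborel \<Otimes>\<^sub>M M)"
      by measurable
    then have "(\<integral>\<^sup>+y. ennreal (s * ?g y) \<partial>(lborel \<Otimes>\<^sub>M M)) =
        (\<integral>\<^sup>+t. (\<integral>\<^sup>+w. ennreal (s * ?g (t, w)) \<partial>M) \<partial>lborel)"
      by (rule M.nn_integral_fst[symmetric])
    also have "\<dots> = (\<integral>\<^sup>+t\<in>{0..T}. (\<integral>\<^sup>+w. ennreal (s * f t w) \<partial>M) \<partial>lborel)"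
      by (rule nn_integral_cong) (auto simp: indicator_def)
    finally show ?thesis .
  qed
  have "time_expectation T M f = ext_integral (lborel \<Otimes>\<^sub>M M) ?g"
    unfolding time_expectation_def ext_integral_def using g[of 1] g[of "-1"] by simp
  also have "\<dots> = ereal (\<integral>y. ?g y \<partial>(lborel \<Otimes>\<^sub>M M))"
    by (rule ext_integral_eq_integral[OF int])
  also have "(\<integral>y. ?g y \<partial>(lborel \<Otimes>\<^sub>M M)) = (\<integral>t. (\<integral>w. indicator {0..T} t * f t w \<partial>M) \<partial>lborel)"
    using P.integral_fst'[OF int] by simp
  finally show ?thesis
    by (simp add: set_lebesgue_integral_def)
qed

definition target_density :: "('a::euclidean_space \<Rightarrow> real) \<Rightarrow> 'a \<Rightarrow> real" where
  "target_density V x = exp (- V x) / (\<integral>y. exp (- V y) \<partial>lborel)"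

definition prod_target :: "('a::euclidean_space \<Rightarrow> real) \<Rightarrow> nat \<Rightarrow> (nat \<Rightarrow> 'a) \<Rightarrow> real" where
  "prod_target V N z = (\<Prod>i<N. target_density V (z i))"

text \<open>
  The integrand is \<open>0\<close> where \<open>q\<close> vanishes. The library constant \<open>KL_divergence\<close> is real-valued and is \<open>0\<close>
  for an infinite relative entropy, hence it is not used here.
\<close>

definition KL_prod ::
  "('a::euclidean_space \<Rightarrow> real) \<Rightarrow> nat \<Rightarrow> ((nat \<Rightarrow> 'a) \<Rightarrow> real) \<Rightarrow> ereal" where
  "KL_prod V N q = ext_integral (config_lborel N) (\<lambda>z. ln (q z / prod_target V N z) * q z)"


section \<open>The particle dynamics\<close>

definition svgd_field ::
  "('a::euclidean_space \<Rightarrow> real) \<Rightarrow> ('a \<Rightarrow> 'a \<Rightarrow> real) \<Rightarrow> nat \<Rightarrow> (nat \<Rightarrow> 'a) \<Rightarrow> nat \<Rightarrow> 'a" where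
  "svgd_field V k N z i =
     - (1 / real N) *\<^sub>R (\<Sum>j<N. k (z i) (z j) *\<^sub>R grad V (z j))
     + (1 / real N) *\<^sub>R (\<Sum>j<N. grad (k (z i)) (z j))"

definition svgd_solution ::
  "('a::euclidean_space \<Rightarrow> real) \<Rightarrow> ('a \<Rightarrow> 'a \<Rightarrow> real) \<Rightarrow> nat \<Rightarrow> real set \<Rightarrow>
     (real \<Rightarrow> nat \<Rightarrow> 'a) \<Rightarrow> bool" where
  "svgd_solution V k N I y \<longleftrightarrow>
     (\<forall>t\<in>I. \<forall>i<N. ((\<lambda>s. y s i) has_vector_derivative svgd_field V k N (y t) i) (at t within I))"

definition svgd_complete ::
  "('a::euclidean_space \<Rightarrow> real) \<Rightarrow> ('a \<Rightarrow> 'a \<Rightarrow> real) \<Rightarrow> nat \<Rightarrow> bool" where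
  "svgd_complete V k N \<longleftrightarrow>
     (\<forall>z. \<exists>y. (\<forall>i<N. y 0 i = z i) \<and> svgd_solution V k N UNIV y)"

text \<open>
  \<open>x t w i\<close> is the position at time \<open>t\<close> of particle \<open>i\<close>, and \<open>p t\<close> is the joint density at time \<open>t\<close>.
\<close>

locale svgd_process =
  fixes V :: "'a::euclidean_space \<Rightarrow> real"
    and k :: "'a \<Rightarrow> 'a \<Rightarrow> real"
    and N :: nat
    and M :: "'w measure"
    and x :: "real \<Rightarrow> 'w \<Rightarrow> nat \<Rightarrow> 'a"
    and p :: "real \<Rightarrow> (nat \<Rightarrow> 'a) \<Rightarrow> real"
  assumes prob: "prob_space M"
    and complete_field: "svgd_complete V k N"
    and dynamics: "\<And>w. w \<in> space M \<Longrightarrow> svgd_solution V k N {0..} (\<lambda>t. x t w)"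
    and density_nonneg: "\<And>t z. t \<ge> 0 \<Longrightarrow> z \<in> configs N \<Longrightarrow> p t z \<ge> 0"
    and density: "\<And>t. t \<ge> 0 \<Longrightarrow>
        distributed M (config_lborel N) (\<lambda>w. restrict (x t w) {..<N}) (\<lambda>z. ennreal (p t z))"
    and initial_smooth: "config_Ck N 2 (p 0)"

definition empirical :: "nat \<Rightarrow> (nat \<Rightarrow> 'a::euclidean_space) \<Rightarrow> 'a measure" where
  "empirical N z = distr (uniform_count_measure {..<N}) borel z"

definition averaged_empirical :: "nat \<Rightarrow> (real \<Rightarrow> nat \<Rightarrow> 'a::euclidean_space) \<Rightarrow> 'a measure" where
  "averaged_empirical N y =
     measure_of UNIV (sets borel)
       (\<lambda>A. (\<integral>\<^sup>+t\<in>{0..real N}. emeasure (empirical N (y t)) A \<partial>lborel) / ennreal (real N))"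

end

theory Submission
  imports Defs
begin

text \<open>
  Let \<open>v\<close> be the particle vector field, \<open>J\<^sub>T = exp (\<integral> div v (x\<^sub>t) dt)\<close> the Jacobian along a trajectory, and let
  \<open>\<pi>\<close> also denote the density of the product target. A direct computation of \<open>div v - \<Sum>\<^sub>i \<nabla>V (x\<^sub>i) \<bullet> v\<^sub>i\<close> gives the
  pathwise identity
  \<open>ln J\<^sub>T + ln \<pi> (x\<^sub>T) - ln \<pi> (x\<^sub>0) = N \<integral> KSD\<^sup>2 dt - (1/N) \<integral> \<Sum>\<^sub>i C (x\<^sub>i) dt\<close>.
  Liouville's theorem gives \<open>E [g (x\<^sub>T) J\<^sub>T / p\<^sub>0 (x\<^sub>0)] \<le> \<integral> g\<close> for \<open>g \<ge> 0\<close>, and \<open>ln u \<le> u - 1\<close> then bounds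
  \<open>E [ln (g (x\<^sub>T) J\<^sub>T / p\<^sub>0 (x\<^sub>0))]\<close> by \<open>0\<close> when \<open>g\<close> is a probability density. The choice \<open>g = \<pi>\<close> yields the
  bound on the discrepancy, the choice \<open>g = p\<^sub>T\<close> the bound on the entropy at time \<open>T\<close>.

  Liouville's theorem is obtained without differentiating the flow: for a truncated field, a scheme that
  moves one coordinate at a time is a composition of shears, each of which preserves integrals of test
  functions exactly by one-dimensional substitution. The scheme converges along every given
  trajectory, and Fatou's lemma gives the inequality.
\<close>

section \<open>Configuration space and test functions\<close>

text \<open>The direct argument differentiates the entropy along the continuity equation and
  integrates by parts. It needs a density that is smooth in time and space and decays at infinity,
  whereas at positive times the density is merely measurable here, and the entropies and the
  expectation of \<open>Cstar\<close> may be infinite. An inequality between nonnegative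
  expectations avoids this, and as only an upper bound is wanted, mass lost in Fatou's lemma does no
  harm.

  \<open>Cstar\<close> stems from the diagonal: a particle enters its own interaction term through
  both arguments of the kernel. The derivative in the first argument, combined with the potential,
  fills the double sum for \<open>KSD\<close>, diagonal included; what the second argument and the
  moving \<open>grad V\<close> add is \<open>Cstar\<close> divided by \<open>N\<close>, with a minus
  sign.

  That this double sum is the square of the supremum defining \<open>KSD\<close> rests on point
  derivatives being bounded functionals on \<open>H\<close>. The averaged Stein operator is then an
  inner product with a fixed vector field, and the supremum is the norm of that field.\<close>

definition axes :: "nat \<Rightarrow> (nat \<times> 'a::euclidean_space) set" where
  "axes N = {..<N} \<times> Basis"

definition shift :: "nat \<times> 'a::euclidean_space \<Rightarrow> real \<Rightarrow> (nat \<Rightarrow> 'a) \<Rightarrow> nat \<Rightarrow> 'a" where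
  "shift l s z = z(fst l := z (fst l) + s *\<^sub>R snd l)"

text \<open>Continuity refers to the whole function type with its product topology, while the
  support is bounded in the coordinates below \<open>N\<close> only. It becomes compact after
  intersection with \<open>configs N\<close>, where the other coordinates are frozen.\<close>

definition test_function :: "nat \<Rightarrow> ((nat \<Rightarrow> 'a::euclidean_space) \<Rightarrow> real) \<Rightarrow> bool" where
  "test_function N f \<longleftrightarrow>
     continuous_on UNIV f \<and> (\<exists>R. \<forall>z. (\<exists>j<N. R < norm (z j)) \<longrightarrow> f z = 0)"

lemma finite_axes [simp]: "finite (axes N)"
  by (simp add: axes_def)

lemma axes_D: "l \<in> axes N \<Longrightarrow> fst l < N" "l \<in> axes N \<Longrightarrow> snd l \<in> Basis"
  by (auto simp: axes_def)

lemma shift_0 [simp]: "shift l 0 z = z"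
  by (simp add: shift_def)

lemma shift_shift: "shift l s (shift l r z) = shift l (s + r) z"
  by (auto simp: shift_def algebra_simps)

lemma shift_apply: "shift l s z j = (if j = fst l then z j + s *\<^sub>R snd l else z j)"
  by (simp add: shift_def)

lemma shift_configs: "l \<in> axes N \<Longrightarrow> z \<in> configs N \<Longrightarrow> shift l s z \<in> configs N"
  by (auto simp: configs_def PiE_def extensional_def shift_apply dest: axes_D)

section \<open>Product Lebesgue measure on configurations\<close>

lemma sigma_finite_config: "product_sigma_finite (\<lambda>_::nat. lborel :: 'a::euclidean_space measure)"
  by standard

lemma sigma_finite_config_lborel: "sigma_finite_measure (config_lborel N)"
proof -
  interpret finite_product_sigma_finite "\<lambda>_::nat. lborel :: 'a::euclidean_space measure" "{..<N}"
    by standard simp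
  show ?thesis unfolding config_lborel_def by unfold_locales
qed

lemma space_config_lborel [simp]: "space (config_lborel N) = configs N"
  by (simp add: config_lborel_def configs_def space_PiM)

lemma measurable_config_component [measurable]:
  "i < N \<Longrightarrow> (\<lambda>z. z i) \<in> config_lborel N \<rightarrow>\<^sub>M (borel :: 'a::euclidean_space measure)"
proof -
  assume "i < N"
  then have "(\<lambda>z. z i) \<in> config_lborel N \<rightarrow>\<^sub>M (lborel :: 'a measure)"
    unfolding config_lborel_def by (intro measurable_component_singleton) auto
  then show ?thesis by simp
qed

lemma measurable_into_config_lborel:
  assumes "\<And>w. w \<in> space M \<Longrightarrow> f w \<in> configs N"
    and "\<And>i. i < N \<Longrightarrow> (\<lambda>w. f w i) \<in> M \<rightarrow>\<^sub>M (borel :: 'a::euclidean_space measure)"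
  shows "f \<in> M \<rightarrow>\<^sub>M config_lborel N"
  unfolding config_lborel_def
proof (rule measurable_PiM_single')
  show "f \<in> space M \<rightarrow> (\<Pi>\<^sub>E i\<in>{..<N}. space lborel)"
    using assms(1) by (auto simp: configs_def)
qed (use assms(2) in auto)

text \<open>Two sigma-algebras occur: the finite product on \<open>configs N\<close> and the Borel
  sets of the function type. Since the coordinates from \<open>N\<close> on are constantly
  \<open>undefined\<close> on \<open>configs N\<close>, Borel functions restrict to functions
  measurable for the product.\<close>

lemma measurable_config_inclusion [measurable]:
  "(\<lambda>z. z) \<in> config_lborel N \<rightarrow>\<^sub>M (borel :: (nat \<Rightarrow> 'a::euclidean_space) measure)"
proof (rule measurable_coordinatewise_then_product)
  fix i :: nat
  show "(\<lambda>z. z i) \<in> config_lborel N \<rightarrow>\<^sub>M (borel :: 'a::euclidean_space measure)"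
  proof (cases "i < N")
    case False
    then have "\<And>z::nat\<Rightarrow>'a. z \<in> space (config_lborel N) \<Longrightarrow> z i = undefined"
      by (auto simp: configs_def PiE_def extensional_def)
    then show ?thesis
      by (subst measurable_cong[where g="\<lambda>_. undefined"]) auto
  qed simp
qed

lemma continuous_measurable_config:
  fixes f :: "(nat \<Rightarrow> 'a::euclidean_space) \<Rightarrow> 'b::topological_space"
  assumes "continuous_on UNIV f"
  shows "f \<in> borel_measurable (config_lborel N)"
  using measurable_compose[OF measurable_config_inclusion borel_measurable_continuous_onI[OF assms]]
  by simp

text \<open>Tychonoff's theorem: the box is a product over all of \<open>nat\<close>, with closed
  balls as factors below \<open>N\<close> and the singleton \<open>{undefined}\<close>
  elsewhere.\<close>

lemma compact_config_box:
  "compact {z \<in> configs N. \<forall>j<N. norm (z j :: 'a::euclidean_space) \<le> R}" (is "compact ?K")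
proof -
  have eq: "?K = PiE UNIV (\<lambda>j. if j < N then cball 0 R else {undefined})"
    by (auto simp: configs_def PiE_def extensional_def Pi_def split: if_splits)
  have "compactin (product_topology (\<lambda>_. euclidean) UNIV)
      (PiE UNIV (\<lambda>j. if j < N then cball (0::'a) R else {undefined}))"
    by (subst compactin_PiE) (auto simp: compactin_euclidean_iff)
  then show ?thesis
    unfolding eq by (simp add: euclidean_product_topology compactin_euclidean_iff)
qed

lemma test_function_bounded:
  assumes "test_function N f"
  obtains B where "B > 0" "\<And>z. z \<in> configs N \<Longrightarrow> \<bar>f z\<bar> \<le> B"
proof -
  from assms obtain R where R: "\<And>z j. j < N \<Longrightarrow> R < norm (z j) \<Longrightarrow> f z = 0"
    and f: "continuous_on UNIV f"
    unfolding test_function_def by metis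
  have "bounded (f ` {z \<in> configs N. \<forall>j<N. norm (z j) \<le> R})"
    by (intro compact_imp_bounded compact_continuous_image compact_config_box
        continuous_on_subset[OF f]) auto
  then obtain B where B: "B > 0" "\<And>z. z \<in> configs N \<Longrightarrow> \<forall>j<N. norm (z j) \<le> R \<Longrightarrow> \<bar>f z\<bar> \<le> B"
    unfolding bounded_pos by auto
  show thesis
  proof
    fix z :: "nat \<Rightarrow> 'a" assume "z \<in> configs N"
    then show "\<bar>f z\<bar> \<le> B"
      using B R[of _ z] by (cases "\<forall>j<N. norm (z j) \<le> R") (auto simp: not_le)
  qed fact
qed

lemma test_function_integrable:
  assumes "test_function N (f :: (nat \<Rightarrow> 'a::euclidean_space) \<Rightarrow> real)"
  shows "integrable (config_lborel N) f"
proof -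
  from assms obtain R where R: "\<And>z j. j < N \<Longrightarrow> R < norm (z j) \<Longrightarrow> f z = 0"
    and f: "continuous_on UNIV f"
    unfolding test_function_def by metis
  obtain B where B: "\<And>z. z \<in> configs N \<Longrightarrow> \<bar>f z\<bar> \<le> B"
    using test_function_bounded[OF assms] by metis
  interpret product_sigma_finite "\<lambda>_::nat. lborel :: 'a measure" by (rule sigma_finite_config)
  define A where "A = PiE {..<N} (\<lambda>_. cball (0::'a) R)"
  have A: "A \<in> sets (config_lborel N)"
    unfolding config_lborel_def A_def by (intro sets_PiM_I_finite) auto
  have fin: "emeasure (config_lborel N) A < \<infinity>"
    unfolding config_lborel_def A_def
    using emeasure_lborel_cball_finite[of "0::'a" R]
    by (subst emeasure_PiM) (auto simp: prod_constant power_less_top_ennreal)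
  have "z j \<in> cball 0 R \<or> f z = 0" if "j < N" for z j
    using R[OF that, of z] by (cases "R < norm (z j)") auto
  then have 0: "f z = 0" if "z \<in> configs N" "z \<notin> A" for z
    using that by (auto simp: configs_def PiE_def Pi_def A_def)
  show ?thesis
    
  proof (rule integrableI_bounded_set[where A=A and B=B])
    show "f \<in> borel_measurable (config_lborel N)" by (rule continuous_measurable_config[OF f])
  qed (use A fin B 0 in auto)
qed

lemma measurable_shift [measurable]:
  fixes l :: "nat \<times> 'a::euclidean_space"
  assumes l: "l \<in> axes N" and [measurable]: "f \<in> borel_measurable M" "g \<in> M \<rightarrow>\<^sub>M config_lborel N"
  shows "(\<lambda>w. shift l (f w) (g w)) \<in> M \<rightarrow>\<^sub>M config_lborel N"
proof (rule measurable_into_config_lborel)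
  fix w assume "w \<in> space M"
  then have "g w \<in> configs N" using measurable_space[OF assms(3)] by simp
  then show "shift l (f w) (g w) \<in> configs N" by (rule shift_configs[OF l])
next
  fix i assume [measurable]: "i < N"
  have "(\<lambda>w. g w i) \<in> borel_measurable M"
    by (rule measurable_compose[OF assms(3) measurable_config_component]) fact
  then show "(\<lambda>w. shift l (f w) (g w) i) \<in> borel_measurable M"
    by (cases "i = fst l") (auto simp: shift_apply)
qed

text \<open>A product measure is determined by its values on boxes, and the preimage of a box is a
  box with a single side translated.\<close>

lemma distr_shift:
  fixes l :: "nat \<times> 'a::euclidean_space"
  assumes l: "l \<in> axes N"
  shows "distr (config_lborel N) (config_lborel N) (shift l s) = config_lborel N"
proof -
  interpret product_sigma_finite "\<lambda>_::nat. lborel :: 'a measure" by (rule sigma_finite_config)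
  interpret finite_product_sigma_finite "\<lambda>_::nat. lborel :: 'a::euclidean_space measure" "{..<N}"
    by standard simp
  have m: "shift l s \<in> config_lborel N \<rightarrow>\<^sub>M config_lborel N"
    using measurable_shift[OF l, of "\<lambda>_. s" "config_lborel N" "\<lambda>z. z"] by simp
  show ?thesis unfolding config_lborel_def
  proof (rule PiM_eqI)
    fix A :: "nat \<Rightarrow> 'a set" assume A: "\<And>i. i \<in> {..<N} \<Longrightarrow> A i \<in> sets lborel"
    define A' where "A' = (\<lambda>i. if i = fst l then (\<lambda>y. s *\<^sub>R snd l + y) -` A i else A i)"
    have A': "A' i \<in> sets lborel" if "i \<in> {..<N}" for i
      using A[OF that] measurable_sets_borel[of "\<lambda>y. s *\<^sub>R snd l + y" borel "A i"]
      by (auto simp: A'_def)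
    have eA: "emeasure lborel (A' i) = emeasure lborel (A i)" if "i \<in> {..<N}" for i
    proof (cases "i = fst l")
      case True
      have "emeasure lborel (A i) = emeasure (distr lborel borel ((+) (s *\<^sub>R snd l))) (A i)"
        by (simp add: lborel_distr_plus)
      also have "\<dots> = emeasure lborel (A' i)"
        using A[OF that] True by (subst emeasure_distr) (auto simp: A'_def)
      finally show ?thesis by simp
    qed (simp add: A'_def)
    have "emeasure (distr (PiM {..<N} (\<lambda>_. lborel)) (PiM {..<N} (\<lambda>_. lborel)) (shift l s)) (PiE {..<N} A) =
        emeasure (config_lborel N) (shift l s -` PiE {..<N} A \<inter> space (config_lborel N))"
      using m A unfolding config_lborel_def
      by (intro emeasure_distr sets_PiM_I_finite) auto
    also have "shift l s -` PiE {..<N} A \<inter> space (config_lborel N) = PiE {..<N} A'"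
    proof (rule set_eqI)
      fix z :: "nat \<Rightarrow> 'a"
      have e: "shift l s z \<in> extensional {..<N} \<longleftrightarrow> z \<in> extensional {..<N}"
        using axes_D(1)[OF l] by (auto simp: extensional_def shift_apply split: if_splits)
      have "shift l s z i \<in> A i \<longleftrightarrow> z i \<in> A' i" for i
        by (simp add: shift_apply A'_def add.commute)
      then show "z \<in> shift l s -` PiE {..<N} A \<inter> space (config_lborel N) \<longleftrightarrow> z \<in> PiE {..<N} A'"
        using e by (auto simp: PiE_def Pi_def configs_def)
    qed
    also have "emeasure (config_lborel N) (PiE {..<N} A') = (\<Prod>i\<in>{..<N}. emeasure lborel (A' i))"
      unfolding config_lborel_def using A' by (intro emeasure_PiM) auto
    also have "\<dots> = (\<Prod>i\<in>{..<N}. emeasure lborel (A i))"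
      by (intro prod.cong eA refl)
    finally show "emeasure (distr (PiM {..<N} (\<lambda>_. lborel)) (PiM {..<N} (\<lambda>_. lborel)) (shift l s)) (PiE {..<N} A) =
        (\<Prod>i\<in>{..<N}. emeasure lborel (A i))" .
  qed (simp_all only: sets_distr finite_lessThan)
qed

text \<open>
  Slicing along lines: insert the factor \<open>\<integral> \<theta> (z \<bullet> b - s) ds = 1\<close> and translate \<open>z\<close> by \<open>s b\<close>.
\<close>

lemma integral_zero_if_line_integrals_zero:
  fixes l :: "nat \<times> 'a::euclidean_space" and G :: "(nat \<Rightarrow> 'a) \<Rightarrow> real"
  assumes l: "l \<in> axes N" and G: "integrable (config_lborel N) G"
    and zero: "\<And>z. z \<in> configs N \<Longrightarrow> (\<integral>s. G (shift l s z) \<partial>lborel) = 0"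
  shows "(\<integral>z. G z \<partial>config_lborel N) = 0"
proof -
  interpret L: sigma_finite_measure "config_lborel N :: (nat \<Rightarrow> 'a) measure"
    by (rule sigma_finite_config_lborel)
  interpret P: pair_sigma_finite "lborel :: real measure" "config_lborel N :: (nat \<Rightarrow> 'a) measure" ..
  note [measurable] = l
  have [measurable]: "fst l < N" "G \<in> borel_measurable (config_lborel N)"
    using axes_D[OF l] G by auto
  define \<theta> :: "real \<Rightarrow> real" where "\<theta> = indicator {0..1}"
  have [measurable]: "\<theta> \<in> borel_measurable borel" by (simp add: \<theta>_def)
  have \<theta>0: "\<theta> r \<ge> 0" for r by (simp add: \<theta>_def)
  let ?c = "\<lambda>z::nat\<Rightarrow>'a. z (fst l) \<bullet> snd l"
  define F where "F = (\<lambda>(s, z). G z * \<theta> (?c z - s))"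
  define F' where "F' = (\<lambda>(s, z). G (shift l s z) * \<theta> (?c z))"
  have [measurable]: "F \<in> borel_measurable (lborel \<Otimes>\<^sub>M config_lborel N)"
    "F' \<in> borel_measurable (lborel \<Otimes>\<^sub>M config_lborel N)"
    unfolding F_def F'_def by measurable
  have \<theta>e: "(\<lambda>s. \<theta> (r - s)) = indicator {r - 1..r}" for r
    by (auto simp: \<theta>_def indicator_def fun_eq_iff)
  \<comment> \<open>The translation adds \<open>s\<close> to the coordinate \<open>?c\<close>, which
    cancels the \<open>- s\<close> in the weight. Afterwards the weight is free of \<open>s\<close>,
    so the inner integral of \<open>F'\<close> over \<open>s\<close> is a multiple of a line
    integral of \<open>G\<close>.\<close>
  have F'F: "F' (s, z) = F (s, shift l s z)" for s z
    using axes_D[OF l] by (simp add: F_def F'_def shift_apply inner_add_left)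
  have m: "shift l s \<in> config_lborel N \<rightarrow>\<^sub>M config_lborel N" for s
    using measurable_shift[OF l, of "\<lambda>_. s" "config_lborel N" "\<lambda>z. z"] by simp
  have intF: "integrable (lborel \<Otimes>\<^sub>M config_lborel N) F"
  proof (rule integrableI_bounded)
    have "(\<integral>\<^sup>+y. ennreal (norm (F y)) \<partial>(lborel \<Otimes>\<^sub>M config_lborel N)) =
        (\<integral>\<^sup>+z. (\<integral>\<^sup>+s. ennreal (norm (F (s, z))) \<partial>lborel) \<partial>config_lborel N)"
      by (subst P.nn_integral_snd[symmetric]) auto
    also have "\<dots> = (\<integral>\<^sup>+z. ennreal (norm (G z)) \<partial>config_lborel N)"
    proof (rule nn_integral_cong)
      fix z :: "nat \<Rightarrow> 'a"
      have "(\<integral>\<^sup>+s. ennreal (norm (F (s, z))) \<partial>lborel) =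
          (\<integral>\<^sup>+s. ennreal (norm (G z)) * indicator {?c z - 1..?c z} s \<partial>lborel)"
        using fun_cong[OF \<theta>e[of "?c z"]]
        by (intro nn_integral_cong) (auto simp: F_def indicator_def)
      then show "(\<integral>\<^sup>+s. ennreal (norm (F (s, z))) \<partial>lborel) = ennreal (norm (G z))"
        by (simp add: nn_integral_cmult_indicator)
    qed
    also have "\<dots> < \<infinity>" using G by (simp add: integrable_iff_bounded)
    finally show "(\<integral>\<^sup>+y. ennreal (norm (F y)) \<partial>(lborel \<Otimes>\<^sub>M config_lborel N)) < \<infinity>" .
  qed simp
  have intF': "integrable (lborel \<Otimes>\<^sub>M config_lborel N) F'"
  proof (rule integrableI_bounded)
    have "(\<integral>\<^sup>+y. ennreal (norm (F' y)) \<partial>(lborel \<Otimes>\<^sub>M config_lborel N)) =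
        (\<integral>\<^sup>+s. (\<integral>\<^sup>+z. ennreal (norm (F' (s, z))) \<partial>config_lborel N) \<partial>lborel)"
      by (subst L.nn_integral_fst[symmetric]) auto
    also have "\<dots> = (\<integral>\<^sup>+s. (\<integral>\<^sup>+z. ennreal (norm (F (s, z))) \<partial>config_lborel N) \<partial>lborel)"
    proof (rule nn_integral_cong)
      fix s :: real
      have "(\<integral>\<^sup>+z. ennreal (norm (F (s, z))) \<partial>config_lborel N) =
        (\<integral>\<^sup>+z. ennreal (norm (F (s, z))) \<partial>distr (config_lborel N) (config_lborel N) (shift l s))"
        by (simp add: distr_shift[OF l])
      also have "\<dots> = (\<integral>\<^sup>+z. ennreal (norm (F (s, shift l s z))) \<partial>config_lborel N)"
        using m by (subst nn_integral_distr) auto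
      finally show "(\<integral>\<^sup>+z. ennreal (norm (F' (s, z))) \<partial>config_lborel N) =
        (\<integral>\<^sup>+z. ennreal (norm (F (s, z))) \<partial>config_lborel N)" by (simp add: F'F)
    qed
    also have "\<dots> = (\<integral>\<^sup>+y. ennreal (norm (F y)) \<partial>(lborel \<Otimes>\<^sub>M config_lborel N))"
      by (subst L.nn_integral_fst[symmetric]) auto
    also have "\<dots> < \<infinity>" using intF by (simp add: integrable_iff_bounded)
    finally show "(\<integral>\<^sup>+y. ennreal (norm (F' y)) \<partial>(lborel \<Otimes>\<^sub>M config_lborel N)) < \<infinity>" .
  qed simp
  have "(\<integral>z. G z \<partial>config_lborel N) = (\<integral>z. (\<integral>s. F (s, z) \<partial>lborel) \<partial>config_lborel N)"
  proof (rule Bochner_Integration.integral_cong)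
    fix z :: "nat \<Rightarrow> 'a"
    have "(\<integral>s. F (s, z) \<partial>lborel) = (\<integral>s. indicator {?c z - 1..?c z} s *\<^sub>R G z \<partial>lborel)"
      using fun_cong[OF \<theta>e[of "?c z"]] by (intro Bochner_Integration.integral_cong) (auto simp: F_def)
    then show "G z = (\<integral>s. F (s, z) \<partial>lborel)" by simp
  qed simp
  also have "\<dots> = (\<integral>s. (\<integral>z. F (s, z) \<partial>config_lborel N) \<partial>lborel)"
    using P.Fubini_integral[of "curry F"] intF by simp
  also have "\<dots> = (\<integral>s. (\<integral>z. F' (s, z) \<partial>config_lborel N) \<partial>lborel)"
  proof (rule Bochner_Integration.integral_cong)
    fix s :: real
    have "(\<integral>z. F (s, z) \<partial>config_lborel N) =
        (\<integral>z. F (s, z) \<partial>distr (config_lborel N) (config_lborel N) (shift l s))"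
      by (simp add: distr_shift[OF l])
    also have "\<dots> = (\<integral>z. F (s, shift l s z) \<partial>config_lborel N)"
      using m by (subst integral_distr) auto
    finally show "(\<integral>z. F (s, z) \<partial>config_lborel N) = (\<integral>z. F' (s, z) \<partial>config_lborel N)"
      by (simp add: F'F)
  qed simp
  also have "\<dots> = (\<integral>z. (\<integral>s. F' (s, z) \<partial>lborel) \<partial>config_lborel N)"
    using P.Fubini_integral[of "curry F'"] intF' by simp
  also have "\<dots> = (\<integral>z. 0 \<partial>(config_lborel N :: (nat \<Rightarrow> 'a) measure))"
    using zero by (intro Bochner_Integration.integral_cong) (auto simp: F'_def)
  finally show ?thesis by simp
qed

section \<open>Shears preserve Lebesgue integrals\<close>

lemma continuous_on_shift:
  assumes "continuous_on UNIV (f :: (nat \<Rightarrow> 'a::euclidean_space) \<Rightarrow> real)"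
  shows "continuous_on UNIV (\<lambda>z. shift l (f z) z)"
proof (rule continuous_on_coordinatewise_then_product)
  fix i
  show "continuous_on UNIV (\<lambda>z. shift l (f z) z i)"
    by (cases "i = fst l") (auto simp: shift_apply intro!: continuous_intros assms)
qed

lemma continuous_on_line:
  "continuous_on UNIV (\<lambda>s. shift l s (z :: nat \<Rightarrow> 'a::euclidean_space))"
proof (rule continuous_on_coordinatewise_then_product)
  fix i
  show "continuous_on UNIV (\<lambda>s. shift l s z i)"
    by (cases "i = fst l") (auto simp: shift_apply intro!: continuous_intros)
qed

text \<open>
  On each line in direction \<open>l\<close> the shear is \<open>s \<mapsto> s + h \<gamma> s\<close> with \<open>\<gamma>\<close> compactly supported, and the
  change of variables follows from the chain rule for an antiderivative of \<open>f\<close>.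
\<close>

lemma
  fixes f c Dc :: "(nat \<Rightarrow> 'a::euclidean_space) \<Rightarrow> real"
  assumes l: "l \<in> axes N" and f: "test_function N f" and c: "test_function N c"
    and Dc: "continuous_on UNIV Dc"
    and deriv: "\<And>z. ((\<lambda>s. c (shift l s z)) has_real_derivative Dc z) (at 0)"
  shows test_function_shear: "test_function N (\<lambda>z. f (shift l (h * c z) z) * (1 + h * Dc z))"
      (is ?test)
    and integral_shear: "(\<integral>z. f (shift l (h * c z) z) * (1 + h * Dc z) \<partial>config_lborel N) =
      (\<integral>z. f z \<partial>config_lborel N)" (is ?int)
proof -
  from f obtain R1 where R1: "\<And>z j. j < N \<Longrightarrow> R1 < norm (z j) \<Longrightarrow> f z = 0"
    and fc: "continuous_on UNIV f"
    unfolding test_function_def by metis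
  from c obtain R2 where R2: "\<And>z j. j < N \<Longrightarrow> R2 < norm (z j) \<Longrightarrow> c z = 0"
    and cc: "continuous_on UNIV c"
    unfolding test_function_def by metis
  define R where "R = max R1 R2"
  have R: "f z = 0" "c z = 0" if "j < N" "R < norm (z j)" for z j
    using that R1[of j z] R2[of j z] by (auto simp: R_def)
  have cont: "continuous_on UNIV (\<lambda>z. f (shift l (h * c z) z) * (1 + h * Dc z))"
    by (intro continuous_intros Dc continuous_on_compose2[OF fc] continuous_on_shift cc) auto
  show t: ?test
    unfolding test_function_def
  proof (intro conjI exI[of _ R] allI impI cont)
    fix z :: "nat \<Rightarrow> 'a" assume "\<exists>j<N. R < norm (z j)"
    then show "f (shift l (h * c z) z) * (1 + h * Dc z) = 0"
      using R by auto
  qed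
  define G where "G = (\<lambda>z. f (shift l (h * c z) z) * (1 + h * Dc z) - f z)"
  have "(\<integral>z. G z \<partial>config_lborel N) = 0"
  proof (rule integral_zero_if_line_integrals_zero[OF l])
    show "integrable (config_lborel N) G"
      unfolding G_def using test_function_integrable[OF t] test_function_integrable[OF f] by auto
    fix z :: "nat \<Rightarrow> 'a"
    define \<phi> where "\<phi> = (\<lambda>s. f (shift l s z))"
    define \<gamma> where "\<gamma> = (\<lambda>s. c (shift l s z))"
    define \<gamma>' where "\<gamma>' = (\<lambda>s. Dc (shift l s z))"
    have \<gamma>': "(\<gamma> has_real_derivative \<gamma>' s) (at s)" for s
    proof -
      have "((\<lambda>r. \<gamma> (r + s)) has_real_derivative \<gamma>' s) (at 0)"
        using deriv[of "shift l s z"] by (simp add: shift_shift \<gamma>_def \<gamma>'_def)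
      then show ?thesis using DERIV_shift[of \<gamma> "\<gamma>' s" 0 s] by simp
    qed
    have c\<phi>: "continuous_on X \<phi>" for X
      unfolding \<phi>_def using continuous_on_compose2[OF fc continuous_on_line]
      by (rule continuous_on_subset) auto
    have c\<gamma>: "continuous_on X \<gamma>" for X
      unfolding \<gamma>_def using continuous_on_compose2[OF cc continuous_on_line]
      by (rule continuous_on_subset) auto
    have c\<gamma>': "continuous_on X \<gamma>'" for X
      unfolding \<gamma>'_def using continuous_on_compose2[OF Dc continuous_on_line]
      by (rule continuous_on_subset) auto
    \<comment> \<open>\<open>snd l\<close> is a unit vector, so for
      \<open>\<bar>s\<bar> \<ge> A\<close> the moved particle has norm at least
      \<open>\<bar>s\<bar> - norm (z (fst l))\<close>, which exceeds \<open>R\<close>.\<close>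
    define A where "A = \<bar>R\<bar> + norm (z (fst l)) + 1"
    have A: "A > 0" by (simp add: A_def add_nonneg_pos)
    have zero: "\<phi> s = 0 \<and> \<gamma> s = 0" if "\<bar>s\<bar> \<ge> A" for s
    proof -
      have "\<bar>s\<bar> = norm (s *\<^sub>R snd l)" using axes_D[OF l] by simp
      also have "\<dots> \<le> norm (shift l s z (fst l)) + norm (z (fst l))"
        using norm_triangle_ineq4[of "z (fst l) + s *\<^sub>R snd l" "z (fst l)"] by (simp add: shift_apply)
      finally have "R < norm (shift l s z (fst l))" using that by (simp add: A_def)
      then show ?thesis using R[OF axes_D(1)[OF l]] by (simp add: \<phi>_def \<gamma>_def)
    qed
    have "bounded (\<gamma> ` {-A..A})"
      by (intro compact_imp_bounded compact_continuous_image c\<gamma>) auto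
    then obtain B where B: "B > 0" "\<And>s. s \<in> {-A..A} \<Longrightarrow> \<bar>\<gamma> s\<bar> \<le> B"
      unfolding bounded_pos by auto
    \<comment> \<open>Room for the displaced argument: \<open>s + h * \<gamma> s\<close> with
      \<open>s\<close> in \<open>{-A..A}\<close> stays strictly inside \<open>{-A'..A'}\<close>,
      where the antiderivative \<open>F\<close> is differentiable from both sides.\<close>
    define A' where "A' = A + \<bar>h\<bar> * B + 1"
    define F where "F = (\<lambda>u. integral {-A'..u} \<phi>)"
    have AA': "A < A'" using B by (simp add: A'_def add_nonneg_pos)
    have F: "(F has_real_derivative \<phi> u) (at u)" if "\<bar>u\<bar> < A'" for u
    proof -
      have "(F has_vector_derivative \<phi> u) (at u within {-A'..A'})"
        unfolding F_def by (rule integral_has_vector_derivative) (use that in \<open>auto intro: c\<phi>\<close>)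
      moreover have "at u within {-A'..A'} = at u"
        by (rule at_within_interior) (use that in auto)
      ultimately show ?thesis by (simp add: has_real_derivative_iff_has_vector_derivative)
    qed
    have bd: "\<bar>s + h * \<gamma> s\<bar> < A'" if "s \<in> {-A..A}" for s
    proof -
      have "\<bar>h * \<gamma> s\<bar> \<le> \<bar>h\<bar> * B" using B(2)[OF that] by (simp add: abs_mult mult_left_mono)
      then show ?thesis using that by (auto simp: A'_def)
    qed
    have "((\<lambda>s. \<phi> (s + h * \<gamma> s) * (1 + h * \<gamma>' s)) has_integral
        (F (A + h * \<gamma> A) - F (- A + h * \<gamma> (- A)))) {-A..A}"
    proof (rule fundamental_theorem_of_calculus)
      fix s assume s: "s \<in> {-A..A}"
      have "((\<lambda>s. F (s + h * \<gamma> s)) has_real_derivative \<phi> (s + h * \<gamma> s) * (1 + h * \<gamma>' s)) (at s)"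
        by (rule DERIV_chain2[where f=F and g="\<lambda>s. s + h * \<gamma> s", OF F[OF bd[OF s]]])
          (auto intro!: derivative_eq_intros \<gamma>')
      then show "((\<lambda>s. F (s + h * \<gamma> s)) has_vector_derivative \<phi> (s + h * \<gamma> s) * (1 + h * \<gamma>' s))
          (at s within {-A..A})"
        by (auto simp: has_real_derivative_iff_has_vector_derivative intro: has_vector_derivative_at_within)
    qed (use A in simp)
    moreover have "(\<phi> has_integral (F A - F (- A))) {-A..A}"
    proof (rule fundamental_theorem_of_calculus)
      fix s assume "s \<in> {-A..A}"
      then have "(F has_real_derivative \<phi> s) (at s)" using AA' by (intro F) auto
      then show "(F has_vector_derivative \<phi> s) (at s within {-A..A})"
        by (auto simp: has_real_derivative_iff_has_vector_derivative intro: has_vector_derivative_at_within)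
    qed (use A in simp)
    \<comment> \<open>\<open>\<gamma>\<close> vanishes at \<open>A\<close> and \<open>-A\<close>, so
      both integrals equal \<open>F A - F (- A)\<close>. The substitution is therefore exact for
      every \<open>h\<close>, of either sign and any size.\<close>
    ultimately have I: "((\<lambda>s. \<phi> (s + h * \<gamma> s) * (1 + h * \<gamma>' s) - \<phi> s) has_integral 0) {-A..A}"
      using zero[of A] zero[of "-A"] A by (auto dest: has_integral_diff)
    have G: "G (shift l s z) = \<phi> (s + h * \<gamma> s) * (1 + h * \<gamma>' s) - \<phi> s" for s
      by (simp add: G_def \<phi>_def \<gamma>_def \<gamma>'_def shift_shift add.commute)
    have "(\<integral>s. G (shift l s z) \<partial>lborel) = (LINT s:{-A..A}|lborel. G (shift l s z))"
      unfolding set_lebesgue_integral_def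
    proof (rule Bochner_Integration.integral_cong)
      fix s
      show "G (shift l s z) = indicator {-A..A} s *\<^sub>R G (shift l s z)"
        using zero[of s] by (cases "s \<in> {-A..A}") (auto simp: G)
    qed simp
    also have "\<dots> = integral {-A..A} (\<lambda>s. G (shift l s z))"
    proof (rule set_borel_integral_eq_integral(2))
      show "set_integrable lborel {-A..A} (\<lambda>s. G (shift l s z))"
        unfolding G by (intro borel_integrable_atLeastAtMost' continuous_intros c\<phi> c\<gamma> c\<gamma>'
            continuous_on_compose2[OF c\<phi>[of UNIV]]) auto
    qed
    also have "\<dots> = 0" using I unfolding G by (rule integral_unique)
    finally show "(\<integral>s. G (shift l s z) \<partial>lborel) = 0" .
  qed
  then show ?int
    unfolding G_def
    using test_function_integrable[OF t] test_function_integrable[OF f] by simp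
qed

section \<open>Locally Lipschitz functions and cutoffs\<close>

definition box_config :: "nat \<Rightarrow> real \<Rightarrow> (nat \<Rightarrow> 'a::euclidean_space) \<Rightarrow> bool" where
  "box_config N R z \<longleftrightarrow> (\<forall>j<N. norm (z j) \<le> R)"

definition config_dist :: "nat \<Rightarrow> (nat \<Rightarrow> 'a::euclidean_space) \<Rightarrow> (nat \<Rightarrow> 'a) \<Rightarrow> real" where
  "config_dist N z z' = (\<Sum>j<N. norm (z j - z' j))"

text \<open>The form in which differentiability of the field is exploited on a type without a norm:
  \<open>config_dist\<close> is an l1 distance in the coordinates below \<open>N\<close>. The
  condition is stable under sums and products and yields the consistency error of an Euler
  step.\<close>

definition lip_on_boxes :: "nat \<Rightarrow> ((nat \<Rightarrow> 'a::euclidean_space) \<Rightarrow> real) \<Rightarrow> bool" where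
  "lip_on_boxes N f \<longleftrightarrow> (\<forall>R. \<exists>L\<ge>0. \<forall>z z'. box_config N R z \<longrightarrow> box_config N R z' \<longrightarrow>
     \<bar>f z - f z'\<bar> \<le> L * config_dist N z z')"

lemma config_dist_nonneg: "config_dist N z z' \<ge> 0"
  by (simp add: config_dist_def sum_nonneg)

lemma norm_le_config_dist: "j < N \<Longrightarrow> norm (z j - z' j) \<le> config_dist N z z'"
  unfolding config_dist_def by (rule member_le_sum) auto

lemma box_config_near:
  assumes "box_config N R z" "config_dist N z' z \<le> d" "R + d \<le> R'"
  shows "box_config N R' z'"
  unfolding box_config_def
proof (intro allI impI)
  fix j assume j: "j < N"
  have "norm (z' j) \<le> norm (z j) + norm (z' j - z j)" by (rule norm_triangle_sub)
  also have "\<dots> \<le> R + d"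
    using assms j norm_le_config_dist[OF j, of z' z] by (auto simp: box_config_def intro!: add_mono)
  finally show "norm (z' j) \<le> R'" using assms(3) by simp
qed

lemma config_dist_shift: "l \<in> axes N \<Longrightarrow> config_dist N (shift l s z) z = \<bar>s\<bar>"
proof -
  assume l: "l \<in> axes N"
  have "config_dist N (shift l s z) z = (\<Sum>j<N. if j = fst l then \<bar>s\<bar> else 0)"
    unfolding config_dist_def using axes_D(2)[OF l] by (intro sum.cong) (auto simp: shift_apply)
  then show ?thesis using axes_D(1)[OF l] by simp
qed

lemma lip_on_boxesE:
  assumes "lip_on_boxes N f"
  obtains L where "L \<ge> 0"
    "\<And>z z'. box_config N R z \<Longrightarrow> box_config N R z' \<Longrightarrow> \<bar>f z - f z'\<bar> \<le> L * config_dist N z z'"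
  using assms unfolding lip_on_boxes_def by meson

lemma lip_on_boxes_bounded:
  assumes "lip_on_boxes N f"
  obtains B where "B \<ge> 0" "\<And>z. box_config N R z \<Longrightarrow> \<bar>f z\<bar> \<le> B"
proof (cases "R \<ge> 0")
  case True
  obtain L where L: "L \<ge> 0"
    "\<And>z z'. box_config N R z \<Longrightarrow> box_config N R z' \<Longrightarrow> \<bar>f z - f z'\<bar> \<le> L * config_dist N z z'"
    using lip_on_boxesE[OF assms] by metis
  show thesis
  proof (rule that[of "\<bar>f (\<lambda>_. 0)\<bar> + L * (real N * R)"])
    show "0 \<le> \<bar>f (\<lambda>_. 0)\<bar> + L * (real N * R)" using True L by simp
    fix z :: "nat \<Rightarrow> 'a" assume z: "box_config N R z"
    have "config_dist N z (\<lambda>_. 0) \<le> (\<Sum>j<N. R)"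
      unfolding config_dist_def using z by (intro sum_mono) (auto simp: box_config_def)
    then have "L * config_dist N z (\<lambda>_. 0) \<le> L * (real N * R)"
      using L by (intro mult_left_mono) auto
    moreover have "\<bar>f z - f (\<lambda>_. 0)\<bar> \<le> L * config_dist N z (\<lambda>_. 0)"
      using z True by (intro L) (auto simp: box_config_def)
    ultimately show "\<bar>f z\<bar> \<le> \<bar>f (\<lambda>_. 0)\<bar> + L * (real N * R)" by linarith
  qed
next
  case False
  show thesis
  \<comment> \<open>For \<open>R < 0\<close> the box is empty if \<open>N > 0\<close>. For
    \<open>N = 0\<close> it contains everything, but then all distances are 0 and \<open>f\<close>
    is constant.\<close>
  proof (cases "N = 0")
    case True
    obtain L where L: "\<And>z z'. box_config N R z \<Longrightarrow> box_config N R z' \<Longrightarrow> \<bar>f z - f z'\<bar> \<le> L * config_dist N z z'"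
      using lip_on_boxesE[OF assms] by metis
    have "f z = f (\<lambda>_. 0)" for z
      using L[of z "\<lambda>_. 0"] True by (simp add: box_config_def config_dist_def)
    then show thesis by (intro that[of "\<bar>f (\<lambda>_. 0)\<bar>"]) (auto, metis order_refl)
  next
    case N: False
    have "\<not> box_config N R z" for z :: "nat \<Rightarrow> 'a"
      using False N by (auto simp: box_config_def not_le intro!: exI[of _ 0] intro: less_le_trans)
    then show thesis by (intro that[of 0]) auto
  qed
qed

lemma lip_on_boxes_const [intro]: "lip_on_boxes N (\<lambda>_. c)"
  by (auto simp: lip_on_boxes_def intro!: exI[of _ 0])

lemma lip_on_boxes_add [intro]:
  assumes "lip_on_boxes N f" "lip_on_boxes N g"
  shows "lip_on_boxes N (\<lambda>z. f z + g z)"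
  unfolding lip_on_boxes_def
proof
  fix R
  obtain L where L: "L \<ge> 0"
    "\<And>z z'. box_config N R z \<Longrightarrow> box_config N R z' \<Longrightarrow> \<bar>f z - f z'\<bar> \<le> L * config_dist N z z'"
    using lip_on_boxesE[OF assms(1)] by metis
  obtain K where K: "K \<ge> 0"
    "\<And>z z'. box_config N R z \<Longrightarrow> box_config N R z' \<Longrightarrow> \<bar>g z - g z'\<bar> \<le> K * config_dist N z z'"
    using lip_on_boxesE[OF assms(2)] by metis
  show "\<exists>L\<ge>0. \<forall>z z'. box_config N R z \<longrightarrow> box_config N R z' \<longrightarrow>
     \<bar>f z + g z - (f z' + g z')\<bar> \<le> L * config_dist N z z'"
  proof (intro exI[of _ "L + K"] conjI allI impI)
    fix z z' :: "nat \<Rightarrow> 'a" assume z: "box_config N R z" "box_config N R z'"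
    show "\<bar>f z + g z - (f z' + g z')\<bar> \<le> (L + K) * config_dist N z z'"
      using L(2)[OF z] K(2)[OF z] by (simp add: distrib_right)
  qed (use L K in simp)
qed

lemma lip_on_boxes_mult [intro]:
  assumes "lip_on_boxes N f" "lip_on_boxes N g"
  shows "lip_on_boxes N (\<lambda>z. f z * g z)"
  unfolding lip_on_boxes_def
proof
  fix R
  obtain L where L: "L \<ge> 0"
    "\<And>z z'. box_config N R z \<Longrightarrow> box_config N R z' \<Longrightarrow> \<bar>f z - f z'\<bar> \<le> L * config_dist N z z'"
    using lip_on_boxesE[OF assms(1)] by metis
  obtain K where K: "K \<ge> 0"
    "\<And>z z'. box_config N R z \<Longrightarrow> box_config N R z' \<Longrightarrow> \<bar>g z - g z'\<bar> \<le> K * config_dist N z z'"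
    using lip_on_boxesE[OF assms(2)] by metis
  obtain A where A: "A \<ge> 0" "\<And>z. box_config N R z \<Longrightarrow> \<bar>f z\<bar> \<le> A"
    using lip_on_boxes_bounded[OF assms(1)] by metis
  obtain B where B: "B \<ge> 0" "\<And>z. box_config N R z \<Longrightarrow> \<bar>g z\<bar> \<le> B"
    using lip_on_boxes_bounded[OF assms(2)] by metis
  show "\<exists>L\<ge>0. \<forall>z z'. box_config N R z \<longrightarrow> box_config N R z' \<longrightarrow>
     \<bar>f z * g z - f z' * g z'\<bar> \<le> L * config_dist N z z'"
  proof (intro exI[of _ "A * K + B * L"] conjI allI impI)
    fix z z' :: "nat \<Rightarrow> 'a" assume z: "box_config N R z" "box_config N R z'"
    have "f z * g z - f z' * g z' = f z * (g z - g z') + g z' * (f z - f z')"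
      by (simp add: algebra_simps)
    then have "\<bar>f z * g z - f z' * g z'\<bar> \<le> \<bar>f z\<bar> * \<bar>g z - g z'\<bar> + \<bar>g z'\<bar> * \<bar>f z - f z'\<bar>"
      by (metis abs_mult abs_triangle_ineq)
    also have "\<dots> \<le> A * (K * config_dist N z z') + B * (L * config_dist N z z')"
      by (intro add_mono mult_mono A B K L z) auto
    finally show "\<bar>f z * g z - f z' * g z'\<bar> \<le> (A * K + B * L) * config_dist N z z'"
      by (simp add: algebra_simps)
  qed (use A B L K in simp)
qed

lemma lip_on_boxes_minus [intro]: "lip_on_boxes N f \<Longrightarrow> lip_on_boxes N (\<lambda>z. - f z)"
  using lip_on_boxes_mult[OF lip_on_boxes_const[of N "-1"]] by simp

lemma lip_on_boxes_diff [intro]: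
  "lip_on_boxes N f \<Longrightarrow> lip_on_boxes N g \<Longrightarrow> lip_on_boxes N (\<lambda>z. f z - g z)"
  using lip_on_boxes_add[OF _ lip_on_boxes_minus, of N f g] by simp

lemma lip_on_boxes_sum [intro]:
  "(\<And>i. i \<in> I \<Longrightarrow> lip_on_boxes N (f i)) \<Longrightarrow> lip_on_boxes N (\<lambda>z. \<Sum>i\<in>I. f i z)"
  by (induction I rule: infinite_finite_induct) auto

text \<open>Finitely many coordinates control \<open>f\<close>: near \<open>z\<close> they all stay
  in one box, and \<open>config_dist\<close> is continuous for the product topology.\<close>

lemma lip_on_boxes_continuous:
  fixes f :: "(nat \<Rightarrow> 'a::euclidean_space) \<Rightarrow> real"
  assumes "lip_on_boxes N f"
  shows "continuous_on UNIV f"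
  unfolding continuous_on_eq_continuous_at[OF open_UNIV]
proof
  fix z :: "nat \<Rightarrow> 'a"
  define R where "R = (\<Sum>j<N. norm (z j)) + 1"
  have zR: "norm (z j) < R" if "j < N" for j
    using member_le_sum[where i=j and A="{..<N}" and f="\<lambda>j. norm (z j)"] that by (auto simp: R_def)
  obtain L where L: "\<And>z z'. box_config N R z \<Longrightarrow> box_config N R z' \<Longrightarrow> \<bar>f z - f z'\<bar> \<le> L * config_dist N z z'"
    using lip_on_boxesE[OF assms] by metis
  have lim: "((\<lambda>w. w j) \<longlongrightarrow> z j) (at z)" for j
  proof -
    have "continuous_on UNIV (\<lambda>w::nat \<Rightarrow> 'a. w j)" by (rule continuous_on_product_coordinates)
    then have "isCont (\<lambda>w::nat \<Rightarrow> 'a. w j) z"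
      unfolding continuous_on_eq_continuous_at[OF open_UNIV] by blast
    then show ?thesis by (simp add: isCont_def)
  qed
  have "\<forall>\<^sub>F w in at z. \<forall>j\<in>{..<N}. norm (w j) < R"
    by (intro eventually_ball_finite ballI order_tendstoD(2)[OF tendsto_norm[OF lim]] zR) auto
  then have "\<forall>\<^sub>F w in at z. norm (f w - f z) \<le> L * config_dist N w z"
  proof eventually_elim
    case (elim w)
    then show ?case using zR by (auto intro!: L simp: box_config_def less_imp_le)
  qed
  moreover have "((\<lambda>w. L * config_dist N w z) \<longlongrightarrow> L * config_dist N z z) (at z)"
    unfolding config_dist_def by (intro tendsto_intros lim)
  then have "((\<lambda>w. L * config_dist N w z) \<longlongrightarrow> 0) (at z)"
    by (simp add: config_dist_def)
  ultimately have "((\<lambda>w. f w - f z) \<longlongrightarrow> 0) (at z)"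
    by (rule Lim_null_comparison)
  then show "isCont f z" by (simp add: isCont_def LIM_zero_iff)
qed

section \<open>Truncation of the field\<close>

text \<open>The squared positive part is a building block for cutoffs with continuous first
  derivative; at 0 its difference quotient is at most \<open>\<bar>h\<bar>\<close>.\<close>

lemma DERIV_max_zero_square: "((\<lambda>s::real. (max 0 s)\<^sup>2) has_real_derivative 2 * max 0 s) (at s)"
proof -
  consider "s < 0" | "s > 0" | "s = 0" by linarith
  then show ?thesis
  proof cases
    case 1
    have "((\<lambda>_::real. 0::real) has_real_derivative 0) (at s)" by simp
    from has_field_derivative_transform_within_open[OF this, of "{..<0}" "\<lambda>s. (max 0 s)\<^sup>2"]
    show ?thesis using 1 by simp
  next
    case 2
    have "((\<lambda>s::real. s\<^sup>2) has_real_derivative 2 * s) (at s)"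
      using DERIV_pow[of 2 s] by simp
    from has_field_derivative_transform_within_open[OF this, of "{0<..}" "\<lambda>s. (max 0 s)\<^sup>2"]
    show ?thesis using 2 by simp
  next
    case 3
    have "((\<lambda>h::real. (max 0 h)\<^sup>2 / h) \<longlongrightarrow> 0) (at 0)"
    proof (rule Lim_null_comparison)
      show "\<forall>\<^sub>F h::real in at 0. norm ((max 0 h)\<^sup>2 / h) \<le> \<bar>h\<bar>"
        by (rule always_eventually) (auto simp: max_def power2_eq_square)
      show "((\<lambda>h::real. \<bar>h\<bar>) \<longlongrightarrow> 0) (at 0)" by (rule tendsto_rabs_zero) simp
    qed
    then show ?thesis using 3 by (simp add: DERIV_def)
  qed
qed

text \<open>The factor is \<open>q (1 - q (S z))\<close> with \<open>q\<close> the squared positive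
  part. On the box of radius \<open>r\<close> one has \<open>S z \<le> 0\<close>, hence value 1 and
  derivative 0; as soon as one particle has norm above \<open>sqrt (real N * r\<^sup>2 + 1)\<close>,
  one has \<open>S z \<ge> 1\<close> and the factor vanishes with its derivative. That
  \<open>Dc\<close> is a test function as well makes it bounded, so that the Jacobian factors
  \<open>1 + h * Dc l z\<close> are nonnegative for small \<open>h\<close>.\<close>

lemma cutoff_exists:
  fixes a D :: "(nat \<Rightarrow> 'a::euclidean_space) \<Rightarrow> real"
  assumes l: "l \<in> axes N" and a: "continuous_on UNIV a" and D: "continuous_on UNIV D"
    and deriv: "\<And>z. ((\<lambda>s. a (shift l s z)) has_real_derivative D z) (at 0)"
  shows "\<exists>c Dc. test_function N c \<and> test_function N Dc \<and>
      (\<forall>z. ((\<lambda>s. c (shift l s z)) has_real_derivative Dc z) (at 0)) \<and>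
      (\<forall>z. box_config N r z \<longrightarrow> c z = a z \<and> Dc z = D z)"
proof -
  define q where "q = (\<lambda>s::real. (max 0 s)\<^sup>2)"
  define q' where "q' = (\<lambda>s::real. 2 * max 0 s)"
  have q: "(q has_real_derivative q' s) (at s)" for s
    using DERIV_max_zero_square by (simp add: q_def q'_def)
  define S where "S = (\<lambda>z::nat\<Rightarrow>'a. (\<Sum>j<N. (norm (z j))\<^sup>2) - real N * r\<^sup>2)"
  define \<kappa> :: "(nat \<Rightarrow> 'a) \<Rightarrow> real" where "\<kappa> = (\<lambda>z. q (1 - q (S z)))"
  define \<kappa>' where "\<kappa>' = (\<lambda>z. q' (1 - q (S z)) * (- q' (S z)) * (2 * (z (fst l) \<bullet> snd l)))"
  have cS: "continuous_on UNIV S"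
    unfolding S_def by (intro continuous_intros) auto
  have cq: "continuous_on UNIV q" "continuous_on UNIV q'"
    unfolding q_def q'_def by (intro continuous_intros)+
  have c\<kappa>: "continuous_on UNIV \<kappa>" "continuous_on UNIV \<kappa>'"
    unfolding \<kappa>_def \<kappa>'_def
    by (intro continuous_intros continuous_on_compose2[OF cq(1)] continuous_on_compose2[OF cq(2)] cS; simp)+
  have dS: "((\<lambda>s. S (shift l s z)) has_real_derivative 2 * (z (fst l) \<bullet> snd l)) (at 0)" for z
  proof -
    have "((\<lambda>s. (norm (shift l s z j))\<^sup>2) has_real_derivative
        (if j = fst l then 2 * (z (fst l) \<bullet> snd l) else 0)) (at 0)" for j
      by (cases "j = fst l")
        (auto simp: shift_apply power2_norm_eq_inner inner_add_left inner_add_right inner_commute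
          intro!: derivative_eq_intros)
    then have "((\<lambda>s. S (shift l s z)) has_real_derivative
        ((\<Sum>j<N. if j = fst l then 2 * (z (fst l) \<bullet> snd l) else 0) - 0)) (at 0)"
      unfolding S_def by (intro derivative_intros)
    then show ?thesis using axes_D(1)[OF l] by simp
  qed
  have d\<kappa>: "((\<lambda>s. \<kappa> (shift l s z)) has_real_derivative \<kappa>' z) (at 0)" for z
  proof -
    have 1: "((\<lambda>s. q (S (shift l s z))) has_real_derivative q' (S z) * (2 * (z (fst l) \<bullet> snd l))) (at 0)"
      by (rule DERIV_chain2[OF _ dS]) (simp add: q)
    have "((\<lambda>s. 1 - q (S (shift l s z))) has_real_derivative - (q' (S z) * (2 * (z (fst l) \<bullet> snd l)))) (at 0)"
      using DERIV_diff[OF DERIV_const 1, of 1] by simp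
    from DERIV_chain2[OF _ this, of q] q[of "1 - q (S z)"] show ?thesis
      by (simp add: \<kappa>_def \<kappa>'_def mult.assoc)
  qed
  have far: "\<kappa> z = 0 \<and> \<kappa>' z = 0" if "j < N" "sqrt (real N * r\<^sup>2 + 1) < norm (z j)" for z j
  proof -
    have "real N * r\<^sup>2 + 1 < (norm (z j))\<^sup>2"
      using that(2) real_le_rsqrt[of "norm (z j)" "real N * r\<^sup>2 + 1"] by linarith
    also have "\<dots> \<le> (\<Sum>j<N. (norm (z j))\<^sup>2)"
      using that(1) by (intro member_le_sum) auto
    finally have "S z \<ge> 1" by (simp add: S_def)
    then have "q (S z) \<ge> 1" by (simp add: q_def)
    then show ?thesis by (simp add: \<kappa>_def \<kappa>'_def q_def q'_def max_def)
  qed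
  have near: "\<kappa> z = 1 \<and> \<kappa>' z = 0" if "box_config N r z" for z
  proof -
    have "(\<Sum>j<N. (norm (z j))\<^sup>2) \<le> (\<Sum>j<N. r\<^sup>2)"
      using that by (intro sum_mono power_mono) (auto simp: box_config_def)
    then have "S z \<le> 0" by (simp add: S_def)
    then show ?thesis by (simp add: \<kappa>_def \<kappa>'_def q_def q'_def)
  qed
  show ?thesis
  proof (intro exI conjI allI impI)
    show "test_function N (\<lambda>z. \<kappa> z * a z)"
      unfolding test_function_def using far
      by (auto intro!: continuous_intros c\<kappa> a exI[of _ "sqrt (real N * r\<^sup>2 + 1)"])
    show "test_function N (\<lambda>z. \<kappa>' z * a z + D z * \<kappa> z)"
      unfolding test_function_def using far
      by (auto intro!: continuous_intros c\<kappa> a D exI[of _ "sqrt (real N * r\<^sup>2 + 1)"])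
    fix z
    show "((\<lambda>s. \<kappa> (shift l s z) * a (shift l s z)) has_real_derivative \<kappa>' z * a z + D z * \<kappa> z) (at 0)"
      using DERIV_mult[OF d\<kappa> deriv, of z] by simp
    assume "box_config N r z"
    then show "\<kappa> z * a z = a z" "\<kappa>' z * a z + D z * \<kappa> z = D z" using near by auto
  qed
qed

section \<open>The splitting scheme\<close>

text \<open>
  One sweep moves the coordinates in the list one after the other by an explicit Euler step. A single
  move is a shear, so that the Jacobian of a sweep is an exact product of one-dimensional factors.
\<close>

primrec sweep :: "(nat \<times> 'a::euclidean_space \<Rightarrow> (nat \<Rightarrow> 'a) \<Rightarrow> real) \<Rightarrow> real \<Rightarrow>
    (nat \<times> 'a) list \<Rightarrow> (nat \<Rightarrow> 'a) \<Rightarrow> nat \<Rightarrow> 'a" where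
  "sweep c h [] z = z"
| "sweep c h (l # ls) z = sweep c h ls (shift l (h * c l z) z)"

primrec sweep_jac :: "(nat \<times> 'a::euclidean_space \<Rightarrow> (nat \<Rightarrow> 'a) \<Rightarrow> real) \<Rightarrow>
    (nat \<times> 'a \<Rightarrow> (nat \<Rightarrow> 'a) \<Rightarrow> real) \<Rightarrow> real \<Rightarrow> (nat \<times> 'a) list \<Rightarrow> (nat \<Rightarrow> 'a) \<Rightarrow> real" where
  "sweep_jac c Dc h [] z = 1"
| "sweep_jac c Dc h (l # ls) z = (1 + h * Dc l z) * sweep_jac c Dc h ls (shift l (h * c l z) z)"

text \<open>The velocity of particle \<open>j\<close>, reassembled from its components along the
  listed axes. A sum over a list, not over a set, because sweeps are compared with Euler steps by
  induction along the list.\<close>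

definition axis_increment ::
  "(nat \<times> 'a::euclidean_space \<Rightarrow> (nat \<Rightarrow> 'a) \<Rightarrow> real) \<Rightarrow> (nat \<times> 'a) list \<Rightarrow> (nat \<Rightarrow> 'a) \<Rightarrow> nat \<Rightarrow> 'a" where
  "axis_increment a ls z j = (\<Sum>l\<leftarrow>ls. if fst l = j then a l z *\<^sub>R snd l else 0)"

lemma sweep_append: "sweep c h (xs @ ys) z = sweep c h ys (sweep c h xs z)"
  by (induction xs arbitrary: z) auto

lemma sweep_jac_append:
  "sweep_jac c Dc h (xs @ ys) z = sweep_jac c Dc h xs z * sweep_jac c Dc h ys (sweep c h xs z)"
  by (induction xs arbitrary: z) auto

lemma sweep_configs:
  "set ls \<subseteq> axes N \<Longrightarrow> z \<in> configs N \<Longrightarrow> sweep c h ls z \<in> configs N"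
  by (induction ls arbitrary: z) (auto intro: shift_configs)

lemma sweep_jac_nonneg:
  assumes "set ls \<subseteq> axes N" "z \<in> configs N"
    and "\<And>l z. l \<in> axes N \<Longrightarrow> z \<in> configs N \<Longrightarrow> 0 \<le> 1 + h * Dc l z"
  shows "0 \<le> sweep_jac c Dc h ls z"
  using assms(1,2)
  by (induction ls arbitrary: z) (auto intro!: mult_nonneg_nonneg assms(3) shift_configs)

text \<open>The integrand for \<open>l # ls\<close> is the integrand for \<open>ls\<close>
  transported by the shear along \<open>l\<close>, times the factor of that shear. The shear lemma
  applies at each stage because the integrand for \<open>ls\<close> is again a test
  function.\<close>

lemma sweep_test_function:
  assumes "set ls \<subseteq> axes N" and f: "test_function N f"
    and c: "\<And>l. l \<in> axes N \<Longrightarrow> test_function N (c l)"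
    and Dc: "\<And>l. l \<in> axes N \<Longrightarrow> continuous_on UNIV (Dc l)"
    and deriv: "\<And>l z. l \<in> axes N \<Longrightarrow> ((\<lambda>s. c l (shift l s z)) has_real_derivative Dc l z) (at 0)"
  shows "test_function N (\<lambda>z. f (sweep c h ls z) * sweep_jac c Dc h ls z) \<and>
    (\<integral>z. f (sweep c h ls z) * sweep_jac c Dc h ls z \<partial>config_lborel N) = (\<integral>z. f z \<partial>config_lborel N)"
  using assms(1)
proof (induction ls)
  case (Cons l ls)
  let ?g = "\<lambda>z. f (sweep c h ls z) * sweep_jac c Dc h ls z"
  have l: "l \<in> axes N" and g: "test_function N ?g"
    and i: "(\<integral>z. ?g z \<partial>config_lborel N) = (\<integral>z. f z \<partial>config_lborel N)"
    using Cons by auto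
  note * = test_function_shear[OF l g c[OF l] Dc[OF l] deriv[OF l], of h]
    integral_shear[OF l g c[OF l] Dc[OF l] deriv[OF l], of h]
  then show ?case using i by (simp add: mult.assoc mult.commute[of "1 + _"])
qed (simp add: f)

lemma config_norm_le_sum_axes:
  "(\<Sum>j<N. norm (y j :: 'a::euclidean_space)) \<le> (\<Sum>l\<in>axes N. \<bar>y (fst l) \<bullet> snd l\<bar>)"
proof -
  have "(\<Sum>j<N. norm (y j)) \<le> (\<Sum>j<N. \<Sum>b\<in>Basis. \<bar>y j \<bullet> b\<bar>)"
    by (intro sum_mono norm_le_l1)
  also have "\<dots> = (\<Sum>l\<in>axes N. \<bar>y (fst l) \<bullet> snd l\<bar>)"
    by (simp add: axes_def sum.cartesian_product case_prod_beta)
  finally show ?thesis .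
qed

text \<open>The bounds concern the true field \<open>a\<close> with its derivatives \<open>D\<close>
  on one box; the truncated \<open>c\<close> and \<open>Dc\<close>, which drive the sweep
  everywhere, agree with them there. A single \<open>K\<close> serves for values and Lipschitz
  constants.\<close>

locale local_sweep =
  fixes N :: nat and a D c Dc :: "nat \<times> 'a::euclidean_space \<Rightarrow> (nat \<Rightarrow> 'a) \<Rightarrow> real"
    and R K :: real
  assumes K: "K \<ge> 0"
    and a_bound: "\<And>l z. l \<in> axes N \<Longrightarrow> box_config N R z \<Longrightarrow> \<bar>a l z\<bar> \<le> K"
    and D_bound: "\<And>l z. l \<in> axes N \<Longrightarrow> box_config N R z \<Longrightarrow> \<bar>D l z\<bar> \<le> K"
    and a_lip: "\<And>l z z'. l \<in> axes N \<Longrightarrow> box_config N R z \<Longrightarrow> box_config N R z' \<Longrightarrow>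
        \<bar>a l z - a l z'\<bar> \<le> K * config_dist N z z'"
    and D_lip: "\<And>l z z'. l \<in> axes N \<Longrightarrow> box_config N R z \<Longrightarrow> box_config N R z' \<Longrightarrow>
        \<bar>D l z - D l z'\<bar> \<le> K * config_dist N z z'"
    and c: "\<And>l z. l \<in> axes N \<Longrightarrow> box_config N R z \<Longrightarrow> c l z = a l z"
    and Dc: "\<And>l z. l \<in> axes N \<Longrightarrow> box_config N R z \<Longrightarrow> Dc l z = D l z"
begin

lemma increment_lip:
  assumes "set ls \<subseteq> axes N" "box_config N R z" "box_config N R z'"
  shows "(\<Sum>j<N. norm (axis_increment a ls z j - axis_increment a ls z' j)) \<le>
      length ls * (K * config_dist N z z')"
  using assms(1)
proof (induction ls)
  case (Cons l ls)
  have l: "l \<in> axes N" using Cons by simp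
  have "(\<Sum>j<N. norm (axis_increment a (l # ls) z j - axis_increment a (l # ls) z' j)) \<le>
      (\<Sum>j<N. (if j = fst l then \<bar>a l z - a l z'\<bar> else 0) +
        norm (axis_increment a ls z j - axis_increment a ls z' j))"
  proof (intro sum_mono)
    fix j
    have "axis_increment a (l # ls) z j - axis_increment a (l # ls) z' j =
       (if j = fst l then (a l z - a l z') *\<^sub>R snd l else 0) +
        (axis_increment a ls z j - axis_increment a ls z' j)"
      by (auto simp: axis_increment_def algebra_simps)
    then show "norm (axis_increment a (l # ls) z j - axis_increment a (l # ls) z' j) \<le>
      (if j = fst l then \<bar>a l z - a l z'\<bar> else 0) +
        norm (axis_increment a ls z j - axis_increment a ls z' j)"
      using norm_triangle_ineq[of "if j = fst l then (a l z - a l z') *\<^sub>R snd l else 0"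
          "axis_increment a ls z j - axis_increment a ls z' j"] axes_D(2)[OF l]
      by (auto split: if_splits)
  qed
  also have "\<dots> = \<bar>a l z - a l z'\<bar> + (\<Sum>j<N. norm (axis_increment a ls z j - axis_increment a ls z' j))"
    using axes_D(1)[OF l] by (simp add: sum.distrib)
  also have "\<dots> \<le> K * config_dist N z z' + length ls * (K * config_dist N z z')"
    using Cons by (intro add_mono a_lip assms l) auto
  finally show ?case by (simp add: algebra_simps)
qed (simp add: axis_increment_def)

lemma D_sum_lip:
  assumes "set ls \<subseteq> axes N" "box_config N R z" "box_config N R z'"
  shows "\<bar>(\<Sum>l\<leftarrow>ls. D l z) - (\<Sum>l\<leftarrow>ls. D l z')\<bar> \<le> length ls * (K * config_dist N z z')"
  using assms(1)
proof (induction ls)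
  case (Cons l ls)
  have "\<bar>D l z - D l z'\<bar> \<le> K * config_dist N z z'" using Cons by (intro D_lip assms) auto
  with Cons show ?case by (simp add: algebra_simps)
qed simp

lemma local_estimate:
  assumes "set ls \<subseteq> axes N" and h: "0 \<le> h" "h * K \<le> 1 / 2"
    and "box_config N \<rho> z" "\<rho> + length ls * (h * K) \<le> R"
  shows "(\<Sum>j<N. norm (sweep c h ls z j - z j - h *\<^sub>R axis_increment a ls z j)) \<le> (length ls * (h * K))\<^sup>2 \<and>
    0 < sweep_jac c Dc h ls z \<and>
    \<bar>ln (sweep_jac c Dc h ls z) - h * (\<Sum>l\<leftarrow>ls. D l z)\<bar> \<le> 2 * (length ls * (h * K))\<^sup>2"
  using assms(1,4,5)
proof (induction ls arbitrary: z \<rho>)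
  case (Cons l ls)
  let ?m = "real (length ls)"
  define e where "e = h * K"
  have e: "0 \<le> e" "e \<le> 1 / 2" using h K by (auto simp: e_def)
  have l: "l \<in> axes N" and ls: "set ls \<subseteq> axes N" using Cons by auto
  have "?m * e \<ge> 0" using e by simp
  have m: "\<rho> + (?m + 1) * e \<le> R" using Cons by (simp add: e_def add.commute)
  then have m': "\<rho> + e + ?m * e \<le> R" by (simp add: algebra_simps)
  have zR: "box_config N R z"
    using box_config_near[OF Cons.prems(2), of z 0 R] m' e \<open>?m * e \<ge> 0\<close> by (simp add: config_dist_def)
  define z1 where "z1 = shift l (h * c l z) z"
  have step: "\<bar>h * a l z\<bar> \<le> e"
    using a_bound[OF l zR] h by (simp add: abs_mult e_def mult_left_mono)
  have d: "config_dist N z1 z \<le> e"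
    unfolding z1_def config_dist_shift[OF l] c[OF l zR] by (rule step)
  have z1: "box_config N (\<rho> + e) z1" by (rule box_config_near[OF Cons.prems(2) d]) simp
  have z1R: "box_config N R z1"
    using box_config_near[OF z1, of z1 0 R] m' \<open>?m * e \<ge> 0\<close> by (simp add: config_dist_def)
  note IH = Cons.IH[OF ls z1, unfolded e_def[symmetric], OF m']
  have lipd: "h * (?m * (K * config_dist N z1 z)) \<le> ?m * e\<^sup>2"
  proof -
    have "h * (?m * (K * config_dist N z1 z)) = ?m * (e * config_dist N z1 z)" by (simp add: e_def)
    also have "\<dots> \<le> ?m * (e * e)" using d e by (intro mult_left_mono) auto
    finally show ?thesis by (simp add: power2_eq_square)
  qed
  have "(\<Sum>j<N. norm (sweep c h (l # ls) z j - z j - h *\<^sub>R axis_increment a (l # ls) z j)) \<le>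
     (\<Sum>j<N. norm (sweep c h ls z1 j - z1 j - h *\<^sub>R axis_increment a ls z1 j) +
        h * norm (axis_increment a ls z1 j - axis_increment a ls z j))"
  proof (intro sum_mono)
    fix j
    have "sweep c h (l # ls) z j - z j - h *\<^sub>R axis_increment a (l # ls) z j =
       (sweep c h ls z1 j - z1 j - h *\<^sub>R axis_increment a ls z1 j) +
       h *\<^sub>R (axis_increment a ls z1 j - axis_increment a ls z j)"
      by (auto simp: axis_increment_def z1_def shift_apply c[OF l zR] algebra_simps)
    then show "norm (sweep c h (l # ls) z j - z j - h *\<^sub>R axis_increment a (l # ls) z j) \<le>
      norm (sweep c h ls z1 j - z1 j - h *\<^sub>R axis_increment a ls z1 j) +
        h * norm (axis_increment a ls z1 j - axis_increment a ls z j)"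
      using norm_triangle_ineq h by (metis abs_of_nonneg norm_scaleR)
  qed
  also have "\<dots> \<le> (?m * e)\<^sup>2 + h * (?m * (K * config_dist N z1 z))"
    unfolding sum.distrib sum_distrib_left[symmetric]
    using IH h by (intro add_mono mult_left_mono increment_lip ls z1R zR) auto
  also have "\<dots> \<le> (?m * e)\<^sup>2 + ?m * e\<^sup>2" using lipd by simp
  also have "\<dots> \<le> ((?m + 1) * e)\<^sup>2"
    using e by (simp add: power2_eq_square algebra_simps)
  finally have 1: "(\<Sum>j<N. norm (sweep c h (l # ls) z j - z j - h *\<^sub>R axis_increment a (l # ls) z j)) \<le>
    ((?m + 1) * e)\<^sup>2" .
  have D: "\<bar>h * D l z\<bar> \<le> e" using D_bound[OF l zR] h by (simp add: abs_mult e_def mult_left_mono)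
  have pos: "0 < 1 + h * D l z" using D e by linarith
  have jac: "sweep_jac c Dc h (l # ls) z = (1 + h * D l z) * sweep_jac c Dc h ls z1"
    by (simp add: z1_def Dc[OF l zR])
  have lnj: "ln (sweep_jac c Dc h (l # ls) z) = ln (1 + h * D l z) + ln (sweep_jac c Dc h ls z1)"
    unfolding jac using pos IH by (simp add: ln_mult_pos)
  have "\<bar>ln (1 + h * D l z) - h * D l z\<bar> \<le> 2 * (h * D l z)\<^sup>2"
    by (rule abs_ln_one_plus_x_minus_x_bound) (use D e in linarith)
  also have "\<dots> \<le> 2 * e\<^sup>2" using D e by (intro mult_left_mono) (auto intro!: abs_le_square_iff[THEN iffD1])
  finally have A: "\<bar>ln (1 + h * D l z) - h * D l z\<bar> \<le> 2 * e\<^sup>2" .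
  have "\<bar>h * (\<Sum>l\<leftarrow>ls. D l z1) - h * (\<Sum>l\<leftarrow>ls. D l z)\<bar> = h * \<bar>(\<Sum>l\<leftarrow>ls. D l z1) - (\<Sum>l\<leftarrow>ls. D l z)\<bar>"
    using h by (simp add: abs_mult right_diff_distrib[symmetric])
  also have "\<dots> \<le> h * (?m * (K * config_dist N z1 z))"
    using h by (intro mult_left_mono D_sum_lip ls z1R zR) auto
  finally have B: "\<bar>h * (\<Sum>l\<leftarrow>ls. D l z1) - h * (\<Sum>l\<leftarrow>ls. D l z)\<bar> \<le> ?m * e\<^sup>2"
    using lipd by simp
  have "\<bar>ln (sweep_jac c Dc h (l # ls) z) - h * (\<Sum>l\<leftarrow>l # ls. D l z)\<bar> \<le>
      2 * (?m * e)\<^sup>2 + 2 * e\<^sup>2 + ?m * e\<^sup>2"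
    using A B IH[THEN conjunct2, THEN conjunct2] unfolding lnj sum_list.Cons list.map distrib_left by linarith
  also have "\<dots> \<le> 2 * ((?m + 1) * e)\<^sup>2"
    using e by (simp add: power2_eq_square algebra_simps)
  finally have 2: "\<bar>ln (sweep_jac c Dc h (l # ls) z) - h * (\<Sum>l\<leftarrow>l # ls. D l z)\<bar> \<le>
    2 * ((?m + 1) * e)\<^sup>2" .
  show ?case using 1 2 pos IH unfolding jac e_def by (simp add: add.commute)
qed (simp add: axis_increment_def)

end

section \<open>Global error of the splitting scheme\<close>

lemma mvt_within:
  fixes f f' :: "real \<Rightarrow> real"
  assumes "s < t" "{s..t} \<subseteq> S" and "\<And>u. u \<in> S \<Longrightarrow> (f has_real_derivative f' u) (at u within S)"
  obtains \<xi> where "s < \<xi>" "\<xi> < t" "f t - f s = f' \<xi> * (t - s)"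
proof -
  have "\<exists>\<xi>\<in>{s<..<t}. f t - f s = (\<lambda>v. f' \<xi> * v) (t - s)"
  proof (rule mvt_simple[OF assms(1)])
    fix u assume "s \<le> u" "u \<le> t"
    then have "u \<in> {s..t}" by simp
    then have "(f has_real_derivative f' u) (at u within {s..t})"
      using assms(2,3) by (blast intro: has_field_derivative_subset)
    then show "(f has_derivative (\<lambda>v. f' u * v)) (at u within {s..t})"
      by (simp add: has_field_derivative_def)
  qed
  then show thesis using that by auto
qed

lemma axis_increment_inner:
  assumes ls: "set ls = axes N" "distinct ls" and l: "l \<in> axes N"
  shows "axis_increment a ls z (fst l) \<bullet> snd l = a l z"
proof -
  have "axis_increment a ls z (fst l) \<bullet> snd l =
      (\<Sum>l'\<in>axes N. (if fst l' = fst l then a l' z *\<^sub>R snd l' else 0) \<bullet> snd l)"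
    unfolding axis_increment_def using ls
    by (simp add: sum_list_distinct_conv_sum_set inner_sum_left)
  also have "\<dots> = (\<Sum>l'\<in>axes N. if l' = l then a l z else 0)"
  proof (intro sum.cong refl)
    fix l' :: "nat \<times> 'a" assume "l' \<in> axes N"
    then have "snd l' \<in> Basis" by (rule axes_D)
    then show "(if fst l' = fst l then a l' z *\<^sub>R snd l' else 0) \<bullet> snd l = (if l' = l then a l z else 0)"
      using axes_D(2)[OF l] prod_eqI[of l' l] by (cases "snd l' = snd l") (auto simp: inner_not_same_Basis)
  qed
  also have "\<dots> = a l z" using l by simp
  finally show ?thesis .
qed

lemma norm_triangle_four:
  "norm (a - b + c + d :: 'a::real_normed_vector) \<le> norm a + norm b + norm c + norm d"
  using norm_triangle_ineq[of "a - b + c" d] norm_triangle_ineq[of "a - b" c] norm_triangle_ineq4[of a b]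
  by linarith

context local_sweep
begin

text \<open>A discrete Gronwall argument for the sum of the distance to the trajectory and the error
  of the log-Jacobian. One sweep multiplies the error by at most \<open>1 + C * h\<close> and adds
  \<open>C * h\<^sup>2\<close>; started at 0, this recursion has the solution
  \<open>h * ((1 + C * h) ^ k - 1)\<close>. In \<open>C\<close>, the term \<open>2 * q\<close>
  collects one Lipschitz contribution \<open>h * q * e\<close> from each summand. The 5 counts
  multiples of \<open>(q * h)\<^sup>2\<close>: 1 for the sweep and 1 for the Taylor error of the
  position, 2 for the sweep and 1 for the Taylor error of the logarithm.\<close>

lemma sweep_error:
  fixes X :: "real \<Rightarrow> nat \<Rightarrow> 'a" and \<Lambda> :: "real \<Rightarrow> real"
  assumes ls: "set ls = axes N" "distinct ls" and r: "R = r + 1"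
    and X_box: "\<And>t. t \<in> {0..T} \<Longrightarrow> box_config N r (X t)"
    and dX: "\<And>t l. t \<in> {0..T} \<Longrightarrow> l \<in> axes N \<Longrightarrow>
        ((\<lambda>t. X t (fst l) \<bullet> snd l) has_real_derivative a l (X t)) (at t within {0..T})"
    and d\<Lambda>: "\<And>t. t \<in> {0..T} \<Longrightarrow>
        (\<Lambda> has_real_derivative (\<Sum>l\<in>axes N. D l (X t))) (at t within {0..T})"
    and \<Lambda>0: "\<Lambda> 0 = 0"
  defines "q \<equiv> real (length ls) * K"
  defines "C \<equiv> 2 * q + 5 * q\<^sup>2"
  assumes h: "0 < h" "real n * h = T" "h * K \<le> 1 / 2" "h * q \<le> 1 / 2" "h * exp (C * T) \<le> 1 / 2"
    and k: "k \<le> n"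
  shows "0 < sweep_jac c Dc h (concat (replicate k ls)) (X 0) \<and>
    config_dist N (sweep c h (concat (replicate k ls)) (X 0)) (X (real k * h)) +
    \<bar>ln (sweep_jac c Dc h (concat (replicate k ls)) (X 0)) - \<Lambda> (real k * h)\<bar>
      \<le> h * ((1 + C * h) ^ k - 1)"
proof -
  let ?m = "real (length ls)"
  have m: "length ls = card (axes N :: (nat \<times> 'a) set)" using ls by (metis distinct_card)
  have q: "q \<ge> 0" using K by (simp add: q_def)
  then have C: "C \<ge> 0" by (simp add: C_def)
  have XR: "box_config N R (X t)" if "t \<in> {0..T}" for t
    using X_box[OF that] by (auto simp: box_config_def r intro: order_trans)
  have speed: "config_dist N (X t) (X s) \<le> q * (t - s)" if st: "s \<in> {0..T}" "t \<in> {0..T}" "s \<le> t" for s t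
  proof (cases "s = t")
    case False
    then have "s < t" using st by simp
    have "config_dist N (X t) (X s) \<le> (\<Sum>l\<in>axes N. \<bar>(X t (fst l) - X s (fst l)) \<bullet> snd l\<bar>)"
      unfolding config_dist_def by (rule config_norm_le_sum_axes)
    also have "\<dots> \<le> (\<Sum>l\<in>(axes N :: (nat \<times> 'a) set). K * (t - s))"
    proof (rule sum_mono)
      fix l :: "nat \<times> 'a" assume l: "l \<in> axes N"
      obtain \<xi> where \<xi>: "s < \<xi>" "\<xi> < t"
        "X t (fst l) \<bullet> snd l - X s (fst l) \<bullet> snd l = a l (X \<xi>) * (t - s)"
        using mvt_within[OF \<open>s < t\<close> _ dX[OF _ l]] st by (metis atLeastAtMost_iff atLeastatMost_subset_iff)
      have "\<bar>a l (X \<xi>)\<bar> \<le> K" using \<xi> st by (intro a_bound l XR) auto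
      then show "\<bar>(X t (fst l) - X s (fst l)) \<bullet> snd l\<bar> \<le> K * (t - s)"
        using \<xi>(3) \<open>s < t\<close> by (simp add: inner_diff_left abs_mult mult_right_mono)
    qed
    also have "\<dots> = q * (t - s)" by (simp add: q_def m)
    finally show ?thesis .
  qed (simp add: config_dist_def)
  have taylorX: "(\<Sum>j<N. norm (X (t + h) j - X t j - h *\<^sub>R axis_increment a ls (X t) j)) \<le> (q * h)\<^sup>2"
    if t: "t \<in> {0..T}" "t + h \<in> {0..T}" for t
  proof -
    have "(\<Sum>j<N. norm (X (t + h) j - X t j - h *\<^sub>R axis_increment a ls (X t) j)) \<le>
        (\<Sum>l\<in>axes N. \<bar>(X (t + h) (fst l) - X t (fst l) - h *\<^sub>R axis_increment a ls (X t) (fst l)) \<bullet> snd l\<bar>)"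
      by (rule config_norm_le_sum_axes)
    also have "\<dots> \<le> (\<Sum>l\<in>(axes N :: (nat \<times> 'a) set). h * (K * (q * h)))"
    proof (rule sum_mono)
      fix l :: "nat \<times> 'a" assume l: "l \<in> axes N"
      have "t < t + h" using h by simp
      obtain \<xi> where \<xi>: "t < \<xi>" "\<xi> < t + h"
        "X (t + h) (fst l) \<bullet> snd l - X t (fst l) \<bullet> snd l = a l (X \<xi>) * (t + h - t)"
        using mvt_within[OF \<open>t < t + h\<close> _ dX[OF _ l]] t by (metis atLeastAtMost_iff atLeastatMost_subset_iff)
      have "\<bar>a l (X \<xi>) - a l (X t)\<bar> \<le> K * config_dist N (X \<xi>) (X t)"
        using \<xi> t by (intro a_lip l XR) auto
      also have "\<dots> \<le> K * (q * (\<xi> - t))" using \<xi> t by (intro mult_left_mono speed K) auto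
      also have "\<dots> \<le> K * (q * h)" using \<xi> by (intro mult_left_mono K q) auto
      finally have "h * \<bar>a l (X \<xi>) - a l (X t)\<bar> \<le> h * (K * (q * h))"
        using h by (intro mult_left_mono) auto
      moreover have "(X (t + h) (fst l) - X t (fst l) - h *\<^sub>R axis_increment a ls (X t) (fst l)) \<bullet> snd l =
          h * (a l (X \<xi>) - a l (X t))"
        using \<xi>(3) by (simp add: inner_diff_left axis_increment_inner[OF ls l] algebra_simps)
      ultimately show "\<bar>(X (t + h) (fst l) - X t (fst l) - h *\<^sub>R axis_increment a ls (X t) (fst l)) \<bullet> snd l\<bar>
          \<le> h * (K * (q * h))"
        using h by (simp add: abs_mult)
    qed
    also have "\<dots> = (q * h)\<^sup>2" by (simp add: q_def m power2_eq_square)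
    finally show ?thesis .
  qed
  have Dsum: "(\<Sum>l\<leftarrow>ls. D l z) = (\<Sum>l\<in>axes N. D l z)" for z
    using ls by (simp add: sum_list_distinct_conv_sum_set)
  have taylor\<Lambda>: "\<bar>\<Lambda> (t + h) - \<Lambda> t - h * (\<Sum>l\<leftarrow>ls. D l (X t))\<bar> \<le> (q * h)\<^sup>2"
    if t: "t \<in> {0..T}" "t + h \<in> {0..T}" for t
  proof -
    have "t < t + h" using h by simp
    obtain \<xi> where \<xi>: "t < \<xi>" "\<xi> < t + h"
      "\<Lambda> (t + h) - \<Lambda> t = (\<Sum>l\<in>axes N. D l (X \<xi>)) * (t + h - t)"
      using mvt_within[OF \<open>t < t + h\<close> _ d\<Lambda>] t by (metis atLeastAtMost_iff atLeastatMost_subset_iff)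
    have "\<bar>(\<Sum>l\<leftarrow>ls. D l (X \<xi>)) - (\<Sum>l\<leftarrow>ls. D l (X t))\<bar> \<le> ?m * (K * config_dist N (X \<xi>) (X t))"
      using \<xi> t ls by (intro D_sum_lip XR) auto
    also have "\<dots> \<le> ?m * (K * (q * (\<xi> - t)))" using \<xi> t by (intro mult_left_mono speed K) auto
    also have "\<dots> \<le> ?m * (K * (q * h))" using \<xi> by (intro mult_left_mono K q) auto
    also have "\<dots> = q * (q * h)" by (simp add: q_def)
    finally have "h * \<bar>(\<Sum>l\<leftarrow>ls. D l (X \<xi>)) - (\<Sum>l\<leftarrow>ls. D l (X t))\<bar> \<le> h * (q * (q * h))"
      using h by (intro mult_left_mono) auto
    moreover have "\<Lambda> (t + h) - \<Lambda> t - h * (\<Sum>l\<leftarrow>ls. D l (X t)) =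
        h * ((\<Sum>l\<leftarrow>ls. D l (X \<xi>)) - (\<Sum>l\<leftarrow>ls. D l (X t)))"
      using \<xi>(3) by (simp add: Dsum algebra_simps)
    ultimately show ?thesis using h by (simp add: abs_mult power2_eq_square mult_ac)
  qed
  show ?thesis using k
  proof (induction k)
    case 0
    show ?case using \<Lambda>0 by (simp add: config_dist_def)
  next
    case (Suc k)
    define z where "z = sweep c h (concat (replicate k ls)) (X 0)"
    define J where "J = sweep_jac c Dc h (concat (replicate k ls)) (X 0)"
    define t where "t = real k * h"
    define e where "e = config_dist N z (X t)"
    define E where "E = h * ((1 + C * h) ^ k - 1)"
    have "real (Suc k) * h \<le> real n * h" using Suc.prems h by (intro mult_right_mono) auto
    then have t: "t \<in> {0..T}" "t + h \<in> {0..T}" using h by (auto simp: t_def algebra_simps)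
    have IH: "0 < J" "e + \<bar>ln J - \<Lambda> t\<bar> \<le> E"
      using Suc by (auto simp: z_def J_def t_def e_def E_def)
    have e0: "0 \<le> e" by (simp add: e_def config_dist_nonneg)
    \<comment> \<open>A bootstrap: the bound reached so far is at most
      \<open>h * exp (C * T) \<le> 1 / 2\<close>, so the numerical point lies in the box of radius
      \<open>r + 1 / 2\<close>. The remaining half unit up to \<open>R\<close> is reserved for the
      moves of the next sweep, by \<open>h * q \<le> 1 / 2\<close>.\<close>
    have "(1 + C * h) ^ k \<le> (1 + C * h) ^ n"
      using Suc.prems C h by (intro power_increasing) auto
    also have "\<dots> \<le> exp (C * h) ^ n" using C h by (intro power_mono) (auto simp: add.commute)
    also have "\<dots> = exp (C * T)" using h(2) by (simp add: exp_of_nat_mult[symmetric] algebra_simps)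
    finally have "E \<le> h * exp (C * T)" unfolding E_def using h by (intro mult_left_mono) auto
    then have e: "e \<le> 1 / 2" using IH(2) h(5) by linarith
    have zb: "box_config N (r + 1 / 2) z"
      by (rule box_config_near[OF X_box[OF t(1)], of z "1 / 2"]) (use e in \<open>auto simp: e_def\<close>)
    then have zR: "box_config N R z" by (auto simp: box_config_def r intro: order_trans)
    have le: "(r + 1 / 2) + ?m * (h * K) \<le> R" using h(4) by (simp add: q_def r algebra_simps)
    have "set ls \<subseteq> axes N" using ls by simp
    note loc = local_estimate[OF this less_imp_le[OF h(1)] h(3) zb le]
    have qh: "(?m * (h * K))\<^sup>2 = (q * h)\<^sup>2" by (simp add: q_def mult_ac)
    define z' where "z' = sweep c h ls z"
    define j where "j = sweep_jac c Dc h ls z"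
    have loc1: "(\<Sum>j<N. norm (z' j - z j - h *\<^sub>R axis_increment a ls z j)) \<le> (q * h)\<^sup>2"
      and j: "0 < j" and loc2: "\<bar>ln j - h * (\<Sum>l\<leftarrow>ls. D l z)\<bar> \<le> 2 * (q * h)\<^sup>2"
      using loc unfolding qh z'_def j_def by auto
    have cr: "concat (replicate (Suc k) ls) = concat (replicate k ls) @ ls"
      by (simp only: replicate_Suc replicate_append_same[symmetric] concat_append) simp
    have z': "sweep c h (concat (replicate (Suc k) ls)) (X 0) = z'"
      unfolding cr sweep_append z'_def z_def ..
    have J': "sweep_jac c Dc h (concat (replicate (Suc k) ls)) (X 0) = J * j"
      unfolding cr sweep_jac_append j_def J_def z_def ..
    have lnJ: "ln (J * j) = ln J + ln j" using IH(1) j by (rule ln_mult_pos)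
    have tS: "real (Suc k) * h = t + h" by (simp add: t_def algebra_simps)
    have "config_dist N z' (X (t + h)) \<le>
      (\<Sum>j<N. norm (z' j - z j - h *\<^sub>R axis_increment a ls z j) +
        norm (X (t + h) j - X t j - h *\<^sub>R axis_increment a ls (X t) j) +
        norm (z j - X t j) + h * norm (axis_increment a ls z j - axis_increment a ls (X t) j))"
      unfolding config_dist_def
    proof (rule sum_mono)
      fix i
      let ?A = "z' i - z i - h *\<^sub>R axis_increment a ls z i"
      let ?B = "X (t + h) i - X t i - h *\<^sub>R axis_increment a ls (X t) i"
      let ?C = "axis_increment a ls z i - axis_increment a ls (X t) i"
      have eq: "z' i - X (t + h) i = ?A - ?B + (z i - X t i) + h *\<^sub>R ?C"
        by (simp add: algebra_simps)
      show "norm (z' i - X (t + h) i) \<le> norm ?A + norm ?B + norm (z i - X t i) + h * norm ?C"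
        using norm_triangle_four[of ?A ?B "z i - X t i" "h *\<^sub>R ?C"]
        unfolding eq norm_scaleR abs_of_pos[OF h(1)] .
    qed
    also have "\<dots> \<le> (q * h)\<^sup>2 + (q * h)\<^sup>2 + e + h * (?m * (K * config_dist N z (X t)))"
      unfolding sum.distrib sum_distrib_left[symmetric]
      using h ls loc1 taylorX[OF t]
      by (intro add_mono mult_left_mono increment_lip zR XR t) (auto simp: e_def config_dist_def)
    finally have E1: "config_dist N z' (X (t + h)) \<le> 2 * (q * h)\<^sup>2 + e + h * (q * e)"
      by (simp add: q_def e_def mult_ac)
    have "\<bar>(\<Sum>l\<leftarrow>ls. D l z) - (\<Sum>l\<leftarrow>ls. D l (X t))\<bar> \<le> ?m * (K * config_dist N z (X t))"
      using ls by (intro D_sum_lip zR XR t) auto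
    then have "h * \<bar>(\<Sum>l\<leftarrow>ls. D l z) - (\<Sum>l\<leftarrow>ls. D l (X t))\<bar> \<le> h * (q * e)"
      using h by (intro mult_left_mono) (auto simp: q_def e_def mult_ac)
    then have "\<bar>h * (\<Sum>l\<leftarrow>ls. D l z) - h * (\<Sum>l\<leftarrow>ls. D l (X t))\<bar> \<le> h * (q * e)"
      using h by (simp add: right_diff_distrib[symmetric] abs_mult)
    then have E2: "\<bar>ln (J * j) - \<Lambda> (t + h)\<bar> \<le> \<bar>ln J - \<Lambda> t\<bar> + 3 * (q * h)\<^sup>2 + h * (q * e)"
      unfolding lnJ using loc2 taylor\<Lambda>[OF t] by linarith
    have "config_dist N z' (X (t + h)) + \<bar>ln (J * j) - \<Lambda> (t + h)\<bar> \<le>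
        E + 5 * (q * h)\<^sup>2 + 2 * (h * (q * e))"
      using E1 E2 IH(2) by linarith
    \<comment> \<open>The last two summands are nonnegative and are added only to complete the
      expression to \<open>E * (1 + C * h) + C * h\<^sup>2\<close>.\<close>
    also have "\<dots> \<le> E + 5 * (q * h)\<^sup>2 + 2 * (h * (q * E)) + 2 * q * h\<^sup>2 + 5 * q\<^sup>2 * h * E"
    proof -
      have "e \<le> E" using IH(2) by linarith
      then have "h * (q * e) \<le> h * (q * E)" using h q by (intro mult_left_mono) auto
      moreover have "0 \<le> 2 * q * h\<^sup>2" using q by simp
      moreover have "0 \<le> 5 * q\<^sup>2 * h * E" using \<open>e \<le> E\<close> e0 h q by simp
      ultimately show ?thesis by linarith
    qed
    also have "\<dots> = E * (1 + C * h) + C * h\<^sup>2"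
      by (simp add: C_def algebra_simps power2_eq_square)
    also have "\<dots> = h * ((1 + C * h) ^ Suc k - 1)"
      by (simp add: E_def algebra_simps power2_eq_square)
    finally show ?case unfolding z' J' tS using IH(1) j by simp
  qed
qed

lemma sweep_converges:
  fixes X :: "real \<Rightarrow> nat \<Rightarrow> 'a" and \<Lambda> :: "real \<Rightarrow> real"
  assumes ls: "set ls = axes N" "distinct ls" and r: "R = r + 1" and T: "T > 0"
    and X_box: "\<And>t. t \<in> {0..T} \<Longrightarrow> box_config N r (X t)"
    and dX: "\<And>t l. t \<in> {0..T} \<Longrightarrow> l \<in> axes N \<Longrightarrow>
        ((\<lambda>t. X t (fst l) \<bullet> snd l) has_real_derivative a l (X t)) (at t within {0..T})"
    and d\<Lambda>: "\<And>t. t \<in> {0..T} \<Longrightarrow>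
        (\<Lambda> has_real_derivative (\<Sum>l\<in>axes N. D l (X t))) (at t within {0..T})"
    and \<Lambda>0: "\<Lambda> 0 = 0"
  shows "(\<lambda>n. config_dist N (sweep c (T / real n) (concat (replicate n ls)) (X 0)) (X T)) \<longlonglongrightarrow> 0"
      (is ?dist)
    and "(\<lambda>n. sweep_jac c Dc (T / real n) (concat (replicate n ls)) (X 0)) \<longlonglongrightarrow> exp (\<Lambda> T)"
      (is ?jac)
proof -
  define q where "q = real (length ls) * K"
  define C where "C = 2 * q + 5 * q\<^sup>2"
  have C: "C \<ge> 0" using K by (simp add: q_def C_def)
  have small: "\<forall>\<^sub>F n in sequentially. T / real n * y \<le> 1 / 2" for y
  proof -
    have "(\<lambda>n. T / real n * y) \<longlonglongrightarrow> 0 * y"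
      by (intro tendsto_mult tendsto_const lim_const_over_n)
    then have "\<forall>\<^sub>F n in sequentially. T / real n * y < 1 / 2"
      by (intro order_tendstoD) auto
    then show ?thesis by (auto elim: eventually_mono)
  qed
  let ?S = "\<lambda>n. sweep c (T / real n) (concat (replicate n ls)) (X 0)"
  let ?J = "\<lambda>n. sweep_jac c Dc (T / real n) (concat (replicate n ls)) (X 0)"
  have ev: "\<forall>\<^sub>F n in sequentially. 0 < ?J n \<and>
      config_dist N (?S n) (X T) + \<bar>ln (?J n) - \<Lambda> T\<bar> \<le> T / real n * exp (C * T)"
    using small[of K] small[of q] small[of "exp (C * T)"] eventually_gt_at_top[of 0]
  proof eventually_elim
    case (elim n)
    have nT: "real n * (T / real n) = T" using elim by simp
    have pos: "0 < T / real n" using elim T by simp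
    have "0 < ?J n \<and> config_dist N (?S n) (X T) + \<bar>ln (?J n) - \<Lambda> T\<bar> \<le>
        T / real n * ((1 + C * (T / real n)) ^ n - 1)"
      using sweep_error[OF ls r X_box dX d\<Lambda> \<Lambda>0 pos nT elim(1) elim(2)[unfolded q_def]
          elim(3)[unfolded C_def q_def] order_refl]
      unfolding nT by (simp only: q_def C_def)
    moreover have "(1 + C * (T / real n)) ^ n \<le> exp (C * (T / real n)) ^ n"
      using mult_nonneg_nonneg[OF C less_imp_le[OF pos]] exp_ge_add_one_self[of "C * (T / real n)"]
      by (intro power_mono) (auto simp: add.commute)
    moreover have "exp (C * (T / real n)) ^ n = exp (C * T)"
      using elim by (simp add: exp_of_nat_mult[symmetric])
    ultimately have "0 < ?J n" "config_dist N (?S n) (X T) + \<bar>ln (?J n) - \<Lambda> T\<bar> \<le>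
        T / real n * ((1 + C * (T / real n)) ^ n - 1)"
       "(1 + C * (T / real n)) ^ n - 1 \<le> exp (C * T)" by auto
    then show ?case using pos by (meson mult_left_mono less_imp_le order_trans)
  qed
  have lim: "(\<lambda>n. T / real n * exp (C * T)) \<longlonglongrightarrow> 0"
    using tendsto_mult[OF lim_const_over_n[of T] tendsto_const[of "exp (C * T)"]] by simp
  show ?dist
  proof (rule Lim_null_comparison[OF _ lim])
    show "\<forall>\<^sub>F n in sequentially. norm (config_dist N (?S n) (X T)) \<le> T / real n * exp (C * T)"
      using ev
    proof eventually_elim
      case (elim n)
      then show ?case using config_dist_nonneg[of N "?S n" "X T"] by auto
    qed
  qed
  have "(\<lambda>n. ln (?J n) - \<Lambda> T) \<longlonglongrightarrow> 0"
  proof (rule Lim_null_comparison[OF _ lim])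
    show "\<forall>\<^sub>F n in sequentially. norm (ln (?J n) - \<Lambda> T) \<le> T / real n * exp (C * T)"
      using ev
    proof eventually_elim
      case (elim n)
      then show ?case using config_dist_nonneg[of N "?S n" "X T"] by auto
    qed
  qed
  then have "(\<lambda>n. exp (ln (?J n))) \<longlonglongrightarrow> exp (\<Lambda> T)"
    by (intro tendsto_exp) (simp add: LIM_zero_iff)
  moreover have "\<forall>\<^sub>F n in sequentially. exp (ln (?J n)) = ?J n"
    using ev by eventually_elim auto
  ultimately show ?jac by (rule Lim_transform_eventually)
qed

end

section \<open>Liouville's theorem\<close>

lemma tendsto_fun_componentwise:
  fixes f :: "'b \<Rightarrow> 'i \<Rightarrow> 'a::topological_space"
  assumes "\<And>i. ((\<lambda>c. f c i) \<longlongrightarrow> l i) F"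
  shows "(f \<longlongrightarrow> l) F"
proof -
  have "limitin (product_topology (\<lambda>_. euclidean) UNIV) f l F"
    using assms by (simp add: limitin_componentwise)
  then show ?thesis by (simp add: euclidean_product_topology)
qed

lemma liminf_eventually_const:
  assumes "\<forall>\<^sub>F n in sequentially. f n = (c :: ennreal)"
  shows "liminf f = c"
  using Liminf_eq[OF assms] Liminf_const[of sequentially c] by simp

text \<open>\<open>D l\<close> differentiates the component \<open>a l\<close> along its own axis,
  so the sum of \<open>D\<close> over all axes is the divergence. Lipschitz bounds on
  \<open>D\<close> are imposed too, because the Jacobians of the scheme have to converge along with
  its points.\<close>

locale axis_field =
  fixes N :: nat and a D :: "nat \<times> 'a::euclidean_space \<Rightarrow> (nat \<Rightarrow> 'a) \<Rightarrow> real"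
  assumes a_lip: "\<And>l. l \<in> axes N \<Longrightarrow> lip_on_boxes N (a l)"
    and D_lip: "\<And>l. l \<in> axes N \<Longrightarrow> lip_on_boxes N (D l)"
    and deriv: "\<And>l z. l \<in> axes N \<Longrightarrow> ((\<lambda>s. a l (shift l s z)) has_real_derivative D l z) (at 0)"
begin

text \<open>\<open>\<Lambda>\<close> is the divergence integrated along \<open>X\<close>, prescribed
  by its derivative. Thus \<open>exp (\<Lambda> T)\<close> plays the part of the Jacobian
  determinant at \<open>X 0\<close>, although no flow map is at hand.\<close>

definition axis_trajectory :: "real \<Rightarrow> (real \<Rightarrow> nat \<Rightarrow> 'a) \<Rightarrow> (real \<Rightarrow> real) \<Rightarrow> bool" where
  "axis_trajectory T X \<Lambda> \<longleftrightarrow> \<Lambda> 0 = 0 \<and> (\<forall>t\<in>{0..T}. X t \<in> configs N \<and>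
     (\<forall>l\<in>axes N. ((\<lambda>t. X t (fst l) \<bullet> snd l) has_real_derivative a l (X t)) (at t within {0..T})) \<and>
     (\<Lambda> has_real_derivative (\<Sum>l\<in>axes N. D l (X t))) (at t within {0..T}))"

lemma local_sweep_exists:
  assumes "\<And>l z. l \<in> axes N \<Longrightarrow> box_config N R z \<Longrightarrow> c l z = a l z"
    and "\<And>l z. l \<in> axes N \<Longrightarrow> box_config N R z \<Longrightarrow> Dc l z = D l z"
  obtains K where "local_sweep N a D c Dc R K"
proof -
  have "\<forall>l\<in>axes N. \<exists>K\<ge>0. (\<forall>z. box_config N R z \<longrightarrow> \<bar>a l z\<bar> \<le> K \<and> \<bar>D l z\<bar> \<le> K) \<and>
     (\<forall>z z'. box_config N R z \<longrightarrow> box_config N R z' \<longrightarrow>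
       \<bar>a l z - a l z'\<bar> \<le> K * config_dist N z z' \<and> \<bar>D l z - D l z'\<bar> \<le> K * config_dist N z z')"
  proof
    fix l :: "nat \<times> 'a" assume l: "l \<in> axes N"
    obtain K1 where K1: "K1 \<ge> 0" "\<And>z. box_config N R z \<Longrightarrow> \<bar>a l z\<bar> \<le> K1"
      using lip_on_boxes_bounded[OF a_lip[OF l]] by metis
    obtain K2 where K2: "K2 \<ge> 0" "\<And>z. box_config N R z \<Longrightarrow> \<bar>D l z\<bar> \<le> K2"
      using lip_on_boxes_bounded[OF D_lip[OF l]] by metis
    obtain K3 where K3: "K3 \<ge> 0" "\<And>z z'. box_config N R z \<Longrightarrow> box_config N R z' \<Longrightarrow>
        \<bar>a l z - a l z'\<bar> \<le> K3 * config_dist N z z'"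
      using lip_on_boxesE[OF a_lip[OF l]] by metis
    obtain K4 where K4: "K4 \<ge> 0" "\<And>z z'. box_config N R z \<Longrightarrow> box_config N R z' \<Longrightarrow>
        \<bar>D l z - D l z'\<bar> \<le> K4 * config_dist N z z'"
      using lip_on_boxesE[OF D_lip[OF l]] by metis
    let ?K = "K1 + K2 + K3 + K4"
    have K34: "K3 * config_dist N z z' \<le> ?K * config_dist N z z'" "K4 * config_dist N z z' \<le> ?K * config_dist N z z'"
      for z z' :: "nat \<Rightarrow> 'a"
      using K1 K2 K3 K4 by (intro mult_right_mono config_dist_nonneg; simp)+
    then show "\<exists>K\<ge>0. (\<forall>z. box_config N R z \<longrightarrow> \<bar>a l z\<bar> \<le> K \<and> \<bar>D l z\<bar> \<le> K) \<and>
     (\<forall>z z'. box_config N R z \<longrightarrow> box_config N R z' \<longrightarrow>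
       \<bar>a l z - a l z'\<bar> \<le> K * config_dist N z z' \<and> \<bar>D l z - D l z'\<bar> \<le> K * config_dist N z z')"
    proof (intro exI[of _ ?K] conjI allI impI)
      fix z :: "nat \<Rightarrow> 'a" assume z: "box_config N R z"
      show "\<bar>a l z\<bar> \<le> ?K" using K1(2)[OF z] K2(1) K3(1) K4(1) by linarith
      show "\<bar>D l z\<bar> \<le> ?K" using K2(2)[OF z] K1(1) K3(1) K4(1) by linarith
      fix z' :: "nat \<Rightarrow> 'a" assume z': "box_config N R z'"
      show "\<bar>a l z - a l z'\<bar> \<le> ?K * config_dist N z z'"
        using K3(2)[OF z z'] K34(1) by (rule order_trans)
      show "\<bar>D l z - D l z'\<bar> \<le> ?K * config_dist N z z'"
        using K4(2)[OF z z'] K34(2) by (rule order_trans)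
    qed (use K1 K2 K3 K4 in simp)
  qed
  then obtain k where k: "\<And>l. l \<in> axes N \<Longrightarrow> k l \<ge> 0"
    "\<And>l z. l \<in> axes N \<Longrightarrow> box_config N R z \<Longrightarrow> \<bar>a l z\<bar> \<le> k l \<and> \<bar>D l z\<bar> \<le> k l"
    "\<And>l z z'. l \<in> axes N \<Longrightarrow> box_config N R z \<Longrightarrow> box_config N R z' \<Longrightarrow>
       \<bar>a l z - a l z'\<bar> \<le> k l * config_dist N z z' \<and> \<bar>D l z - D l z'\<bar> \<le> k l * config_dist N z z'"
    unfolding bchoice_iff by metis
  define K where "K = (\<Sum>l\<in>axes N. k l)"
  have kK: "k l \<le> K" if "l \<in> axes N" for l
    unfolding K_def using that k(1) by (intro member_le_sum) auto
  have kKd: "k l * config_dist N z z' \<le> K * config_dist N z z'" if "l \<in> axes N" for l z z'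
    using kK[OF that] by (intro mult_right_mono config_dist_nonneg)
  have "local_sweep N a D c Dc R K"
  proof
    show "K \<ge> 0" unfolding K_def by (intro sum_nonneg k)
  qed (use k kK kKd assms in \<open>meson order_trans\<close>)+
  then show thesis by (rule that)
qed

lemma trajectory_box:
  assumes tr: "axis_trajectory T X \<Lambda>"
  obtains r where "\<And>t. t \<in> {0..T} \<Longrightarrow> box_config N r (X t)"
proof -
  have "\<exists>B. \<forall>t\<in>{0..T}. \<bar>X t (fst l) \<bullet> snd l\<bar> \<le> B" if l: "l \<in> axes N" for l
  proof -
    have "continuous_on {0..T} (\<lambda>t. X t (fst l) \<bullet> snd l)"
      using tr l by (intro DERIV_continuous_on) (auto simp: axis_trajectory_def)
    then have "bounded ((\<lambda>t. X t (fst l) \<bullet> snd l) ` {0..T})"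
      by (intro compact_imp_bounded compact_continuous_image) auto
    then show ?thesis unfolding bounded_iff by auto
  qed
  then obtain B where B: "\<And>l t. l \<in> axes N \<Longrightarrow> t \<in> {0..T} \<Longrightarrow> \<bar>X t (fst l) \<bullet> snd l\<bar> \<le> B l"
    by metis
  show thesis
  proof
    fix t assume t: "t \<in> {0..T}"
    show "box_config N (\<Sum>l\<in>axes N. B l) (X t)"
      unfolding box_config_def
    proof (intro allI impI)
      fix j assume j: "j < N"
      have "norm (X t j) \<le> (\<Sum>j<N. norm (X t j))" using j by (intro member_le_sum) auto
      also have "\<dots> \<le> (\<Sum>l\<in>axes N. \<bar>X t (fst l) \<bullet> snd l\<bar>)" by (rule config_norm_le_sum_axes)
      also have "\<dots> \<le> (\<Sum>l\<in>axes N. B l)" by (intro sum_mono B t)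
      finally show "norm (X t j) \<le> (\<Sum>l\<in>axes N. B l)" .
    qed
  qed
qed

text \<open>
  The function \<open>G\<close> is an iterated lower limit of the integrands of a splitting scheme for the
  truncated fields. This avoids constructing the flow and proving its measurability.
\<close>

lemma liouville_test_function:
  assumes T: "T > 0" and f: "test_function N f" and f0: "\<And>z. 0 \<le> f z"
  obtains G where "G \<in> borel_measurable (config_lborel N)"
    "(\<integral>\<^sup>+z. G z \<partial>config_lborel N) \<le> (\<integral>\<^sup>+z. ennreal (f z) \<partial>config_lborel N)"
    "\<And>X \<Lambda>. axis_trajectory T X \<Lambda> \<Longrightarrow> G (X 0) = ennreal (f (X T) * exp (\<Lambda> T))"
proof -
  obtain ls :: "(nat \<times> 'a) list" where ls: "set ls = axes N" "distinct ls"
    using finite_distinct_list[OF finite_axes] by metis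
  \<comment> \<open>A pair in \<open>Q (r, l)\<close> truncates component \<open>l\<close> at radius
    \<open>r + 1\<close>: a trajectory inside the box of radius \<open>r\<close> needs one further
    unit of room for the numerical points around it.\<close>
  define Q :: "nat \<times> nat \<times> 'a \<Rightarrow> ((nat \<Rightarrow> 'a) \<Rightarrow> real) \<times> ((nat \<Rightarrow> 'a) \<Rightarrow> real) \<Rightarrow> bool" where
    "Q = (\<lambda>(r, l) (c, Dc). test_function N c \<and> test_function N Dc \<and>
      (\<forall>z. ((\<lambda>s. c (shift l s z)) has_real_derivative Dc z) (at 0)) \<and>
      (\<forall>z. box_config N (real r + 1) z \<longrightarrow> c z = a l z \<and> Dc z = D l z))"
  have "\<exists>p. l \<in> axes N \<longrightarrow> Q (r, l) p" for r l
  proof (cases "l \<in> axes N")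
    case True
    from cutoff_exists[OF True lip_on_boxes_continuous[OF a_lip[OF True]]
        lip_on_boxes_continuous[OF D_lip[OF True]] deriv[OF True], of "real r + 1"]
    show ?thesis by (auto simp: Q_def)
  qed simp
  then have "\<forall>q. \<exists>p. snd q \<in> axes N \<longrightarrow> Q q p" by (simp add: split_paired_all)
  from choice[OF this] obtain F where F: "\<And>r l. l \<in> axes N \<Longrightarrow> Q (r, l) (F (r, l))" by fastforce
  define c where "c = (\<lambda>r l. fst (F (r, l)))"
  define Dc where "Dc = (\<lambda>r l. snd (F (r, l)))"
  have "Q (r, l) (c r l, Dc r l)" if "l \<in> axes N" for r l
    using F[OF that] by (simp add: c_def Dc_def)
  then have c: "\<And>r l. l \<in> axes N \<Longrightarrow> test_function N (c r l)"
    and Dc: "\<And>r l. l \<in> axes N \<Longrightarrow> test_function N (Dc r l)"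
    and dc: "\<And>r l z. l \<in> axes N \<Longrightarrow> ((\<lambda>s. c r l (shift l s z)) has_real_derivative Dc r l z) (at 0)"
    and c_box: "\<And>r l z. l \<in> axes N \<Longrightarrow> box_config N (real r + 1) z \<Longrightarrow> c r l z = a l z"
    and Dc_box: "\<And>r l z. l \<in> axes N \<Longrightarrow> box_config N (real r + 1) z \<Longrightarrow> Dc r l z = D l z"
    unfolding Q_def by auto
  define g where "g = (\<lambda>r n z. f (sweep (c r) (T / real n) (concat (replicate n ls)) z) *
      sweep_jac (c r) (Dc r) (T / real n) (concat (replicate n ls)) z)"
  have set_ls: "set (concat (replicate n ls)) \<subseteq> axes N" for n using ls by auto
  have g: "test_function N (g r n)" "(\<integral>z. g r n z \<partial>config_lborel N) = (\<integral>z. f z \<partial>config_lborel N)" for r n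
    using sweep_test_function[OF set_ls f, where c="c r" and Dc="Dc r" and h="T / real n"] c Dc dc
    unfolding g_def test_function_def by blast+
  have gm: "(\<lambda>z. ennreal (g r n z)) \<in> borel_measurable (config_lborel N)" for r n
    using g(1)[of r n]
    by (intro measurable_compose[OF _ measurable_ennreal] continuous_measurable_config)
      (simp add: test_function_def)
  have gml: "(\<lambda>z. liminf (\<lambda>n. ennreal (g r n z))) \<in> borel_measurable (config_lborel N)" for r
    by (intro borel_measurable_liminf gm)
  define G where "G = (\<lambda>z. liminf (\<lambda>r. liminf (\<lambda>n. ennreal (g r n z))))"
  \<comment> \<open>The signed integrals agree for every step size. Since \<open>Dc r l\<close> is
    bounded on \<open>configs N\<close>, for large \<open>n\<close> all Jacobian factors are
    nonnegative and the nonnegative integrals agree as well.\<close>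
  have ev: "\<forall>\<^sub>F n in sequentially. (\<integral>\<^sup>+z. ennreal (g r n z) \<partial>config_lborel N) = (\<integral>\<^sup>+z. ennreal (f z) \<partial>config_lborel N)" for r
  proof -
    have "\<forall>l\<in>axes N. \<exists>B\<ge>0. \<forall>z\<in>configs N. \<bar>Dc r l z\<bar> \<le> B"
      using test_function_bounded[OF Dc] by (metis less_imp_le)
    then obtain B where B: "\<And>l. l \<in> axes N \<Longrightarrow> 0 \<le> B l"
      "\<And>l z. l \<in> axes N \<Longrightarrow> z \<in> configs N \<Longrightarrow> \<bar>Dc r l z\<bar> \<le> B l"
      unfolding bchoice_iff by metis
    have "(\<lambda>n. T / real n * (\<Sum>l\<in>axes N. B l)) \<longlonglongrightarrow> 0 * (\<Sum>l\<in>axes N. B l)"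
      by (intro tendsto_mult tendsto_const lim_const_over_n)
    then have "\<forall>\<^sub>F n in sequentially. T / real n * (\<Sum>l\<in>axes N. B l) < 1"
      by (intro order_tendstoD) auto
    then show ?thesis
    proof eventually_elim
      case (elim n)
      have pos: "0 \<le> 1 + T / real n * Dc r l z" if "l \<in> axes N" "z \<in> configs N" for l z
      proof -
        have "B l \<le> (\<Sum>l\<in>axes N. B l)" using that B by (intro member_le_sum) auto
        then have "\<bar>Dc r l z\<bar> \<le> (\<Sum>l\<in>axes N. B l)" using B(2)[OF that] by simp
        then have "\<bar>T / real n * Dc r l z\<bar> \<le> T / real n * (\<Sum>l\<in>axes N. B l)"
          unfolding abs_mult using T by (intro mult_mono) auto
        then show ?thesis using elim by linarith
      qed
      have g0: "0 \<le> g r n z" if "z \<in> configs N" for z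
        unfolding g_def by (intro mult_nonneg_nonneg f0 sweep_jac_nonneg[OF set_ls that] pos)
      have "(\<integral>\<^sup>+z. ennreal (g r n z) \<partial>config_lborel N) = ennreal (\<integral>z. g r n z \<partial>config_lborel N)"
        using g0 by (intro nn_integral_eq_integral test_function_integrable g AE_I2) simp
      also have "\<dots> = (\<integral>\<^sup>+z. ennreal (f z) \<partial>config_lborel N)"
        unfolding g(2) using f0 by (intro nn_integral_eq_integral[symmetric] test_function_integrable f AE_I2)
      finally show ?case .
    qed
  qed
  show thesis
  proof
    show "G \<in> borel_measurable (config_lborel N)"
      unfolding G_def by (intro borel_measurable_liminf gml)
    have "(\<integral>\<^sup>+z. G z \<partial>config_lborel N) \<le>
        liminf (\<lambda>r. (\<integral>\<^sup>+z. liminf (\<lambda>n. ennreal (g r n z)) \<partial>config_lborel N))"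
      unfolding G_def by (intro nn_integral_liminf gml)
    also have "\<dots> \<le> liminf (\<lambda>r. liminf (\<lambda>n. (\<integral>\<^sup>+z. ennreal (g r n z) \<partial>config_lborel N)))"
      by (intro Liminf_mono always_eventually allI nn_integral_liminf gm)
    also have "\<dots> = liminf (\<lambda>r::nat. (\<integral>\<^sup>+z. ennreal (f z) \<partial>config_lborel N))"
      using ev by (intro arg_cong[where f=liminf] ext liminf_eventually_const)
    also have "\<dots> = (\<integral>\<^sup>+z. ennreal (f z) \<partial>config_lborel N)"
      by (simp add: Liminf_const)
    finally show "(\<integral>\<^sup>+z. G z \<partial>config_lborel N) \<le> (\<integral>\<^sup>+z. ennreal (f z) \<partial>config_lborel N)" .
  next
    fix X \<Lambda> assume tr: "axis_trajectory T X \<Lambda>"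
    have X: "X t \<in> configs N" if "t \<in> {0..T}" for t
      using tr that by (auto simp: axis_trajectory_def)
    obtain r0 where r0: "\<And>t. t \<in> {0..T} \<Longrightarrow> box_config N r0 (X t)"
      using trajectory_box[OF tr] by metis
    \<comment> \<open>Once \<open>r\<close> exceeds a radius containing the trajectory, the inner
      limit is attained with a value independent of \<open>r\<close>. Hence the outer lower limit is
      that of an eventually constant sequence.\<close>
    have lim: "liminf (\<lambda>n. ennreal (g r n (X 0))) = ennreal (f (X T) * exp (\<Lambda> T))" if r: "real r \<ge> r0" for r
    proof -
      obtain K where "local_sweep N a D (c r) (Dc r) (real r + 1) K"
        using local_sweep_exists[of "real r + 1" "c r" "Dc r"] c_box Dc_box by metis
      then interpret local_sweep N a D "c r" "Dc r" "real r + 1" K .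
      have bx: "box_config N (real r) (X t)" if "t \<in> {0..T}" for t
        using r0[OF that] r by (auto simp: box_config_def intro: order_trans)
      let ?S = "\<lambda>n. sweep (c r) (T / real n) (concat (replicate n ls)) (X 0)"
      have S: "(\<lambda>n. config_dist N (?S n) (X T)) \<longlonglongrightarrow> 0"
        and J: "(\<lambda>n. sweep_jac (c r) (Dc r) (T / real n) (concat (replicate n ls)) (X 0)) \<longlonglongrightarrow> exp (\<Lambda> T)"
        using sweep_converges[where X=X and \<Lambda>=\<Lambda>, OF ls refl T bx] tr unfolding axis_trajectory_def by blast+
      have "?S \<longlonglongrightarrow> X T"
      proof (rule tendsto_fun_componentwise)
        fix j
        show "(\<lambda>n. ?S n j) \<longlonglongrightarrow> X T j"
        proof (cases "j < N")
          case True
          have "(\<lambda>n. ?S n j - X T j) \<longlonglongrightarrow> 0"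
            by (rule Lim_null_comparison[OF _ S]) (auto intro!: always_eventually norm_le_config_dist True)
          then show ?thesis by (simp add: LIM_zero_iff)
        next
          case False
          have "?S n \<in> configs N" for n using T by (intro sweep_configs set_ls X) auto
          moreover have "X T \<in> configs N" using T by (intro X) auto
          ultimately have "?S n j = X T j" for n
            using False by (auto simp: configs_def PiE_def extensional_def)
          then show ?thesis by simp
        qed
      qed
      moreover have "isCont f (X T)"
        using f by (simp add: test_function_def continuous_on_eq_continuous_at)
      ultimately have "(\<lambda>n. f (?S n)) \<longlonglongrightarrow> f (X T)"
        by (rule isCont_tendsto_compose[rotated])
      then have "(\<lambda>n. ennreal (g r n (X 0))) \<longlonglongrightarrow> ennreal (f (X T) * exp (\<Lambda> T))"
        unfolding g_def by (intro tendsto_ennrealI tendsto_mult J)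
      then show ?thesis by (intro lim_imp_Liminf) auto
    qed
    have "\<forall>\<^sub>F r in sequentially. real r \<ge> r0"
      using filterlim_real_sequentially unfolding filterlim_at_top by blast
    then have "\<forall>\<^sub>F r in sequentially. liminf (\<lambda>n. ennreal (g r n (X 0))) = ennreal (f (X T) * exp (\<Lambda> T))"
      by eventually_elim (rule lim)
    then show "G (X 0) = ennreal (f (X T) * exp (\<Lambda> T))"
      unfolding G_def by (rule liminf_eventually_const)
  qed
qed

end

section \<open>From test functions to Borel sets\<close>

text \<open>For open \<open>U\<close> inside some \<open>B k\<close>, the functions
  \<open>min 1 (m * infdist z (- U))\<close> are test functions increasing to the indicator of
  \<open>U\<close>. Outer regularity passes to Borel subsets of \<open>B k\<close>, and exhaustion
  by the \<open>B k\<close> to all Borel sets.\<close>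

lemma emeasure_le_of_test_functions:
  fixes \<nu> :: "(nat \<Rightarrow> 'a::euclidean_space) measure"
  assumes N: "N > 0" and [measurable_cong]: "sets \<nu> = sets borel"
    and le: "\<And>f. test_function N f \<Longrightarrow> (\<And>z. 0 \<le> f z) \<Longrightarrow>
      (\<integral>\<^sup>+z. ennreal (f z) \<partial>\<nu>) \<le> (\<integral>\<^sup>+z. ennreal (f z) \<partial>config_lborel N)"
    and A: "A \<in> sets borel"
  shows "emeasure \<nu> A \<le> emeasure (distr (config_lborel N) borel (\<lambda>z. z)) A"
proof -
  define \<mu> where "\<mu> = distr (config_lborel N) borel (\<lambda>z :: nat \<Rightarrow> 'a. z)"
  have [measurable_cong]: "sets \<mu> = sets borel" by (simp add: \<mu>_def)
  have \<mu>I: "(\<integral>\<^sup>+z. f z \<partial>\<mu>) = (\<integral>\<^sup>+z. f z \<partial>config_lborel N)" if "f \<in> borel_measurable borel" for f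
    unfolding \<mu>_def using that by (intro nn_integral_distr) auto
  define B where "B = (\<lambda>k::nat. {z :: nat \<Rightarrow> 'a. \<forall>j<N. norm (z j) < real k})"
  have oB: "open (B k)" for k
  proof -
    have "open {z :: nat \<Rightarrow> 'a. norm (z j) < real k}" for j
      by (intro open_Collect_less continuous_intros continuous_on_product_coordinates)
    then have "open (\<Inter>j\<in>{..<N}. {z :: nat \<Rightarrow> 'a. norm (z j) < real k})"
      by (intro open_INT) auto
    moreover have "(\<Inter>j\<in>{..<N}. {z :: nat \<Rightarrow> 'a. norm (z j) < real k}) = B k" by (auto simp: B_def)
    ultimately show ?thesis by simp
  qed
  have [measurable]: "B k \<in> sets borel" for k using oB by simp
  have opens: "emeasure \<nu> U \<le> emeasure \<mu> U" if U: "open U" "U \<subseteq> B k" for U k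
  proof -
    have Uc: "closed (- U)" using U(1) unfolding open_closed .
    obtain b :: 'a where b: "b \<in> Basis" by (rule nonempty_Basis[THEN ex_in_conv[THEN iffD2, THEN exE]])
    \<comment> \<open>\<open>infdist\<close> to the empty set is 0 by convention, so the
      approximation needs a nonempty complement of \<open>U\<close>. With at least one particle and
      \<open>U \<subseteq> B k\<close>, a configuration of norm \<open>k\<close> lies
      outside.\<close>
    have "(\<lambda>_. real k *\<^sub>R b) \<notin> B k" using b N by (auto simp: B_def)
    then have ne: "- U \<noteq> {}" using U by auto
    define F where "F = (\<lambda>(m::nat) z. min 1 (real m * infdist z (- U)))"
    have cF: "continuous_on UNIV (F m)" for m
      unfolding F_def by (intro continuous_intros continuous_on_infdist) 
    have F0: "0 \<le> F m z" for m z by (simp add: F_def infdist_nonneg)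
    have FU: "F m z = 0" if "z \<notin> U" for m z
      using that by (simp add: F_def)
    have F1: "F m z \<le> 1" for m z by (simp add: F_def)
    have test: "test_function N (F m)" for m
      unfolding test_function_def
    proof (intro conjI cF exI[of _ "real k"] allI impI)
      fix z :: "nat \<Rightarrow> 'a" assume "\<exists>j<N. real k < norm (z j)"
      then have "z \<notin> B k" by (auto simp: B_def not_less intro: less_imp_le)
      then show "F m z = 0" using U by (intro FU) auto
    qed
    have [measurable]: "U \<in> sets borel" "F m \<in> borel_measurable borel" for m
      using U cF by (auto intro: borel_measurable_continuous_onI)
    have Flim: "(\<lambda>m. ennreal (F m z)) \<longlonglongrightarrow> indicator U z" for z
    proof (cases "z \<in> U")
      case True
      then have "infdist z (- U) > 0"
        using in_closed_iff_infdist_zero[OF Uc ne, of z] infdist_nonneg[of z "- U"] by fastforce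
      then obtain m0 where m0: "1 / infdist z (- U) < real m0" "infdist z (- U) > 0"
        using reals_Archimedean2 by metis
      have "F m z = 1" if "m \<ge> m0" for m
      proof -
        have "1 / infdist z (- U) \<le> real m" using m0 that by simp
        then show ?thesis using m0(2) by (simp add: F_def min_def field_simps)
      qed
      then have "\<forall>\<^sub>F m in sequentially. ennreal (F m z) = indicator U z"
        using True unfolding eventually_sequentially by (auto intro!: exI[of _ m0])
      then show ?thesis by (rule tendsto_eventually)
    qed (simp add: FU)
    have inc: "incseq (\<lambda>m z. ennreal (F m z))"
      by (auto simp: incseq_def le_fun_def F_def intro!: ennreal_leI min.mono mult_right_mono infdist_nonneg)
    have "(\<lambda>m. \<integral>\<^sup>+z. ennreal (F m z) \<partial>\<nu>) \<longlonglongrightarrow> (\<integral>\<^sup>+z. indicator U z \<partial>\<nu>)"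
    proof (rule nn_integral_LIMSEQ[OF inc _ Flim])
      show "(\<lambda>z. ennreal (F m z)) \<in> borel_measurable \<nu>" for m
        using borel_measurable_continuous_onI[OF cF[of m]] measurable_cong_sets[OF \<open>sets \<nu> = sets borel\<close> refl]
        by (intro measurable_compose[OF _ measurable_ennreal]) blast
    qed
    moreover have "(\<integral>\<^sup>+z. ennreal (F m z) \<partial>\<nu>) \<le> emeasure \<mu> U" for m
    proof -
      have "(\<integral>\<^sup>+z. ennreal (F m z) \<partial>\<nu>) \<le> (\<integral>\<^sup>+z. ennreal (F m z) \<partial>\<mu>)"
        using le[OF test F0] by (simp add: \<mu>I)
      also have "\<dots> \<le> (\<integral>\<^sup>+z. indicator U z \<partial>\<mu>)"
        using F1 FU by (intro nn_integral_mono) (auto simp: indicator_def)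
      finally show ?thesis by simp
    qed
    ultimately show ?thesis by (intro LIMSEQ_le_const2) auto
  qed
  have bounded: "emeasure \<nu> A \<le> emeasure \<mu> A" if [measurable]: "A \<in> sets borel" and AB: "A \<subseteq> B k" for A k
  proof -
    \<comment> \<open>Outer regularity is available for finite measures, and \<open>\<mu>\<close>
      has infinite mass. Restricting it to \<open>B k\<close> is harmless because the open sets are
      intersected with \<open>B k\<close> before the two measures are compared.\<close>
    define \<mu>' where "\<mu>' = density \<mu> (indicator (B k))"
    have [measurable_cong]: "sets \<mu>' = sets borel"
      by (simp add: \<mu>'_def \<open>sets \<mu> = sets borel\<close>)
    have \<mu>': "emeasure \<mu>' S = emeasure \<mu> (B k \<inter> S)" if "S \<in> sets borel" for S
    proof -
      have "emeasure \<mu>' S = (\<integral>\<^sup>+z. indicator (B k) z * indicator S z \<partial>\<mu>)"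
        unfolding \<mu>'_def using that
        by (intro emeasure_density borel_measurable_indicator) (auto simp: \<open>sets \<mu> = sets borel\<close> oB)
      also have "\<dots> = (\<integral>\<^sup>+z. indicator (B k \<inter> S) z \<partial>\<mu>)"
        by (simp add: indicator_inter_arith)
      also have "\<dots> = emeasure \<mu> (B k \<inter> S)"
        using that by (intro nn_integral_indicator) (simp add: \<open>sets \<mu> = sets borel\<close>)
      finally show ?thesis .
    qed
    have fin: "emeasure \<mu>' (space \<mu>') \<noteq> \<infinity>"
    proof -
      interpret product_sigma_finite "\<lambda>_::nat. lborel :: 'a measure" by (rule sigma_finite_config)
      have "emeasure \<mu>' (space \<mu>') = emeasure \<mu> (B k)"
        using \<mu>'[of UNIV] by (simp add: \<mu>'_def \<mu>_def)
      also have "\<dots> = emeasure (config_lborel N) (B k \<inter> configs N)"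
        unfolding \<mu>_def by (subst emeasure_distr) auto
      also have "B k \<inter> configs N = PiE {..<N} (\<lambda>_. ball 0 (real k))"
        by (auto simp: B_def configs_def PiE_def Pi_def)
      also have "emeasure (config_lborel N) (PiE {..<N} (\<lambda>_. ball (0::'a) (real k))) < \<infinity>"
        unfolding config_lborel_def using emeasure_lborel_ball_finite[of "0::'a" "real k"]
        by (subst emeasure_PiM) (auto simp: prod_constant power_less_top_ennreal)
      finally show ?thesis by simp
    qed
    have "emeasure \<nu> A \<le> emeasure \<mu>' U" if U: "open U" "A \<subseteq> U" for U
    proof -
      have "emeasure \<nu> A \<le> emeasure \<nu> (B k \<inter> U)"
        using U AB by (intro emeasure_mono) (auto simp: \<open>sets \<nu> = sets borel\<close> oB)
      also have "\<dots> \<le> emeasure \<mu> (B k \<inter> U)" using U oB by (intro opens[of _ k]) auto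
      also have "\<dots> = emeasure \<mu>' U" using U by (simp add: \<mu>')
      finally show ?thesis .
    qed
    then have "emeasure \<nu> A \<le> (INF U\<in>{U. A \<subseteq> U \<and> open U}. emeasure \<mu>' U)"
      by (intro INF_greatest) auto
    also have "\<dots> = emeasure \<mu>' A"
      by (rule outer_regular[symmetric]) (use fin in \<open>auto simp: \<mu>'_def \<mu>_def\<close>)
    also have "\<dots> = emeasure \<mu> A" using AB by (simp add: \<mu>' Int_absorb1)
    finally show ?thesis .
  qed
  have inc: "incseq (\<lambda>k. A \<inter> B k)"
    by (auto simp: incseq_def B_def intro: less_le_trans)
  have un: "(\<Union>k. A \<inter> B k) = A"
  proof -
    have "\<exists>k. z \<in> B k" for z :: "nat \<Rightarrow> 'a"
    proof -
      obtain k where k: "(\<Sum>j<N. norm (z j)) < real k" using reals_Archimedean2 by metis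
      have "norm (z j) \<le> (\<Sum>j<N. norm (z j))" if "j < N" for j
        using that by (intro member_le_sum) auto
      then have "z \<in> B k" using k le_less_trans by (fastforce simp: B_def)
      then show ?thesis ..
    qed
    then show ?thesis by auto
  qed
  have rg: "range (\<lambda>k. A \<inter> B k) \<subseteq> sets borel"
    using A oB by auto
  have "(\<lambda>k. emeasure \<nu> (A \<inter> B k)) \<longlonglongrightarrow> emeasure \<nu> A"
    using Lim_emeasure_incseq[OF _ inc, of \<nu>] rg unfolding un by (simp add: \<open>sets \<nu> = sets borel\<close>)
  moreover have "(\<lambda>k. emeasure \<mu> (A \<inter> B k)) \<longlonglongrightarrow> emeasure \<mu> A"
    using Lim_emeasure_incseq[OF _ inc, of \<mu>] rg unfolding un by (simp add: \<open>sets \<mu> = sets borel\<close>)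
  moreover have "emeasure \<nu> (A \<inter> B k) \<le> emeasure \<mu> (A \<inter> B k)" for k
    using rg by (intro bounded[of _ k]) auto
  ultimately have "emeasure \<nu> A \<le> emeasure \<mu> A"
    by (intro LIMSEQ_le) auto
  then show ?thesis by (simp add: \<mu>_def)
qed

section \<open>Derivatives in the reproducing kernel Hilbert space\<close>

lemma Ck_continuous: "Ck m f \<Longrightarrow> continuous_on UNIV f"
  by (cases m) (auto intro: differentiable_imp_continuous_on)

lemma Ck_has_derivative:
  "Ck (Suc m) f \<Longrightarrow> (f has_derivative frechet_derivative f (at x)) (at x)"
  by (auto simp: differentiable_on_def frechet_derivative_works)

lemma Ck_partial: "Ck (Suc m) f \<Longrightarrow> b \<in> Basis \<Longrightarrow> Ck m (\<lambda>x. frechet_derivative f (at x) b)"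
  by simp

lemma Ck_frechet_linear: "Ck (Suc m) f \<Longrightarrow> linear (frechet_derivative f (at x))"
  using Ck_has_derivative has_derivative_linear by blast

lemma Ck_lipschitz_cball:
  fixes f :: "'a::euclidean_space \<Rightarrow> real"
  assumes f: "Ck (Suc m) f"
  obtains L where "L \<ge> 0"
    "\<And>x y. norm x \<le> R \<Longrightarrow> norm y \<le> R \<Longrightarrow> \<bar>f x - f y\<bar> \<le> L * norm (x - y)"
proof -
  have "\<forall>b\<in>Basis. \<exists>B\<ge>0. \<forall>x\<in>cball 0 R. \<bar>frechet_derivative f (at x) b\<bar> \<le> B"
  proof
    fix b :: 'a assume "b \<in> Basis"
    then have "continuous_on UNIV (\<lambda>x. frechet_derivative f (at x) b)"
      using Ck_continuous[OF Ck_partial[OF f]] by blast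
    then have "bounded ((\<lambda>x. frechet_derivative f (at x) b) ` cball 0 R)"
      by (intro compact_imp_bounded compact_continuous_image) (auto intro: continuous_on_subset)
    then show "\<exists>B\<ge>0. \<forall>x\<in>cball 0 R. \<bar>frechet_derivative f (at x) b\<bar> \<le> B"
      unfolding bounded_pos by (auto intro: less_imp_le)
  qed
  then obtain B where B: "\<And>b. b \<in> Basis \<Longrightarrow> B b \<ge> 0"
    "\<And>b x. b \<in> Basis \<Longrightarrow> x \<in> cball 0 R \<Longrightarrow> \<bar>frechet_derivative f (at x) b\<bar> \<le> B b"
    unfolding bchoice_iff by metis
  have "\<bar>f x - f y\<bar> \<le> (\<Sum>b\<in>Basis. B b) * norm (x - y)" if "norm x \<le> R" "norm y \<le> R" for x y
  proof -
    have "norm (f x - f y) \<le> (\<Sum>b\<in>Basis. B b) * norm (x - y)"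
    proof (rule differentiable_bound[where S="cball 0 R" and f'="\<lambda>x. frechet_derivative f (at x)"])
      fix x :: 'a assume x: "x \<in> cball 0 R"
      show "(f has_derivative frechet_derivative f (at x)) (at x within cball 0 R)"
        by (rule has_derivative_at_withinI[OF Ck_has_derivative[OF f]])
      show "onorm (frechet_derivative f (at x)) \<le> (\<Sum>b\<in>Basis. B b)"
      proof (rule onorm_le)
        fix v :: 'a
        have "frechet_derivative f (at x) v = (\<Sum>b\<in>Basis. (v \<bullet> b) * frechet_derivative f (at x) b)"
        proof -
          interpret linear "frechet_derivative f (at x)" by (rule Ck_frechet_linear[OF f])
          have "frechet_derivative f (at x) v = frechet_derivative f (at x) (\<Sum>b\<in>Basis. (v \<bullet> b) *\<^sub>R b)"
            by (simp only: euclidean_representation)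
          then show ?thesis by (simp only: sum scale real_scaleR_def)
        qed
        then have "norm (frechet_derivative f (at x) v) \<le> (\<Sum>b\<in>Basis. \<bar>(v \<bullet> b) * frechet_derivative f (at x) b\<bar>)"
          by simp
        also have "\<dots> \<le> (\<Sum>b\<in>Basis. norm v * B b)"
          unfolding abs_mult using B x by (intro sum_mono mult_mono Basis_le_norm) auto
        also have "\<dots> = (\<Sum>b\<in>Basis. B b) * norm v"
          unfolding sum_distrib_right by (simp only: mult.commute)
        finally show "norm (frechet_derivative f (at x) v) \<le> (\<Sum>b\<in>Basis. B b) * norm v" .
      qed
    qed (use that in auto)
    then show ?thesis by simp
  qed
  then show thesis using B by (intro that[of "\<Sum>b\<in>Basis. B b"]) (auto intro: sum_nonneg)
qed

lemma Ck_line_derivative: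
  fixes f :: "'a::euclidean_space \<Rightarrow> real"
  assumes f: "Ck (Suc m) f"
  shows "((\<lambda>s. f (p + s *\<^sub>R v)) has_real_derivative frechet_derivative f (at (p + s *\<^sub>R v)) v) (at s)"
proof -
  have g: "((\<lambda>s. p + s *\<^sub>R v) has_derivative (\<lambda>h. h *\<^sub>R v)) (at s)"
    by (auto intro!: derivative_eq_intros)
  have "((\<lambda>s. f (p + s *\<^sub>R v)) has_derivative (\<lambda>h. frechet_derivative f (at (p + s *\<^sub>R v)) (h *\<^sub>R v))) (at s)"
    by (rule has_derivative_compose[OF g Ck_has_derivative[OF f]])
  moreover have "(\<lambda>h. frechet_derivative f (at (p + s *\<^sub>R v)) (h *\<^sub>R v)) =
      (*) (frechet_derivative f (at (p + s *\<^sub>R v)) v)"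
    using Ck_frechet_linear[OF f, of "p + s *\<^sub>R v"] by (simp add: fun_eq_iff linear_cmul mult.commute)
  ultimately show ?thesis by (simp add: has_field_derivative_def)
qed

section \<open>Inner product identities\<close>

context rkhs
begin

lemma diff_mem: "f \<in> H \<Longrightarrow> g \<in> H \<Longrightarrow> (\<lambda>x. f x - g x) \<in> H"
  using add_mem[OF _ scale_mem[of g "-1"]] by simp

lemma sum_mem: "(\<And>i. i \<in> I \<Longrightarrow> f i \<in> H) \<Longrightarrow> (\<lambda>x. \<Sum>i\<in>I. f i x) \<in> H"
  by (induction I rule: infinite_finite_induct) (auto intro: zero_mem add_mem)

lemma ip_zero: "g \<in> H \<Longrightarrow> ip (\<lambda>x. 0) g = 0"
  using ip_scale[OF zero_mem, of g 0] by simp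

lemma ip_diff: "f \<in> H \<Longrightarrow> g \<in> H \<Longrightarrow> h \<in> H \<Longrightarrow> ip (\<lambda>x. f x - g x) h = ip f h - ip g h"
  using ip_add[OF _ scale_mem[of g "-1"]] ip_scale[of g h "-1"] by simp

lemma ip_diff_right: "f \<in> H \<Longrightarrow> g \<in> H \<Longrightarrow> h \<in> H \<Longrightarrow> ip h (\<lambda>x. f x - g x) = ip h f - ip h g"
  using ip_diff[of f g h] ip_sym diff_mem by metis

lemma ip_scale_right: "f \<in> H \<Longrightarrow> g \<in> H \<Longrightarrow> ip g (\<lambda>x. c * f x) = c * ip g f"
  using ip_scale[of f g c] ip_sym scale_mem by metis

lemma ip_add_right: "f \<in> H \<Longrightarrow> g \<in> H \<Longrightarrow> h \<in> H \<Longrightarrow> ip h (\<lambda>x. f x + g x) = ip h f + ip h g"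
  using ip_add[of f g h] ip_sym add_mem by metis

lemma ip_sum_right:
  "(\<And>i. i \<in> I \<Longrightarrow> f i \<in> H) \<Longrightarrow> g \<in> H \<Longrightarrow> ip g (\<lambda>x. \<Sum>i\<in>I. f i x) = (\<Sum>i\<in>I. ip g (f i))"
proof (induction I rule: infinite_finite_induct)
  case (insert i I)
  then show ?case using sum_mem[of I f] by (simp add: ip_add_right)
qed (use ip_zero ip_sym zero_mem in auto)

lemma ip_diff_diff:
  assumes "f \<in> H" "g \<in> H"
  shows "ip (\<lambda>x. f x - g x) (\<lambda>x. f x - g x) = ip f f - 2 * ip f g + ip g g"
  using assms by (simp add: ip_diff ip_diff_right diff_mem ip_sym[of g f])

text \<open>\<open>H\<close> is a carrier set with an explicit inner product, not a type of a normed
  class. The inequality comes from nonnegativity of the square of \<open>f - c * g\<close> at the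
  projection coefficient \<open>c\<close>; definiteness settles the case of vanishing
  \<open>g\<close>.\<close>

lemma Cauchy_Schwarz_rkhs:
  assumes f: "f \<in> H" and g: "g \<in> H"
  shows "\<bar>ip f g\<bar> \<le> sqrt (ip f f) * sqrt (ip g g)"
proof -
  have "(ip f g)\<^sup>2 \<le> ip f f * ip g g"
  proof (cases "ip g g = 0")
    case True
    then have "ip f g = 0" using ip_definite[OF g] ip_zero[OF f] ip_sym[OF f g] by simp
    then show ?thesis using True by simp
  next
    case False
    then have pos: "ip g g > 0" using ip_nonneg[OF g] by simp
    define c where "c = ip f g / ip g g"
    have cg: "(\<lambda>x. c * g x) \<in> H" by (rule scale_mem[OF g])
    have "0 \<le> ip (\<lambda>x. f x - c * g x) (\<lambda>x. f x - c * g x)" by (intro ip_nonneg diff_mem f cg)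
    also have "\<dots> = ip f f - 2 * (c * ip f g) + c * (c * ip g g)"
      using ip_diff_diff[OF f cg] f g cg by (simp add: ip_scale ip_scale_right)
    also have "\<dots> = ip f f - (ip f g)\<^sup>2 / ip g g"
      using pos by (simp add: c_def power2_eq_square)
    finally show ?thesis using pos by (simp add: field_simps)
  qed
  then have "sqrt ((ip f g)\<^sup>2) \<le> sqrt (ip f f * ip g g)" by (rule real_sqrt_le_mono)
  then show ?thesis by (simp add: real_sqrt_mult)
qed

lemma kernel_ip: "ip (k x) (k y) = k x y"
  using reproducing[OF kernel_mem, of x y] by simp

lemma kernel_sym: "k x y = k y x"
  using kernel_ip ip_sym kernel_mem by metis

end

section \<open>Partial derivatives of the kernel\<close>

locale smooth_rkhs = rkhs k H ip
  for k :: "'a::euclidean_space \<Rightarrow> 'a \<Rightarrow> real" and H ip +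
  assumes smooth: "Ck 3 (\<lambda>(y, z). k y z)"
begin

definition k2 :: "'a \<Rightarrow> 'a \<times> 'a \<Rightarrow> real" where
  "k2 v p = frechet_derivative (\<lambda>(y, z). k y z) (at p) (0, v)"

definition k12 :: "'a \<Rightarrow> 'a \<Rightarrow> 'a \<times> 'a \<Rightarrow> real" where
  "k12 u v p = frechet_derivative (k2 v) (at p) (u, 0)"

definition k22 :: "'a \<Rightarrow> 'a \<Rightarrow> 'a \<times> 'a \<Rightarrow> real" where
  "k22 u v p = frechet_derivative (k2 v) (at p) (0, u)"

lemma smooth': "Ck (Suc 2) (\<lambda>(y, z). k y z)"
  using smooth by (simp add: numeral_3_eq_3 numeral_2_eq_2)

lemma Basis_Pair: "b \<in> Basis \<Longrightarrow> (b, 0) \<in> Basis" "b \<in> Basis \<Longrightarrow> (0, b) \<in> Basis"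
  by (auto simp: Basis_prod_def)

lemma Ck_k2: "b \<in> Basis \<Longrightarrow> Ck 2 (k2 b)"
  using Ck_partial[OF smooth' Basis_Pair(2)] by (simp add: k2_def[abs_def])

lemma Ck_k2': "b \<in> Basis \<Longrightarrow> Ck (Suc 1) (k2 b)"
  using Ck_k2 by (simp add: numeral_2_eq_2)

lemma Ck_k12: "u \<in> Basis \<Longrightarrow> v \<in> Basis \<Longrightarrow> Ck 1 (k12 u v)"
  using Ck_partial[OF Ck_k2' Basis_Pair(1)] by (simp add: k12_def[abs_def])

lemma Ck_k22: "u \<in> Basis \<Longrightarrow> v \<in> Basis \<Longrightarrow> Ck 1 (k22 u v)"
  using Ck_partial[OF Ck_k2' Basis_Pair(2)] by (simp add: k22_def[abs_def])

text \<open>\<open>Ck\<close> speaks of basis directions. Expanding a direction in the basis carries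
  differentiability and continuity over to arbitrary directions, which occur later as
  \<open>y - x\<close> in the proof of differentiability.\<close>

lemma k2_expand: "k2 v p = (\<Sum>b\<in>Basis. (v \<bullet> b) * k2 b p)"
proof -
  interpret linear "frechet_derivative (\<lambda>(y, z). k y z) (at p)"
    by (rule Ck_frechet_linear[OF smooth'])
  have "(0::'a, v) = (\<Sum>b\<in>Basis. (v \<bullet> b) *\<^sub>R (0, b))"
    by (simp add: prod_eq_iff fst_sum snd_sum euclidean_representation)
  show ?thesis unfolding k2_def
    by (subst \<open>(0, v) = _\<close>) (simp only: sum scale real_scaleR_def)
qed

lemma k2_has_derivative:
  "(k2 v has_derivative (\<lambda>h. \<Sum>b\<in>Basis. (v \<bullet> b) * frechet_derivative (k2 b) (at p) h)) (at p)"
  unfolding k2_expand[of v, abs_def]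
  by (intro has_derivative_sum has_derivative_mult_right Ck_has_derivative[OF Ck_k2'])

lemma k12_expand: "k12 u v p = (\<Sum>b\<in>Basis. \<Sum>c\<in>Basis. (v \<bullet> b) * ((u \<bullet> c) * k12 c b p))"
proof -
  have "k12 u v p = (\<Sum>b\<in>Basis. (v \<bullet> b) * frechet_derivative (k2 b) (at p) (u, 0))"
    using fun_cong[OF frechet_derivative_at[OF k2_has_derivative[of v p]], of "(u, 0)"] by (simp add: k12_def)
  also have "\<dots> = (\<Sum>b\<in>Basis. (v \<bullet> b) * (\<Sum>c\<in>Basis. (u \<bullet> c) * k12 c b p))"
  proof (intro sum.cong refl)
    fix b :: 'a assume b: "b \<in> Basis"
    interpret linear "frechet_derivative (k2 b) (at p)" by (rule Ck_frechet_linear[OF Ck_k2'[OF b]])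
    have "(u, 0::'a) = (\<Sum>c\<in>Basis. (u \<bullet> c) *\<^sub>R (c, 0))"
      by (simp add: prod_eq_iff fst_sum snd_sum euclidean_representation)
    show "(v \<bullet> b) * frechet_derivative (k2 b) (at p) (u, 0) = (v \<bullet> b) * (\<Sum>c\<in>Basis. (u \<bullet> c) * k12 c b p)"
      unfolding k12_def by (subst \<open>(u, 0) = _\<close>) (simp only: sum scale real_scaleR_def)
  qed
  finally show ?thesis by (simp add: sum_distrib_left)
qed

lemma k_line2: "((\<lambda>t. k x (y + t *\<^sub>R v)) has_real_derivative k2 v (x, y + t *\<^sub>R v)) (at t)"
  using Ck_line_derivative[OF smooth', of "(x, y)" "(0, v)" t] by (simp add: k2_def)

lemma k2_line1: "((\<lambda>s. k2 v (x + s *\<^sub>R u, y)) has_real_derivative k12 u v (x + s *\<^sub>R u, y)) (at s)"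
proof -
  have g: "((\<lambda>s. (x + s *\<^sub>R u, y)) has_derivative (\<lambda>h. h *\<^sub>R (u, 0))) (at s)"
    by (auto intro!: derivative_eq_intros)
  have d: "(k2 v has_derivative frechet_derivative (k2 v) (at p)) (at p)" for p
    using k2_has_derivative[of v p] frechet_derivative_at[OF k2_has_derivative[of v p]] by simp
  have "(\<lambda>h. frechet_derivative (k2 v) (at p) (h *\<^sub>R (u, 0))) = (*) (frechet_derivative (k2 v) (at p) (u, 0))" for p
    using has_derivative_linear[OF d[of p]] by (simp add: fun_eq_iff linear_cmul mult.commute del: scaleR_Pair)
  then show ?thesis
    using has_derivative_compose[OF g d]
    by (simp add: has_field_derivative_def k12_def del: scaleR_Pair)
qed

text \<open>Mean value theorem in each of the two variables.\<close>

lemma second_difference: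
  obtains \<xi> \<eta> where "\<bar>\<xi>\<bar> \<le> \<bar>h\<bar>" "\<bar>\<eta>\<bar> \<le> \<bar>h'\<bar>"
    "k (x + h *\<^sub>R v) (x + h' *\<^sub>R v) - k (x + h *\<^sub>R v) x - k x (x + h' *\<^sub>R v) + k x x =
      h * h' * k12 v v (x + \<xi> *\<^sub>R v, x + \<eta> *\<^sub>R v)"
proof -
  have mvt: "\<exists>c. \<bar>c\<bar> \<le> \<bar>h\<bar> \<and> f h - f 0 = h * f' c"
    if "\<And>s. (f has_real_derivative f' s) (at s)" for f f' :: "real \<Rightarrow> real" and h
  proof -
    consider "h = 0" | "h > 0" | "h < 0" by linarith
    then show ?thesis
    proof cases
      case 2
      with MVT2[OF 2 that] show ?thesis by (metis abs_of_nonneg diff_zero less_imp_le)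
    next
      case 3
      from MVT2[OF 3 that] obtain c where "h < c" "c < 0" "f 0 - f h = (0 - h) * f' c" by metis
      then show ?thesis by (intro exI[of _ c]) (auto simp: algebra_simps)
    qed auto
  qed
  have "((\<lambda>t. k (x + h *\<^sub>R v) (x + t *\<^sub>R v) - k x (x + t *\<^sub>R v)) has_real_derivative
      k2 v (x + h *\<^sub>R v, x + t *\<^sub>R v) - k2 v (x, x + t *\<^sub>R v)) (at t)" for t
    by (intro derivative_intros k_line2)
  from mvt[OF this, of h'] obtain \<eta> where \<eta>: "\<bar>\<eta>\<bar> \<le> \<bar>h'\<bar>"
    "k (x + h *\<^sub>R v) (x + h' *\<^sub>R v) - k x (x + h' *\<^sub>R v) - (k (x + h *\<^sub>R v) x - k x x) =
     h' * (k2 v (x + h *\<^sub>R v, x + \<eta> *\<^sub>R v) - k2 v (x, x + \<eta> *\<^sub>R v))"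
    by auto
  from mvt[OF k2_line1[of v x v "x + \<eta> *\<^sub>R v"], of h] obtain \<xi> where \<xi>: "\<bar>\<xi>\<bar> \<le> \<bar>h\<bar>"
    "k2 v (x + h *\<^sub>R v, x + \<eta> *\<^sub>R v) - k2 v (x, x + \<eta> *\<^sub>R v) = h * k12 v v (x + \<xi> *\<^sub>R v, x + \<eta> *\<^sub>R v)"
    by auto
  show thesis
  proof (rule that[OF \<xi>(1) \<eta>(1)])
    show "k (x + h *\<^sub>R v) (x + h' *\<^sub>R v) - k (x + h *\<^sub>R v) x - k x (x + h' *\<^sub>R v) + k x x =
      h * h' * k12 v v (x + \<xi> *\<^sub>R v, x + \<eta> *\<^sub>R v)"
      using \<eta>(2) unfolding \<xi>(2) by (simp add: algebra_simps)
  qed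
qed

lemma continuous_k12: "continuous_on UNIV (k12 u v)"
  unfolding k12_expand[of u v, abs_def]
  by (intro continuous_intros Ck_continuous[OF Ck_k12])

end

context rkhs
begin

text \<open>The parallelogram law with one square dropped. It replaces the triangle inequality and
  avoids square roots.\<close>

lemma ip_diff_le:
  assumes a: "a \<in> H" and b: "b \<in> H" and c: "c \<in> H"
  shows "ip (\<lambda>x. a x - c x) (\<lambda>x. a x - c x) \<le>
    2 * ip (\<lambda>x. a x - b x) (\<lambda>x. a x - b x) + 2 * ip (\<lambda>x. b x - c x) (\<lambda>x. b x - c x)"
proof -
  define u where "u = (\<lambda>x. a x - b x)"
  define w where "w = (\<lambda>x. b x - c x)"
  have u: "u \<in> H" and w: "w \<in> H" unfolding u_def w_def by (intro diff_mem a b c)+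
  have ac: "(\<lambda>x. a x - c x) = (\<lambda>x. u x + w x)" by (simp add: u_def w_def)
  have "0 \<le> ip (\<lambda>x. u x - w x) (\<lambda>x. u x - w x)" by (intro ip_nonneg diff_mem u w)
  moreover have "ip (\<lambda>x. u x + w x) (\<lambda>x. u x + w x) = ip u u + 2 * ip u w + ip w w"
    using u w by (simp add: ip_add ip_add_right add_mem ip_sym[of w u])
  ultimately show ?thesis
    unfolding ac u_def[symmetric] w_def[symmetric] using ip_diff_diff[OF u w] by simp
qed

end

context smooth_rkhs
begin

text \<open>The derivative of the feature map \<open>k\<close> at \<open>x\<close> in direction
  \<open>v\<close>. By symmetry of the kernel, differentiating \<open>k x y\<close> in
  \<open>x\<close> amounts to differentiating the second argument of \<open>k y x\<close>.\<close>

definition deriv_repr :: "'a \<Rightarrow> 'a \<Rightarrow> 'a \<Rightarrow> real" where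
  "deriv_repr v x = (\<lambda>y. k2 v (y, x))"

definition diff_quot :: "'a \<Rightarrow> 'a \<Rightarrow> real \<Rightarrow> 'a \<Rightarrow> real" where
  "diff_quot v x h = (\<lambda>y. (1 / h) * (k (x + h *\<^sub>R v) y - k x y))"

lemma diff_quot_mem: "diff_quot v x h \<in> H"
  unfolding diff_quot_def by (intro scale_mem diff_mem kernel_mem)

lemma ip_diff_quot:
  assumes f: "f \<in> H"
  shows "ip f (diff_quot v x h) = (f (x + h *\<^sub>R v) - f x) / h"
proof -
  have 1: "ip f (diff_quot v x h) = 1 / h * ip f (\<lambda>y. k (x + h *\<^sub>R v) y - k x y)"
    unfolding diff_quot_def by (rule ip_scale_right[OF diff_mem[OF kernel_mem kernel_mem] f])
  have 2: "ip f (\<lambda>y. k (x + h *\<^sub>R v) y - k x y) = ip f (k (x + h *\<^sub>R v)) - ip f (k x)"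
    by (rule ip_diff_right[OF kernel_mem kernel_mem f])
  show ?thesis
    unfolding 1 2 by (simp add: reproducing[OF f, of x] reproducing[OF f, of "x + h *\<^sub>R v"])
qed

lemma ip_diff_quot_diff_quot:
  assumes "h \<noteq> 0" "h' \<noteq> 0"
  obtains \<xi> \<eta> where "\<bar>\<xi>\<bar> \<le> \<bar>h\<bar>" "\<bar>\<eta>\<bar> \<le> \<bar>h'\<bar>"
    "ip (diff_quot v x h) (diff_quot v x h') = k12 v v (x + \<xi> *\<^sub>R v, x + \<eta> *\<^sub>R v)"
proof -
  obtain \<xi> \<eta> where *: "\<bar>\<xi>\<bar> \<le> \<bar>h\<bar>" "\<bar>\<eta>\<bar> \<le> \<bar>h'\<bar>"
    "k (x + h *\<^sub>R v) (x + h' *\<^sub>R v) - k (x + h *\<^sub>R v) x - k x (x + h' *\<^sub>R v) + k x x =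
      h * h' * k12 v v (x + \<xi> *\<^sub>R v, x + \<eta> *\<^sub>R v)"
    by (rule second_difference[where v=v and x=x and h=h and h'=h'])
  have "ip (diff_quot v x h) (diff_quot v x h') =
      (k (x + h *\<^sub>R v) (x + h' *\<^sub>R v) - k (x + h *\<^sub>R v) x - k x (x + h' *\<^sub>R v) + k x x) / (h * h')"
    unfolding ip_diff_quot[OF diff_quot_mem] using assms by (simp add: diff_quot_def field_simps)
  then show thesis using *(3) assms by (intro that[OF *(1,2)]) simp
qed

text \<open>All inner products of difference quotients are values of \<open>k12 v v\<close> close to
  \<open>(x, x)\<close>, so they have a common limit and the three terms of the squared distance
  cancel. Their coefficients 1, -2 and 1 explain the \<open>e / 4\<close>.\<close>

lemma diff_quot_limit:
  assumes "e > 0"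
  shows "\<exists>\<delta>>0. \<forall>h h'. h \<noteq> 0 \<longrightarrow> h' \<noteq> 0 \<longrightarrow> \<bar>h\<bar> < \<delta> \<longrightarrow> \<bar>h'\<bar> < \<delta> \<longrightarrow>
    ip (\<lambda>y. diff_quot v x h y - diff_quot v x h' y) (\<lambda>y. diff_quot v x h y - diff_quot v x h' y) < e"
proof -
  let ?F = "\<lambda>q. k12 v v (x + fst q *\<^sub>R v, x + snd q *\<^sub>R v)"
  have "continuous_on UNIV ?F"
    by (intro continuous_on_compose2[OF continuous_k12] continuous_intros) auto
  then have "isCont ?F (0, 0)" by (simp add: continuous_on_eq_continuous_at)
  moreover have "e / 4 > 0" using assms by simp
  ultimately obtain d where d: "d > 0" "\<And>q. dist q (0, 0) < d \<Longrightarrow> dist (?F q) (?F (0, 0)) < e / 4"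
    unfolding continuous_at_eps_delta by meson
  have near: "\<bar>ip (diff_quot v x h) (diff_quot v x h') - k12 v v (x, x)\<bar> < e / 4"
    if h: "h \<noteq> 0" "h' \<noteq> 0" "\<bar>h\<bar> < d / 2" "\<bar>h'\<bar> < d / 2" for h h'
  proof -
    obtain \<xi> \<eta> where *: "\<bar>\<xi>\<bar> \<le> \<bar>h\<bar>" "\<bar>\<eta>\<bar> \<le> \<bar>h'\<bar>"
      "ip (diff_quot v x h) (diff_quot v x h') = k12 v v (x + \<xi> *\<^sub>R v, x + \<eta> *\<^sub>R v)"
      by (rule ip_diff_quot_diff_quot[OF h(1,2), where v=v and x=x])
    have "dist (\<xi>, \<eta>) (0, 0) \<le> \<bar>\<xi>\<bar> + \<bar>\<eta>\<bar>"
      using norm_Pair_le[of \<xi> \<eta>] by (simp add: dist_norm)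
    then have "dist (\<xi>, \<eta>) (0, 0) < d" using * h by linarith
    from d(2)[OF this] show ?thesis unfolding *(3) by (simp add: dist_real_def)
  qed
  show ?thesis
  proof (intro exI[of _ "d / 2"] conjI allI impI)
    fix h h' :: real assume h: "h \<noteq> 0" "h' \<noteq> 0" "\<bar>h\<bar> < d / 2" "\<bar>h'\<bar> < d / 2"
    show "ip (\<lambda>y. diff_quot v x h y - diff_quot v x h' y) (\<lambda>y. diff_quot v x h y - diff_quot v x h' y) < e"
      unfolding ip_diff_diff[OF diff_quot_mem diff_quot_mem]
      using near[of h h] near[of h h'] near[of h' h'] h unfolding abs_less_iff by linarith
  qed (use d in simp)
qed

text \<open>
  The difference quotients of \<open>k x\<close> form a Cauchy sequence in \<open>H\<close>. Their limit represents the directional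
  derivative, and the reproducing property identifies it with a partial derivative of \<open>k\<close>.
\<close>

lemma
  shows deriv_repr_mem: "deriv_repr v x \<in> H"
    and line_derivative_at_0: "\<And>f. f \<in> H \<Longrightarrow>
      ((\<lambda>s. f (x + s *\<^sub>R v)) has_real_derivative ip f (deriv_repr v x)) (at 0)"
proof -
  let ?q = "diff_quot v x"
  define F where "F = (\<lambda>n::nat. ?q (1 / real (Suc n)))"
  have FH: "F n \<in> H" for n by (simp add: F_def diff_quot_mem)
  have "\<exists>f\<in>H. (\<lambda>n. sqrt (ip (\<lambda>x. F n x - f x) (\<lambda>x. F n x - f x))) \<longlonglongrightarrow> 0"
  proof (rule complete[OF FH])
    fix e :: real assume e: "e > 0"
    then have e2: "e\<^sup>2 > 0" by simp
    from diff_quot_limit[OF e2, of v x] obtain \<delta> where "0 < \<delta> \<and>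
        (\<forall>h h'. h \<noteq> 0 \<longrightarrow> h' \<noteq> 0 \<longrightarrow> \<bar>h\<bar> < \<delta> \<longrightarrow> \<bar>h'\<bar> < \<delta> \<longrightarrow>
          ip (\<lambda>y. ?q h y - ?q h' y) (\<lambda>y. ?q h y - ?q h' y) < e\<^sup>2)" ..
    note \<delta> = this[THEN conjunct1] this[THEN conjunct2, rule_format]
    obtain n0 where n0: "1 / real (Suc n0) < \<delta>" using \<delta>(1) nat_approx_posE by metis
    have small: "\<bar>1 / real (Suc n)\<bar> < \<delta>" if "n \<ge> n0" for n
    proof -
      have "1 / real (Suc n) \<le> 1 / real (Suc n0)" using that by (intro divide_left_mono) auto
      then show ?thesis using n0 by simp
    qed
    show "\<exists>n0. \<forall>m\<ge>n0. \<forall>n\<ge>n0. sqrt (ip (\<lambda>x. F m x - F n x) (\<lambda>x. F m x - F n x)) < e"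
    proof (intro exI[of _ n0] allI impI)
      fix m n assume "m \<ge> n0" "n \<ge> n0"
      then have "ip (\<lambda>x. F m x - F n x) (\<lambda>x. F m x - F n x) < e\<^sup>2"
        unfolding F_def by (intro \<delta>(2) small) auto
      then show "sqrt (ip (\<lambda>x. F m x - F n x) (\<lambda>x. F m x - F n x)) < e"
        using e by (intro real_less_lsqrt) auto
    qed
  qed
  then obtain D where D: "D \<in> H" "(\<lambda>n. sqrt (ip (\<lambda>x. F n x - D x) (\<lambda>x. F n x - D x))) \<longlonglongrightarrow> 0"
    by blast
  \<comment> \<open>Completeness supplies a limit along \<open>1 / (n + 1)\<close> only. The Cauchy
    property in \<open>h\<close> extends it to all small \<open>h\<close>; \<open>e / 4\<close> is
    chosen for the factors 2 in \<open>ip_diff_le\<close>.\<close>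
  have approx: "\<exists>\<delta>>0. \<forall>h. h \<noteq> 0 \<longrightarrow> \<bar>h\<bar> < \<delta> \<longrightarrow> ip (\<lambda>y. ?q h y - D y) (\<lambda>y. ?q h y - D y) < e"
    if e: "e > 0" for e
  proof -
    have e4: "e / 4 > 0" using e by simp
    from diff_quot_limit[OF e4, of v x] obtain \<delta> where "0 < \<delta> \<and>
        (\<forall>h h'. h \<noteq> 0 \<longrightarrow> h' \<noteq> 0 \<longrightarrow> \<bar>h\<bar> < \<delta> \<longrightarrow> \<bar>h'\<bar> < \<delta> \<longrightarrow>
          ip (\<lambda>y. ?q h y - ?q h' y) (\<lambda>y. ?q h y - ?q h' y) < e / 4)" ..
    note \<delta> = this[THEN conjunct1] this[THEN conjunct2, rule_format]
    have "\<forall>\<^sub>F n in sequentially. sqrt (ip (\<lambda>x. F n x - D x) (\<lambda>x. F n x - D x)) < sqrt (e / 4)"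
      using e by (intro order_tendstoD(2)[OF D(2)]) simp
    moreover have "\<forall>\<^sub>F n in sequentially. 1 / real (Suc n) < \<delta>"
      using LIMSEQ_inverse_real_of_nat[THEN order_tendstoD(2), OF \<delta>(1)] by (simp add: divide_inverse)
    ultimately have "\<forall>\<^sub>F n in sequentially. sqrt (ip (\<lambda>x. F n x - D x) (\<lambda>x. F n x - D x)) < sqrt (e / 4) \<and>
        1 / real (Suc n) < \<delta>" by (rule eventually_conj)
    then obtain n where n: "ip (\<lambda>x. F n x - D x) (\<lambda>x. F n x - D x) < e / 4" "1 / real (Suc n) < \<delta>"
      unfolding eventually_sequentially by auto
    show ?thesis
    proof (intro exI[of _ \<delta>] conjI allI impI \<delta>(1))
      fix h :: real assume h: "h \<noteq> 0" "\<bar>h\<bar> < \<delta>"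
      have "ip (\<lambda>y. ?q h y - F n y) (\<lambda>y. ?q h y - F n y) < e / 4"
        unfolding F_def using h n by (intro \<delta>(2)) auto
      then show "ip (\<lambda>y. ?q h y - D y) (\<lambda>y. ?q h y - D y) < e"
        using ip_diff_le[OF diff_quot_mem FH D(1), of v x h n] n(1) by linarith
    qed
  qed
  have deriv: "((\<lambda>s. f (x + s *\<^sub>R v)) has_real_derivative ip f D) (at 0)" if f: "f \<in> H" for f
  proof -
    have "((\<lambda>h. (f (x + h *\<^sub>R v) - f x) / h) \<longlongrightarrow> ip f D) (at 0)"
    proof (rule LIM_I)
      fix r :: real assume r: "r > 0"
      \<comment> \<open>Chosen so that Cauchy-Schwarz gives an error below \<open>r\<close>; the
        summand 1 keeps the divisor positive when \<open>ip f f = 0\<close>.\<close>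
      define e where "e = (r / (sqrt (ip f f) + 1))\<^sup>2"
      have pos: "sqrt (ip f f) + 1 > 0" using ip_nonneg[OF f] by (simp add: add_nonneg_pos)
      then have "e > 0" using r by (simp add: e_def)
      from approx[OF this] obtain \<delta> where \<delta>: "\<delta> > 0"
        "\<And>h. h \<noteq> 0 \<Longrightarrow> \<bar>h\<bar> < \<delta> \<Longrightarrow> ip (\<lambda>y. ?q h y - D y) (\<lambda>y. ?q h y - D y) < e" by auto
      show "\<exists>s>0. \<forall>h. h \<noteq> 0 \<and> norm (h - 0) < s \<longrightarrow> norm ((f (x + h *\<^sub>R v) - f x) / h - ip f D) < r"
      proof (intro exI[of _ \<delta>] conjI allI impI \<delta>(1))
        fix h :: real assume "h \<noteq> 0 \<and> norm (h - 0) < \<delta>"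
        then have *: "ip (\<lambda>y. ?q h y - D y) (\<lambda>y. ?q h y - D y) < e" using \<delta>(2) by simp
        have "norm ((f (x + h *\<^sub>R v) - f x) / h - ip f D) = \<bar>ip f (\<lambda>y. ?q h y - D y)\<bar>"
          by (simp add: ip_diff_right f diff_quot_mem D(1) ip_diff_quot)
        also have "\<dots> \<le> sqrt (ip f f) * sqrt (ip (\<lambda>y. ?q h y - D y) (\<lambda>y. ?q h y - D y))"
          by (intro Cauchy_Schwarz_rkhs f diff_mem diff_quot_mem D(1))
        also have "\<dots> \<le> sqrt (ip f f) * sqrt e"
          using * ip_nonneg[OF f] by (intro mult_left_mono real_sqrt_le_mono) auto
        also have "\<dots> = sqrt (ip f f) * (r / (sqrt (ip f f) + 1))"
          using r pos by (simp add: e_def real_sqrt_divide)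
        also have "\<dots> < r" using r pos by (simp add: field_simps)
        finally show "norm ((f (x + h *\<^sub>R v) - f x) / h - ip f D) < r" .
      qed
    qed
    then show ?thesis by (simp add: DERIV_def)
  qed
  have "D = deriv_repr v x"
  proof
    fix y
    have "((\<lambda>s. k y (x + s *\<^sub>R v)) has_real_derivative ip (k y) D) (at 0)"
      by (rule deriv[OF kernel_mem])
    moreover have "((\<lambda>s. k y (x + s *\<^sub>R v)) has_real_derivative k2 v (y, x)) (at 0)"
      using k_line2[of y x v 0] by simp
    ultimately have "ip (k y) D = k2 v (y, x)" by (rule DERIV_unique)
    then show "D y = deriv_repr v x y"
      using reproducing[OF D(1)] ip_sym[OF D(1) kernel_mem] by (simp add: deriv_repr_def)
  qed
  then show "deriv_repr v x \<in> H" "\<And>f. f \<in> H \<Longrightarrow>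
      ((\<lambda>s. f (x + s *\<^sub>R v)) has_real_derivative ip f (deriv_repr v x)) (at 0)"
    using D(1) deriv by auto
qed

lemma ip_deriv_repr: "ip (deriv_repr v y) (deriv_repr u x) = k12 u v (x, y)"
proof (rule DERIV_unique)
  show "((\<lambda>s. deriv_repr v y (x + s *\<^sub>R u)) has_real_derivative ip (deriv_repr v y) (deriv_repr u x)) (at 0)"
    by (rule line_derivative_at_0[OF deriv_repr_mem])
  show "((\<lambda>s. deriv_repr v y (x + s *\<^sub>R u)) has_real_derivative k12 u v (x, y)) (at 0)"
    using k2_line1[of v x u y 0] by (simp add: deriv_repr_def)
qed

lemma ip_deriv_repr_kernel: "ip (deriv_repr v y) (k x) = k2 v (x, y)"
  using reproducing[OF deriv_repr_mem, of v y x, symmetric] by (simp add: deriv_repr_def)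

lemma deriv_repr_expand: "deriv_repr v x = (\<lambda>y. \<Sum>b\<in>Basis. (v \<bullet> b) * deriv_repr b x y)"
  unfolding deriv_repr_def by (rule ext) (rule k2_expand)

lemma ip_deriv_repr_expand:
  assumes "f \<in> H"
  shows "ip f (deriv_repr v x) = (\<Sum>b\<in>Basis. (v \<bullet> b) * ip f (deriv_repr b x))"
proof -
  have mem: "(\<lambda>y. (v \<bullet> b) * deriv_repr b x y) \<in> H" for b
    by (rule scale_mem[OF deriv_repr_mem])
  have "ip f (\<lambda>y. \<Sum>b\<in>Basis. (v \<bullet> b) * deriv_repr b x y) =
      (\<Sum>b\<in>Basis. ip f (\<lambda>y. (v \<bullet> b) * deriv_repr b x y))"
    by (rule ip_sum_right[OF mem assms])
  then show ?thesis
    unfolding deriv_repr_expand[of v x, symmetric] ip_scale_right[OF deriv_repr_mem assms] .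
qed

lemma line_derivative:
  assumes "f \<in> H"
  shows "((\<lambda>s. f (x + s *\<^sub>R v)) has_real_derivative ip f (deriv_repr v (x + t *\<^sub>R v))) (at t)"
proof -
  have "((\<lambda>s. f (x + (s + t) *\<^sub>R v)) has_real_derivative ip f (deriv_repr v (x + t *\<^sub>R v))) (at 0)"
    using line_derivative_at_0[OF assms, of "x + t *\<^sub>R v" v] by (simp add: algebra_simps)
  then show ?thesis
    using DERIV_shift[of "\<lambda>s. f (x + s *\<^sub>R v)" "ip f (deriv_repr v (x + t *\<^sub>R v))" 0 t] by simp
qed

text \<open>The squared norm is a combination of values of \<open>k12 v v\<close> that cancels at
  \<open>y = x\<close>, and \<open>\<omega>\<close> is a modulus of continuity for the finitely many
  basis components of \<open>k12\<close>. The direction enters only through the factor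
  \<open>norm v\<close>, and this uniformity is what turns directional derivatives into a Frechet
  derivative.\<close>

lemma deriv_repr_near:
  assumes e: "e > 0"
  shows "\<exists>d>0. \<forall>y v. dist y x < d \<longrightarrow>
    ip (\<lambda>w. deriv_repr v y w - deriv_repr v x w) (\<lambda>w. deriv_repr v y w - deriv_repr v x w) \<le> (e * norm v)\<^sup>2"
proof -
  define \<omega> where "\<omega> = (\<lambda>p. \<Sum>b\<in>Basis. \<Sum>c\<in>Basis. \<bar>k12 c b p - k12 c b (x, x)\<bar>)"
  have \<omega>: "\<bar>k12 v v p - k12 v v (x, x)\<bar> \<le> (norm v)\<^sup>2 * \<omega> p" for v p
  proof -
    have eq: "k12 v v p - k12 v v (x, x) =
        (\<Sum>b\<in>Basis. \<Sum>c\<in>Basis. (v \<bullet> b) * ((v \<bullet> c) * (k12 c b p - k12 c b (x, x))))"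
      by (simp only: k12_expand[of v v p] k12_expand[of v v "(x, x)"] sum_subtractf right_diff_distrib)
    have "\<bar>k12 v v p - k12 v v (x, x)\<bar> \<le> (\<Sum>b\<in>Basis. \<Sum>c\<in>Basis. \<bar>(v \<bullet> b) * ((v \<bullet> c) * (k12 c b p - k12 c b (x, x)))\<bar>)"
      unfolding eq by (intro order_trans[OF sum_abs] sum_mono) simp
    also have "\<dots> \<le> (\<Sum>b\<in>Basis. \<Sum>c\<in>Basis. norm v * (norm v * \<bar>k12 c b p - k12 c b (x, x)\<bar>))"
      unfolding abs_mult by (intro sum_mono mult_mono Basis_le_norm) auto
    also have "\<dots> = (norm v)\<^sup>2 * \<omega> p"
      by (simp add: \<omega>_def sum_distrib_left power2_eq_square mult.assoc)
    finally show ?thesis .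
  qed
  have "continuous_on UNIV (\<lambda>y. \<omega> (y, y) + 2 * \<omega> (x, y))"
    unfolding \<omega>_def by (intro continuous_intros continuous_on_compose2[OF continuous_k12]) auto
  then have "isCont (\<lambda>y. \<omega> (y, y) + 2 * \<omega> (x, y)) x" by (simp add: continuous_on_eq_continuous_at)
  moreover have "e\<^sup>2 > 0" using e by simp
  ultimately obtain d where d: "d > 0" "\<And>y. dist y x < d \<Longrightarrow>
      dist (\<omega> (y, y) + 2 * \<omega> (x, y)) (\<omega> (x, x) + 2 * \<omega> (x, x)) < e\<^sup>2"
    unfolding continuous_at_eps_delta by meson
  show ?thesis
  proof (intro exI[of _ d] conjI allI impI d(1))
    fix y v assume "dist y x < d"
    then have *: "\<omega> (y, y) + 2 * \<omega> (x, y) \<le> e\<^sup>2"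
      using d(2)[of y] by (simp add: \<omega>_def dist_real_def)
    have eq: "ip (\<lambda>w. deriv_repr v y w - deriv_repr v x w) (\<lambda>w. deriv_repr v y w - deriv_repr v x w) =
        (k12 v v (y, y) - k12 v v (x, x)) - 2 * (k12 v v (x, y) - k12 v v (x, x))"
      by (simp add: ip_diff_diff deriv_repr_mem ip_deriv_repr)
    have sum2: "r - 2 * s \<le> m * p + 2 * (m * q)" if "\<bar>r\<bar> \<le> m * p" "\<bar>s\<bar> \<le> m * q" for r s m p q :: real
      using that by linarith
    have "(norm v)\<^sup>2 * (\<omega> (y, y) + 2 * \<omega> (x, y)) \<le> (norm v)\<^sup>2 * e\<^sup>2"
      by (rule mult_left_mono[OF *]) simp
    then have "(norm v)\<^sup>2 * \<omega> (y, y) + 2 * ((norm v)\<^sup>2 * \<omega> (x, y)) \<le> (e * norm v)\<^sup>2"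
      by (simp add: algebra_simps power_mult_distrib)
    with sum2[OF \<omega> \<omega>]
    show "ip (\<lambda>w. deriv_repr v y w - deriv_repr v x w) (\<lambda>w. deriv_repr v y w - deriv_repr v x w)
        \<le> (e * norm v)\<^sup>2" unfolding eq by (rule order_trans)
  qed
qed

section \<open>Frechet differentiability of the functions in \<open>H\<close>\<close>

lemma ip_deriv_repr_near:
  assumes f: "f \<in> H" and e: "e > 0"
  shows "\<exists>d>0. \<forall>y v. dist y x < d \<longrightarrow> \<bar>ip f (deriv_repr v y) - ip f (deriv_repr v x)\<bar> \<le> e * norm v"
proof -
  have pos: "sqrt (ip f f) + 1 > 0" using ip_nonneg[OF f] by (simp add: add_nonneg_pos)
  define e' where "e' = e / (sqrt (ip f f) + 1)"
  have e': "e' > 0" using e pos by (simp add: e'_def)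
  from deriv_repr_near[OF e', of x] obtain d where "0 < d \<and> (\<forall>y v. dist y x < d \<longrightarrow>
    ip (\<lambda>w. deriv_repr v y w - deriv_repr v x w) (\<lambda>w. deriv_repr v y w - deriv_repr v x w) \<le> (e' * norm v)\<^sup>2)" ..
  note d = this[THEN conjunct1] this[THEN conjunct2, rule_format]
  show ?thesis
  proof (intro exI[of _ d] conjI allI impI d(1))
    fix y v assume y: "dist y x < d"
    let ?w = "\<lambda>w. deriv_repr v y w - deriv_repr v x w"
    have "\<bar>ip f (deriv_repr v y) - ip f (deriv_repr v x)\<bar> = \<bar>ip f ?w\<bar>"
      by (simp add: ip_diff_right f deriv_repr_mem)
    also have "\<dots> \<le> sqrt (ip f f) * sqrt (ip ?w ?w)"
      by (intro Cauchy_Schwarz_rkhs f diff_mem deriv_repr_mem)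
    also have "\<dots> \<le> sqrt (ip f f) * sqrt ((e' * norm v)\<^sup>2)"
      using ip_nonneg[OF f] by (intro mult_left_mono real_sqrt_le_mono d(2)[OF y]) auto
    also have "\<dots> = sqrt (ip f f) * e' * norm v" using e' by simp
    also have "\<dots> \<le> e * norm v"
      using e pos by (intro mult_right_mono) (simp_all add: e'_def field_simps)
    finally show "\<bar>ip f (deriv_repr v y) - ip f (deriv_repr v x)\<bar> \<le> e * norm v" .
  qed
qed

text \<open>The mean value theorem on the segment from \<open>x\<close> to \<open>y\<close> gives
  the derivative in direction \<open>y - x\<close> at an intermediate point. Its difference to the
  value at \<open>x\<close> is at most \<open>e * norm (y - x)\<close>, uniformly in the
  direction.\<close>

lemma rkhs_has_derivative:
  assumes f: "f \<in> H"
  shows "(f has_derivative (\<lambda>v. ip f (deriv_repr v x))) (at x)"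
  unfolding has_derivative_at_alt
proof (intro conjI allI impI)
  show "bounded_linear (\<lambda>v. ip f (deriv_repr v x))"
  proof -
    have eq: "(\<lambda>v. ip f (deriv_repr v x)) = (\<lambda>v. \<Sum>b\<in>Basis. (v \<bullet> b) * ip f (deriv_repr b x))"
      by (rule ext) (rule ip_deriv_repr_expand[OF f])
    have "bounded_linear (\<lambda>v. \<Sum>b\<in>Basis. (v \<bullet> b) * ip f (deriv_repr b x))"
      by (intro bounded_linear_sum bounded_linear_mult_const bounded_linear_inner_left)
    then show ?thesis by (subst eq)
  qed
  fix e :: real assume "e > 0"
  from ip_deriv_repr_near[OF f \<open>e > 0\<close>, of x] obtain d where "0 < d \<and> (\<forall>y v. dist y x < d \<longrightarrow>
      \<bar>ip f (deriv_repr v y) - ip f (deriv_repr v x)\<bar> \<le> e * norm v)" ..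
  note d = this[THEN conjunct1] this[THEN conjunct2, rule_format]
  show "\<exists>d>0. \<forall>y. norm (y - x) < d \<longrightarrow> norm (f y - f x - ip f (deriv_repr (y - x) x)) \<le> e * norm (y - x)"
  proof (intro exI[of _ d] conjI allI impI d(1))
    fix y assume y: "norm (y - x) < d"
    obtain \<theta> where \<theta>: "0 < \<theta>" "\<theta> < 1"
      "f (x + 1 *\<^sub>R (y - x)) - f (x + 0 *\<^sub>R (y - x)) = (1 - 0) * ip f (deriv_repr (y - x) (x + \<theta> *\<^sub>R (y - x)))"
      using MVT2[of 0 1 "\<lambda>s. f (x + s *\<^sub>R (y - x))", OF _ line_derivative[OF f]] by auto
    have "dist (x + \<theta> *\<^sub>R (y - x)) x = \<theta> * norm (y - x)" using \<theta> by (simp add: dist_norm)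
    also have "\<dots> \<le> norm (y - x)" using \<theta> by (intro mult_left_le_one_le) auto
    finally have "dist (x + \<theta> *\<^sub>R (y - x)) x < d" using y by simp
    from d(2)[OF this, of "y - x"] \<theta>(3)
    show "norm (f y - f x - ip f (deriv_repr (y - x) x)) \<le> e * norm (y - x)" by simp
  qed
qed

lemma rkhs_frechet_derivative:
  "f \<in> H \<Longrightarrow> frechet_derivative f (at x) = (\<lambda>v. ip f (deriv_repr v x))"
  using frechet_derivative_at[OF rkhs_has_derivative] by metis

lemma continuous_ip_deriv_repr:
  assumes f: "f \<in> H"
  shows "continuous_on UNIV (\<lambda>x. ip f (deriv_repr v x))"
  unfolding continuous_on_eq_continuous_at[OF open_UNIV]
proof
  fix x
  show "isCont (\<lambda>x. ip f (deriv_repr v x)) x"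
    unfolding continuous_at_eps_delta
  proof (intro allI impI)
    fix e :: real assume "e > 0"
    then have e': "e / (norm v + 1) > 0" by (simp add: add_nonneg_pos)
  from ip_deriv_repr_near[OF f e', of x] obtain d where "0 < d \<and> (\<forall>y u. dist y x < d \<longrightarrow>
      \<bar>ip f (deriv_repr u y) - ip f (deriv_repr u x)\<bar> \<le> e / (norm v + 1) * norm u)" ..
  note d = this[THEN conjunct1] this[THEN conjunct2, rule_format]
    have "e / (norm v + 1) * norm v < e"
    proof -
      have "0 < norm v + 1" by (simp add: add_nonneg_pos)
      then show ?thesis using \<open>e > 0\<close> by (simp add: divide_less_eq distrib_left)
    qed
    then show "\<exists>d>0. \<forall>x'. dist x' x < d \<longrightarrow> dist (ip f (deriv_repr v x')) (ip f (deriv_repr v x)) < e"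
      using d by (intro exI[of _ d]) (auto simp: dist_real_def intro: le_less_trans)
  qed
qed

lemma rkhs_continuous: "f \<in> H \<Longrightarrow> continuous_on UNIV f"
  by (intro continuous_at_imp_continuous_on ballI has_derivative_continuous[OF rkhs_has_derivative])

end

section \<open>The kernelized Stein discrepancy of empirical measures\<close>

lemma grad_inner: "b \<in> Basis \<Longrightarrow> grad f x \<bullet> b = frechet_derivative f (at x) b"
  by (simp add: grad_def inner_sum_left inner_Basis if_distrib cong: if_cong)

lemma measurable_from_uniform_count: "f \<in> uniform_count_measure A \<rightarrow>\<^sub>M borel"
  unfolding measurable_def by (auto simp: space_uniform_count_measure sets_uniform_count_measure)

lemma integral_empirical:
  fixes g :: "'a::euclidean_space \<Rightarrow> real"
  assumes "g \<in> borel_measurable borel"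
  shows "(\<integral>x. g x \<partial>empirical N z) = (\<Sum>j<N. g (z j)) / real N"
  unfolding empirical_def using assms measurable_from_uniform_count[of z "{..<N}"]
  by (subst integral_distr) (auto simp: integral_uniform_count_measure)

locale svgd_setting = smooth_rkhs k H ip
  for k :: "'a::euclidean_space \<Rightarrow> 'a \<Rightarrow> real" and H ip +
  fixes V :: "'a \<Rightarrow> real"
  assumes V_smooth: "Ck 3 V"
begin

lemma V_smooth': "Ck (Suc 2) V"
  using V_smooth by (simp add: numeral_3_eq_3 numeral_2_eq_2)

lemma Ck_grad_V: "b \<in> Basis \<Longrightarrow> Ck 2 (\<lambda>x. grad V x \<bullet> b)"
  using Ck_partial[OF V_smooth'] by (simp add: grad_inner)

lemma continuous_grad_V: "b \<in> Basis \<Longrightarrow> continuous_on UNIV (\<lambda>x. grad V x \<bullet> b)"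
  by (rule Ck_continuous[OF Ck_grad_V])

lemma deriv_repr_apply: "deriv_repr v x y = k2 v (y, x)"
  by (simp add: deriv_repr_def)

text \<open>The Riesz representer of
  \<open>f \<mapsto> \<partial>f(x) - \<partial>V(x) f(x)\<close>, with derivatives in direction
  \<open>b\<close>: the part of the Stein operator at \<open>x\<close> that acts on component
  \<open>b\<close>.\<close>

definition stein_repr :: "'a \<Rightarrow> 'a \<Rightarrow> 'a \<Rightarrow> real" where
  "stein_repr b x = (\<lambda>y. deriv_repr b x y - (grad V x \<bullet> b) * k x y)"

text \<open>The integrand of the explicit formula for the squared discrepancy. The term
  \<open>k2 b (y, x)\<close> is the derivative of the kernel in its first argument at
  \<open>(x, y)\<close>, by symmetry.\<close>

definition stein_kernel :: "'a \<Rightarrow> 'a \<Rightarrow> real" where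
  "stein_kernel x y = (\<Sum>b\<in>Basis. k12 b b (x, y) - (grad V y \<bullet> b) * k2 b (y, x)
     - (grad V x \<bullet> b) * k2 b (x, y) + (grad V x \<bullet> b) * (grad V y \<bullet> b) * k x y)"

text \<open>The embedding of the empirical measure into \<open>H\<close>: component \<open>b\<close>
  of the vector field that represents the averaged Stein operator. \<open>ksd_sq\<close> is the
  squared norm of this field.\<close>

definition stein_mean :: "nat \<Rightarrow> (nat \<Rightarrow> 'a) \<Rightarrow> 'a \<Rightarrow> 'a \<Rightarrow> real" where
  "stein_mean N z b = (\<lambda>y. \<Sum>j<N. (1 / real N) * stein_repr b (z j) y)"

definition ksd_sq :: "nat \<Rightarrow> (nat \<Rightarrow> 'a) \<Rightarrow> real" where
  "ksd_sq N z = (\<Sum>b\<in>Basis. ip (stein_mean N z b) (stein_mean N z b))"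

lemma stein_repr_mem: "stein_repr b x \<in> H"
  unfolding stein_repr_def by (intro diff_mem deriv_repr_mem scale_mem kernel_mem)

lemma stein_mean_mem: "stein_mean N z b \<in> H"
  unfolding stein_mean_def by (intro sum_mem scale_mem stein_repr_mem)

lemma ksd_sq_nonneg: "0 \<le> ksd_sq N z"
  unfolding ksd_sq_def by (intro sum_nonneg ip_nonneg stein_mean_mem)

lemma ip_stein_repr:
  assumes f: "f \<in> H"
  shows "ip f (stein_repr b x) = ip f (deriv_repr b x) - (grad V x \<bullet> b) * f x"
proof -
  have "ip f (stein_repr b x) = ip f (deriv_repr b x) - ip f (\<lambda>y. (grad V x \<bullet> b) * k x y)"
    unfolding stein_repr_def by (rule ip_diff_right[OF deriv_repr_mem scale_mem[OF kernel_mem] f])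
  also have "ip f (\<lambda>y. (grad V x \<bullet> b) * k x y) = (grad V x \<bullet> b) * ip f (k x)"
    by (rule ip_scale_right[OF kernel_mem f])
  also have "ip f (k x) = f x" by (rule reproducing[OF f, symmetric])
  finally show ?thesis .
qed

lemma ip_stein_repr_stein_repr:
  "ip (stein_repr b x) (stein_repr b y) = k12 b b (y, x) - (grad V y \<bullet> b) * k2 b (y, x)
     - (grad V x \<bullet> b) * k2 b (x, y) + (grad V x \<bullet> b) * (grad V y \<bullet> b) * k x y"
proof -
  have "ip (stein_repr b x) (deriv_repr b y) = ip (deriv_repr b y) (stein_repr b x)"
    by (rule ip_sym[OF stein_repr_mem deriv_repr_mem])
  also have "\<dots> = ip (deriv_repr b y) (deriv_repr b x) - (grad V x \<bullet> b) * deriv_repr b y x"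
    by (rule ip_stein_repr[OF deriv_repr_mem])
  also have "ip (deriv_repr b y) (deriv_repr b x) = ip (deriv_repr b x) (deriv_repr b y)"
    by (rule ip_sym[OF deriv_repr_mem deriv_repr_mem])
  finally have "ip (stein_repr b x) (deriv_repr b y) = k12 b b (y, x) - (grad V x \<bullet> b) * k2 b (x, y)"
    unfolding ip_deriv_repr deriv_repr_apply .
  then show ?thesis
    unfolding ip_stein_repr[OF stein_repr_mem]
    by (simp add: stein_repr_def deriv_repr_apply algebra_simps)
qed

lemma ip_stein_mean:
  assumes f: "f \<in> H"
  shows "ip f (stein_mean N z b) = (\<Sum>j<N. ip f (stein_repr b (z j))) / real N"
proof -
  have "ip f (stein_mean N z b) = (\<Sum>j<N. ip f (\<lambda>y. (1 / real N) * stein_repr b (z j) y))"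
    unfolding stein_mean_def by (rule ip_sum_right[OF scale_mem[OF stein_repr_mem] f])
  also have "\<dots> = (\<Sum>j<N. (1 / real N) * ip f (stein_repr b (z j)))"
    by (intro sum.cong refl ip_scale_right stein_repr_mem f)
  finally show ?thesis by (simp add: sum_divide_distrib)
qed

text \<open>Bilinear expansion of the squared norm. In this form continuity in the configuration and
  the comparison with the divergence of the particle field become accessible.\<close>

lemma ksd_sq_explicit:
  "ksd_sq N z = (\<Sum>i<N. \<Sum>j<N. stein_kernel (z i) (z j)) / (real N)\<^sup>2"
proof -
  have "ip (stein_mean N z b) (stein_mean N z b) =
      (\<Sum>i<N. \<Sum>j<N. ip (stein_repr b (z j)) (stein_repr b (z i))) / (real N)\<^sup>2" for b
  proof -
    have "ip (stein_mean N z b) (stein_repr b (z j)) = (\<Sum>i<N. ip (stein_repr b (z j)) (stein_repr b (z i))) / real N" for j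
      by (subst ip_sym[OF stein_mean_mem stein_repr_mem]) (rule ip_stein_mean[OF stein_repr_mem])
    then have "ip (stein_mean N z b) (stein_mean N z b) =
        (\<Sum>j<N. (\<Sum>i<N. ip (stein_repr b (z j)) (stein_repr b (z i))) / real N) / real N"
      unfolding ip_stein_mean[OF stein_mean_mem] by simp
    also have "\<dots> = (\<Sum>j<N. \<Sum>i<N. ip (stein_repr b (z j)) (stein_repr b (z i))) / (real N)\<^sup>2"
      by (simp add: sum_divide_distrib power2_eq_square)
    also have "(\<Sum>j<N. \<Sum>i<N. ip (stein_repr b (z j)) (stein_repr b (z i))) =
        (\<Sum>i<N. \<Sum>j<N. ip (stein_repr b (z j)) (stein_repr b (z i)))" by (rule sum.swap)
    finally show ?thesis .
  qed
  then have "ksd_sq N z = (\<Sum>b\<in>Basis. \<Sum>i<N. \<Sum>j<N. ip (stein_repr b (z j)) (stein_repr b (z i))) / (real N)\<^sup>2"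
    by (simp add: ksd_sq_def sum_divide_distrib)
  also have "(\<Sum>b\<in>Basis. \<Sum>i<N. \<Sum>j<N. ip (stein_repr b (z j)) (stein_repr b (z i))) =
      (\<Sum>i<N. \<Sum>j<N. \<Sum>b\<in>Basis. ip (stein_repr b (z j)) (stein_repr b (z i)))"
    by (subst sum.swap) (intro sum.cong refl sum.swap)
  also have "\<dots> = (\<Sum>i<N. \<Sum>j<N. stein_kernel (z i) (z j))"
    unfolding stein_kernel_def ip_stein_repr_stein_repr
    by (intro sum.cong refl) (simp add: kernel_sym mult_ac)
  finally show ?thesis .
qed

lemma continuous_stein_kernel: "continuous_on UNIV (\<lambda>p. stein_kernel (fst p) (snd p))"
proof -
  have c1: "continuous_on UNIV (\<lambda>p::'a \<times> 'a. k12 b b p)" for b by (rule continuous_k12)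
  have c2: "continuous_on UNIV (k2 b)" if "b \<in> Basis" for b
    by (rule Ck_continuous[OF Ck_k2[OF that]])
  have c3: "continuous_on UNIV (\<lambda>p. k (fst p) (snd p))"
    using Ck_continuous[OF smooth] by (simp add: case_prod_unfold)
  show ?thesis
    unfolding stein_kernel_def
    by (intro continuous_on_sum continuous_on_add continuous_on_diff continuous_on_mult c3
        continuous_on_compose2[OF c1] continuous_on_compose2[OF c2] continuous_on_compose2[OF continuous_grad_V]
        continuous_intros) auto
qed

lemma continuous_ksd_sq:
  assumes "\<And>i. i < N \<Longrightarrow> continuous_on S (\<lambda>t. y t i)"
  shows "continuous_on S (\<lambda>t. ksd_sq N (y t))"
proof -
  have "continuous_on S (\<lambda>t. stein_kernel (y t i) (y t j))" if "i < N" "j < N" for i j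
  proof -
    have "continuous_on S (\<lambda>t. (y t i, y t j))" by (intro continuous_on_Pair assms that)
    from continuous_on_compose2[OF continuous_stein_kernel this] show ?thesis by simp
  qed
  then have "continuous_on S (\<lambda>t. \<Sum>i<N. \<Sum>j<N. stein_kernel (y t i) (y t j))"
    by (intro continuous_on_sum) auto
  then show ?thesis
    unfolding ksd_sq_explicit divide_inverse by (intro continuous_on_mult continuous_on_const)
qed

section \<open>The supremum over the unit ball\<close>

lemma stein_op_rkhs:
  assumes \<phi>: "\<phi> \<in> vec_space H"
  shows "stein_op V \<phi> x = (\<Sum>b\<in>Basis. ip (\<lambda>x. \<phi> x \<bullet> b) (stein_repr b x))"
proof -
  have mem: "(\<lambda>x. \<phi> x \<bullet> b) \<in> H" if "b \<in> Basis" for b using \<phi> that by (simp add: vec_space_def)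
  have "divergence \<phi> x = (\<Sum>b\<in>Basis. ip (\<lambda>x. \<phi> x \<bullet> b) (deriv_repr b x))"
    unfolding divergence_def by (intro sum.cong refl) (simp add: rkhs_frechet_derivative[OF mem])
  moreover have "grad V x \<bullet> \<phi> x = (\<Sum>b\<in>Basis. (grad V x \<bullet> b) * (\<phi> x \<bullet> b))"
    by (rule euclidean_inner)
  ultimately have "stein_op V \<phi> x =
      (\<Sum>b\<in>Basis. ip (\<lambda>x. \<phi> x \<bullet> b) (deriv_repr b x) - (grad V x \<bullet> b) * (\<phi> x \<bullet> b))"
    by (simp add: stein_op_def sum_subtractf)
  also have "\<dots> = (\<Sum>b\<in>Basis. ip (\<lambda>x. \<phi> x \<bullet> b) (stein_repr b x))"
    by (intro sum.cong refl ip_stein_repr[OF mem, symmetric])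
  finally show ?thesis .
qed

lemma continuous_stein_op:
  assumes \<phi>: "\<phi> \<in> vec_space H"
  shows "continuous_on UNIV (stein_op V \<phi>)"
proof -
  have mem: "(\<lambda>x. \<phi> x \<bullet> b) \<in> H" if "b \<in> Basis" for b using \<phi> that by (simp add: vec_space_def)
  have "continuous_on UNIV (\<lambda>x. ip (\<lambda>x. \<phi> x \<bullet> b) (stein_repr b x))" if b: "b \<in> Basis" for b
    unfolding ip_stein_repr[OF mem[OF b]]
    by (intro continuous_on_diff continuous_on_mult continuous_grad_V b continuous_ip_deriv_repr
        rkhs_continuous mem)
  then show ?thesis
    unfolding stein_op_rkhs[OF \<phi>, abs_def] by (intro continuous_on_sum) auto
qed

lemma mean_stein_op:
  assumes \<phi>: "\<phi> \<in> vec_space H"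
  shows "(\<Sum>j<N. stein_op V \<phi> (z j)) / real N = (\<Sum>b\<in>Basis. ip (\<lambda>x. \<phi> x \<bullet> b) (stein_mean N z b))"
proof -
  have mem: "(\<lambda>x. \<phi> x \<bullet> b) \<in> H" if "b \<in> Basis" for b using \<phi> that by (simp add: vec_space_def)
  have "(\<Sum>j<N. stein_op V \<phi> (z j)) = (\<Sum>b\<in>Basis. \<Sum>j<N. ip (\<lambda>x. \<phi> x \<bullet> b) (stein_repr b (z j)))"
    unfolding stein_op_rkhs[OF \<phi>] by (rule sum.swap)
  then show ?thesis
    by (simp add: sum_divide_distrib ip_stein_mean[OF mem])
qed

text \<open>Cauchy-Schwarz twice: in \<open>H\<close> for each component, then in the Euclidean
  space for the vectors of component norms.\<close>

lemma mean_stein_op_le: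
  assumes \<phi>: "\<phi> \<in> vec_space H" "vec_norm ip \<phi> \<le> 1"
  shows "(\<Sum>j<N. stein_op V \<phi> (z j)) / real N \<le> sqrt (ksd_sq N z)"
proof -
  have mem: "(\<lambda>x. \<phi> x \<bullet> b) \<in> H" if "b \<in> Basis" for b using \<phi> that by (simp add: vec_space_def)
  let ?\<phi> = "\<lambda>b x. \<phi> x \<bullet> b"
  have "(\<Sum>b\<in>Basis. ip (?\<phi> b) (stein_mean N z b)) \<le>
      (\<Sum>b\<in>Basis. \<bar>sqrt (ip (?\<phi> b) (?\<phi> b))\<bar> * \<bar>sqrt (ip (stein_mean N z b) (stein_mean N z b))\<bar>)"
  proof (rule sum_mono)
    fix b :: 'a assume b: "b \<in> Basis"
    show "ip (?\<phi> b) (stein_mean N z b) \<le> \<bar>sqrt (ip (?\<phi> b) (?\<phi> b))\<bar> * \<bar>sqrt (ip (stein_mean N z b) (stein_mean N z b))\<bar>"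
      using Cauchy_Schwarz_rkhs[OF mem[OF b] stein_mean_mem, of N z b] ip_nonneg[OF mem[OF b]]
        ip_nonneg[OF stein_mean_mem, of N z b] by simp
  qed
  also have "\<dots> \<le> L2_set (\<lambda>b. sqrt (ip (?\<phi> b) (?\<phi> b))) Basis *
      L2_set (\<lambda>b. sqrt (ip (stein_mean N z b) (stein_mean N z b))) Basis"
    by (rule L2_set_mult_ineq)
  also have "L2_set (\<lambda>b. sqrt (ip (?\<phi> b) (?\<phi> b))) Basis = vec_norm ip \<phi>"
    unfolding L2_set_def vec_norm_def using ip_nonneg[OF mem] by (intro arg_cong[where f=sqrt] sum.cong) auto
  also have "L2_set (\<lambda>b. sqrt (ip (stein_mean N z b) (stein_mean N z b))) Basis = sqrt (ksd_sq N z)"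
    unfolding L2_set_def ksd_sq_def using ip_nonneg[OF stein_mean_mem]
    by (intro arg_cong[where f=sqrt] sum.cong) auto
  also have "vec_norm ip \<phi> * sqrt (ksd_sq N z) \<le> 1 * sqrt (ksd_sq N z)"
    using \<phi>(2) ksd_sq_nonneg by (intro mult_right_mono) auto
  finally show ?thesis unfolding mean_stein_op[OF \<phi>(1)] by simp
qed

text \<open>The supremum of a bounded linear functional over the unit ball is the norm of its
  representer, attained at the normalised \<open>stein_mean\<close>. A vanishing representer cannot
  be normalised, but then the lower bound is 0.\<close>

lemma KSD_empirical: "KSD V H ip (empirical N z) = ennreal (sqrt (ksd_sq N z))"
proof (rule antisym)
  have int: "(\<integral>x. stein_op V \<phi> x \<partial>empirical N z) = (\<Sum>j<N. stein_op V \<phi> (z j)) / real N"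
    if "\<phi> \<in> vec_space H" for \<phi>
    by (intro integral_empirical borel_measurable_continuous_onI continuous_stein_op that)
  show "KSD V H ip (empirical N z) \<le> ennreal (sqrt (ksd_sq N z))"
    unfolding KSD_def
  proof (rule SUP_least)
    fix \<phi> assume "\<phi> \<in> {\<phi> \<in> vec_space H. vec_norm ip \<phi> \<le> 1}"
    then have \<phi>: "\<phi> \<in> vec_space H" "vec_norm ip \<phi> \<le> 1" by auto
    show "ennreal (\<integral>x. stein_op V \<phi> x \<partial>empirical N z) \<le> ennreal (sqrt (ksd_sq N z))"
      unfolding int[OF \<phi>(1)] by (intro ennreal_leI mean_stein_op_le \<phi>)
  qed
  show "ennreal (sqrt (ksd_sq N z)) \<le> KSD V H ip (empirical N z)"
  proof (cases "ksd_sq N z = 0")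
    case False
    then have pos: "ksd_sq N z > 0" using ksd_sq_nonneg[of N z] by simp
    define c where "c = 1 / sqrt (ksd_sq N z)"
    define \<phi> where "\<phi> = (\<lambda>x. \<Sum>b\<in>Basis. (c * stein_mean N z b x) *\<^sub>R b)"
    have \<phi>b: "(\<lambda>x. \<phi> x \<bullet> b) = (\<lambda>x. c * stein_mean N z b x)" if "b \<in> Basis" for b
      using that by (simp add: \<phi>_def inner_sum_left inner_Basis if_distrib cong: if_cong)
    have \<phi>: "\<phi> \<in> vec_space H"
      unfolding vec_space_def using \<phi>b by (auto intro: scale_mem stein_mean_mem)
    have ipc: "ip (\<lambda>x. \<phi> x \<bullet> b) g = c * ip (stein_mean N z b) g" if "b \<in> Basis" "g \<in> H" for b g
      unfolding \<phi>b[OF that(1)] by (rule ip_scale[OF stein_mean_mem that(2)])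
    have "(\<Sum>b\<in>Basis. ip (\<lambda>x. \<phi> x \<bullet> b) (\<lambda>x. \<phi> x \<bullet> b)) =
        (\<Sum>b\<in>Basis. c * (c * ip (stein_mean N z b) (stein_mean N z b)))"
    proof (intro sum.cong refl)
      fix b :: 'a assume b: "b \<in> Basis"
      have m: "(\<lambda>x. \<phi> x \<bullet> b) \<in> H" using \<phi> b by (simp add: vec_space_def)
      show "ip (\<lambda>x. \<phi> x \<bullet> b) (\<lambda>x. \<phi> x \<bullet> b) = c * (c * ip (stein_mean N z b) (stein_mean N z b))"
        unfolding ipc[OF b m] ip_sym[OF stein_mean_mem m] ipc[OF b stein_mean_mem] ..
    qed
    also have "\<dots> = c * (c * ksd_sq N z)" by (simp add: ksd_sq_def sum_distrib_left)
    also have "\<dots> = 1" using pos by (simp add: c_def)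
    finally have norm: "vec_norm ip \<phi> \<le> 1" by (simp add: vec_norm_def)
    have "(\<integral>x. stein_op V \<phi> x \<partial>empirical N z) =
        (\<Sum>b\<in>Basis. c * ip (stein_mean N z b) (stein_mean N z b))"
      unfolding int[OF \<phi>] mean_stein_op[OF \<phi>] by (intro sum.cong refl ipc stein_mean_mem)
    also have "\<dots> = c * ksd_sq N z" by (simp add: ksd_sq_def sum_distrib_left)
    also have "\<dots> = sqrt (ksd_sq N z)" using pos by (simp add: c_def real_div_sqrt)
    finally have eq: "(\<integral>x. stein_op V \<phi> x \<partial>empirical N z) = sqrt (ksd_sq N z)" .
    show ?thesis
      unfolding KSD_def eq[symmetric] using \<phi> norm by (intro SUP_upper) auto
  qed simp
qed

lemma KSD_empirical_sq: "(KSD V H ip (empirical N z))\<^sup>2 = ennreal (ksd_sq N z)"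
  unfolding KSD_empirical using ksd_sq_nonneg[of N z] by (simp add: ennreal_power)

end

section \<open>The time-averaged empirical measure\<close>

lemma prob_space_unif: "N > 0 \<Longrightarrow> prob_space (uniform_measure lborel {0..real N})"
  by (intro prob_space_uniform_measure) auto

text \<open>The averaged measure is the law of a uniformly chosen particle at a uniformly chosen
  time. Being a law, the set function given to \<open>measure_of\<close> is countably additive and
  takes effect, and Fubini's theorem becomes available. Time is clamped to
  \<open>{0..real N}\<close> because nothing is known about \<open>y\<close> at negative
  times.\<close>

lemma averaged_empirical_eq_distr:
  fixes y :: "real \<Rightarrow> nat \<Rightarrow> 'a::euclidean_space"
  assumes N: "N > 0" and y: "\<And>i. i < N \<Longrightarrow> continuous_on {0..} (\<lambda>t. y t i)"
  defines "h \<equiv> \<lambda>(t, i). y (max 0 (min (real N) t)) i"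
  defines "Q \<equiv> uniform_measure lborel {0..real N} \<Otimes>\<^sub>M uniform_count_measure {..<N}"
  shows "h \<in> Q \<rightarrow>\<^sub>M borel" "averaged_empirical N y = distr Q borel h"
proof -
  let ?U = "uniform_measure lborel {0..real N}" and ?C = "uniform_count_measure {..<N}"
  have pC: "prob_space ?C" using N by (intro prob_space_uniform_count_measure) auto
  then interpret C: prob_space ?C .
  have cont: "continuous_on UNIV (\<lambda>t. y (max 0 (min (real N) t)) i)" if "i < N" for i
    by (rule continuous_on_compose2[OF y[OF that]]) (auto intro!: continuous_intros)
  have "(\<lambda>q. y (max 0 (min (real N) (fst q))) (snd q)) \<in> ?U \<Otimes>\<^sub>M ?C \<rightarrow>\<^sub>M borel"
  proof (rule measurable_compose_countable'[where I="{..<N}"])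
    fix i assume "i \<in> {..<N}"
    then have "(\<lambda>t. y (max 0 (min (real N) t)) i) \<in> borel_measurable borel"
      using cont by (intro borel_measurable_continuous_onI) auto
    then have "(\<lambda>t. y (max 0 (min (real N) t)) i) \<in> ?U \<rightarrow>\<^sub>M borel"
      using measurable_cong_sets[of ?U borel "borel :: 'a measure" borel] by simp
    then show "(\<lambda>q. y (max 0 (min (real N) (fst q))) i) \<in> ?U \<Otimes>\<^sub>M ?C \<rightarrow>\<^sub>M borel"
      by (rule measurable_compose[OF measurable_fst])
  next
    have "snd \<in> ?U \<Otimes>\<^sub>M ?C \<rightarrow>\<^sub>M ?C" by (rule measurable_snd)
    then show "snd \<in> ?U \<Otimes>\<^sub>M ?C \<rightarrow>\<^sub>M count_space {..<N}"
      unfolding measurable_cong_sets[OF refl sets_uniform_count_measure_count_space] .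
  qed simp
  then show h: "h \<in> Q \<rightarrow>\<^sub>M borel"
    unfolding Q_def h_def by (simp add: case_prod_unfold)
  have eq: "(\<integral>\<^sup>+t\<in>{0..real N}. emeasure (empirical N (y t)) A \<partial>lborel) / ennreal (real N) =
      emeasure (distr Q borel h) A" if A: "A \<in> sets borel" for A
  proof -
    have 1: "emeasure (distr Q borel h) A = (\<integral>\<^sup>+q. indicator A (h q) \<partial>Q)"
    proof -
      have "emeasure (distr Q borel h) A = (\<integral>\<^sup>+q. indicator A q \<partial>distr Q borel h)"
        using A by simp
      also have "\<dots> = (\<integral>\<^sup>+q. indicator A (h q) \<partial>Q)"
        using h A by (intro nn_integral_distr) auto
      finally show ?thesis .
    qed
    have hi: "(\<lambda>q. indicator A (h q) :: ennreal) \<in> borel_measurable (?U \<Otimes>\<^sub>M ?C)"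
      using measurable_compose[OF h, of "indicator A :: 'a \<Rightarrow> ennreal" borel] A unfolding Q_def by auto
    have 2: "(\<integral>\<^sup>+q. indicator A (h q) \<partial>Q) = (\<integral>\<^sup>+t. (\<integral>\<^sup>+i. indicator A (h (t, i)) \<partial>?C) \<partial>?U)"
      unfolding Q_def by (rule C.nn_integral_fst[symmetric, OF hi])
    have 3: "(\<integral>\<^sup>+t. (\<integral>\<^sup>+i. indicator A (h (t, i)) \<partial>?C) \<partial>?U) =
        (\<integral>\<^sup>+t. (\<integral>\<^sup>+i. indicator A (h (t, i)) \<partial>?C) * indicator {0..real N} t \<partial>lborel) / emeasure lborel {0..real N}"
    proof (rule nn_integral_uniform_measure)
      have "(\<lambda>t. \<integral>\<^sup>+i. indicator A (h (t, i)) \<partial>?C) \<in> borel_measurable ?U"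
        using C.borel_measurable_nn_integral_fst[OF hi] by simp
      then show "(\<lambda>t. \<integral>\<^sup>+i. indicator A (h (t, i)) \<partial>?C) \<in> borel_measurable lborel"
        using measurable_cong_sets[of ?U lborel "borel :: ennreal measure" borel] by simp
    qed auto
    have 4: "(\<integral>\<^sup>+t. (\<integral>\<^sup>+i. indicator A (h (t, i)) \<partial>?C) * indicator {0..real N} t \<partial>lborel) =
        (\<integral>\<^sup>+t\<in>{0..real N}. emeasure (empirical N (y t)) A \<partial>lborel)"
    proof (rule nn_integral_cong)
      fix t :: real
      show "(\<integral>\<^sup>+i. indicator A (h (t, i)) \<partial>?C) * indicator {0..real N} t =
          emeasure (empirical N (y t)) A * indicator {0..real N} t"
      proof (cases "t \<in> {0..real N}")
        case True
        have "emeasure (empirical N (y t)) A = (\<integral>\<^sup>+x. indicator A x \<partial>empirical N (y t))"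
          using A by (intro nn_integral_indicator[symmetric]) (simp add: empirical_def)
        also have "\<dots> = (\<integral>\<^sup>+i. indicator A (y t i) \<partial>?C)"
          unfolding empirical_def using A by (intro nn_integral_distr measurable_from_uniform_count) auto
        finally show ?thesis using True by (simp add: h_def)
      qed simp
    qed
    show ?thesis unfolding 1 2 3 4 by simp
  qed
  have m1: "averaged_empirical N y = measure_of UNIV (sets borel) (emeasure (distr Q borel h))"
    unfolding averaged_empirical_def
  proof (rule measure_of_eq)
    fix A :: "'a set" assume "A \<in> sigma_sets UNIV (sets borel)"
    then have "A \<in> sets borel" using sets.sigma_sets_eq[of "borel :: 'a measure"] by simp
    then show "(\<integral>\<^sup>+t\<in>{0..real N}. emeasure (empirical N (y t)) A \<partial>lborel) / ennreal (real N) =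
      emeasure (distr Q borel h) A" by (rule eq)
  qed simp
  have m2: "measure_of UNIV (sets borel) (emeasure (distr Q borel h)) = distr Q borel h"
    using measure_of_of_measure[of "distr Q borel h"] by simp
  show "averaged_empirical N y = distr Q borel h"
    using m1 m2 by (rule trans)
qed

context svgd_setting
begin

text \<open>Convexity of a supremum of linear functionals: for fixed \<open>\<phi>\<close> the
  integral against the averaged measure is the time average of the integrals against the empirical
  measures, each at most its own discrepancy. Integrability follows from continuity on a compact
  time interval.\<close>

lemma KSD_averaged_empirical_le:
  fixes y :: "real \<Rightarrow> nat \<Rightarrow> 'a"
  assumes N: "N > 0" and y: "\<And>i. i < N \<Longrightarrow> continuous_on {0..} (\<lambda>t. y t i)"
  shows "KSD V H ip (averaged_empirical N y) \<le>
    (\<integral>\<^sup>+t. ennreal (sqrt (ksd_sq N (y (max 0 (min (real N) t))))) \<partial>uniform_measure lborel {0..real N})"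
  unfolding KSD_def
proof (rule SUP_least)
  fix \<phi> assume "\<phi> \<in> {\<phi> \<in> vec_space H. vec_norm ip \<phi> \<le> 1}"
  then have \<phi>: "\<phi> \<in> vec_space H" "vec_norm ip \<phi> \<le> 1" by auto
  let ?U = "uniform_measure lborel {0..real N}" and ?C = "uniform_count_measure {..<N}"
  let ?g = "stein_op V \<phi>"
  define y' where "y' = (\<lambda>t. y (max 0 (min (real N) t)))"
  define h where "h = (\<lambda>(t, i). y' t i)"
  interpret U: prob_space ?U using N by (rule prob_space_unif)
  interpret C: prob_space ?C using N by (intro prob_space_uniform_count_measure) auto
  interpret UC: pair_prob_space ?U ?C ..
  have hm: "h \<in> ?U \<Otimes>\<^sub>M ?C \<rightarrow>\<^sub>M borel" and av: "averaged_empirical N y = distr (?U \<Otimes>\<^sub>M ?C) borel h"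
    unfolding h_def y'_def by (rule averaged_empirical_eq_distr[where y=y]; use N y in blast)+
  have gm: "?g \<in> borel_measurable borel"
    by (intro borel_measurable_continuous_onI continuous_stein_op \<phi>)
  have y'c: "continuous_on UNIV (\<lambda>t. y' t i)" if "i < N" for i
    unfolding y'_def by (rule continuous_on_compose2[OF y[OF that]]) (auto intro!: continuous_intros)
  have bdd: "\<exists>B. \<forall>t. \<bar>f (y' t)\<bar> \<le> B" if "continuous_on UNIV (\<lambda>t. f (y' t))" for f :: "(nat \<Rightarrow> 'a) \<Rightarrow> real"
  proof -
    have "bounded ((\<lambda>t. f (y' t)) ` {0..real N})"
      by (intro compact_imp_bounded compact_continuous_image continuous_on_subset[OF that]) auto
    then obtain B where B: "\<forall>t\<in>{0..real N}. \<bar>f (y' t)\<bar> \<le> B" unfolding bounded_iff by auto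
    have "y' t = y' (max 0 (min (real N) t))" for t by (simp add: y'_def)
    then have "\<bar>f (y' t)\<bar> \<le> B" for t
      using B[rule_format, of "max 0 (min (real N) t)"] by simp
    then show ?thesis by blast
  qed
  have "\<exists>B. \<forall>t. \<bar>?g (y' t i)\<bar> \<le> B" if "i < N" for i
    using continuous_on_compose2[OF continuous_stein_op[OF \<phi>(1)] y'c[OF that]] by (intro bdd[of "\<lambda>z. ?g (z i)"]) auto
  then obtain B where B: "\<And>i t. i < N \<Longrightarrow> \<bar>?g (y' t i)\<bar> \<le> B i" by metis
  have "integrable (?U \<Otimes>\<^sub>M ?C) (\<lambda>q. ?g (h q))"
  proof (rule UC.P.integrable_const_bound)
    show "(\<lambda>q. ?g (h q)) \<in> borel_measurable (?U \<Otimes>\<^sub>M ?C)" by (rule measurable_compose[OF hm gm])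
    show "AE q in ?U \<Otimes>\<^sub>M ?C. norm (?g (h q)) \<le> (\<Sum>i<N. B i)"
    proof (rule AE_I2)
      fix q assume "q \<in> space (?U \<Otimes>\<^sub>M ?C)"
      then obtain t i where q: "q = (t, i)" "i < N" by (auto simp: space_pair_measure space_uniform_count_measure)
      have "0 \<le> B i" if "i < N" for i using B[OF that, of 0] by linarith
      then have "B i \<le> (\<Sum>i<N. B i)" using q by (intro member_le_sum) auto
      then show "norm (?g (h q)) \<le> (\<Sum>i<N. B i)" using B[OF q(2), of t] q by (simp add: h_def)
    qed
  qed
  then have "(\<integral>q. ?g (h q) \<partial>(?U \<Otimes>\<^sub>M ?C)) = (\<integral>t. (\<integral>i. ?g (h (t, i)) \<partial>?C) \<partial>?U)"
    by (rule UC.integral_fst'[symmetric])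
  also have "\<dots> = (\<integral>t. (\<Sum>i<N. ?g (y' t i)) / real N \<partial>?U)"
    by (simp add: integral_uniform_count_measure h_def)
  finally have int: "(\<integral>x. ?g x \<partial>averaged_empirical N y) = (\<integral>t. (\<Sum>i<N. ?g (y' t i)) / real N \<partial>?U)"
    unfolding av using integral_distr[OF hm gm] by simp
  have mU: "f \<in> borel_measurable ?U" if "f \<in> borel_measurable borel" for f :: "real \<Rightarrow> real"
    using that measurable_cong_sets[of ?U borel "borel :: real measure" borel] by simp
  have kc: "continuous_on UNIV (\<lambda>t. sqrt (ksd_sq N (y' t)))"
    by (intro continuous_intros continuous_ksd_sq y'c)
  obtain K where K: "\<And>t. \<bar>sqrt (ksd_sq N (y' t))\<bar> \<le> K" using bdd[OF kc] by auto
  have ki: "integrable ?U (\<lambda>t. sqrt (ksd_sq N (y' t)))"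
    using K mU[OF borel_measurable_continuous_onI[OF kc]]
    by (intro U.integrable_const_bound[where B=K]) auto
  have gi: "integrable ?U (\<lambda>t. (\<Sum>i<N. ?g (y' t i)) / real N)"
  proof -
    have "integrable ?U (\<lambda>t. ?g (y' t i))" if "i < N" for i
      using B[OF that] mU[OF borel_measurable_continuous_onI[OF continuous_on_compose2[OF continuous_stein_op[OF \<phi>(1)] y'c[OF that]]]]
      by (intro U.integrable_const_bound[where B="B i"]) auto
    then show ?thesis by (intro integrable_divide_zero Bochner_Integration.integrable_sum) auto
  qed
  have "(\<integral>t. (\<Sum>i<N. ?g (y' t i)) / real N \<partial>?U) \<le> (\<integral>t. sqrt (ksd_sq N (y' t)) \<partial>?U)"
    by (intro integral_mono gi ki mean_stein_op_le \<phi>)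
  then have "ennreal (\<integral>x. ?g x \<partial>averaged_empirical N y) \<le> ennreal (\<integral>t. sqrt (ksd_sq N (y' t)) \<partial>?U)"
    unfolding int by (rule ennreal_leI)
  also have "\<dots> = (\<integral>\<^sup>+t. ennreal (sqrt (ksd_sq N (y' t))) \<partial>?U)"
    by (intro nn_integral_eq_integral[symmetric] ki) (auto simp: ksd_sq_nonneg)
  finally show "ennreal (\<integral>x. ?g x \<partial>averaged_empirical N y) \<le>
    (\<integral>\<^sup>+t. ennreal (sqrt (ksd_sq N (y (max 0 (min (real N) t))))) \<partial>?U)"
    unfolding y'_def .
qed

end

section \<open>The particle vector field and its divergence\<close>

lemma lip_on_boxes_comp1:
  assumes g: "Ck (Suc m) (g :: 'a::euclidean_space \<Rightarrow> real)" and i: "i < N"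
  shows "lip_on_boxes N (\<lambda>z. g (z i))"
  unfolding lip_on_boxes_def
proof
  fix R
  obtain L where L: "L \<ge> 0" "\<And>x y. norm x \<le> R \<Longrightarrow> norm y \<le> R \<Longrightarrow> \<bar>g x - g y\<bar> \<le> L * norm (x - y)"
    by (rule Ck_lipschitz_cball[OF g, where R=R]) blast
  show "\<exists>L\<ge>0. \<forall>z z'. box_config N R z \<longrightarrow> box_config N R z' \<longrightarrow>
     \<bar>g (z i) - g (z' i)\<bar> \<le> L * config_dist N z z'"
  proof (intro exI[of _ L] conjI allI impI L(1))
    fix z z' :: "nat \<Rightarrow> 'a" assume z: "box_config N R z" "box_config N R z'"
    have "\<bar>g (z i) - g (z' i)\<bar> \<le> L * norm (z i - z' i)" using z i by (intro L(2)) (auto simp: box_config_def)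
    also have "\<dots> \<le> L * config_dist N z z'" by (intro mult_left_mono norm_le_config_dist i L(1))
    finally show "\<bar>g (z i) - g (z' i)\<bar> \<le> L * config_dist N z z'" .
  qed
qed

lemma lip_on_boxes_comp2:
  assumes g: "Ck (Suc m) (g :: 'a::euclidean_space \<times> 'a \<Rightarrow> real)" and i: "i < N" "j < N"
  shows "lip_on_boxes N (\<lambda>z. g (z i, z j))"
  unfolding lip_on_boxes_def
proof
  fix R
  obtain L where L: "L \<ge> 0"
    "\<And>x y. norm x \<le> R + R \<Longrightarrow> norm y \<le> R + R \<Longrightarrow> \<bar>g x - g y\<bar> \<le> L * norm (x - y)"
    by (rule Ck_lipschitz_cball[OF g, where R="R + R"]) blast
  show "\<exists>L\<ge>0. \<forall>z z'. box_config N R z \<longrightarrow> box_config N R z' \<longrightarrow>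
     \<bar>g (z i, z j) - g (z' i, z' j)\<bar> \<le> L * config_dist N z z'"
  proof (intro exI[of _ "L * 2"] conjI allI impI)
    fix z z' :: "nat \<Rightarrow> 'a" assume z: "box_config N R z" "box_config N R z'"
    have n: "norm (w i, w j) \<le> R + R" if "box_config N R w" for w :: "nat \<Rightarrow> 'a"
    proof -
      have "norm (w i) \<le> R" "norm (w j) \<le> R" using that i by (auto simp: box_config_def)
      then show ?thesis using norm_Pair_le[of "w i" "w j"] by linarith
    qed
    have "\<bar>g (z i, z j) - g (z' i, z' j)\<bar> \<le> L * norm ((z i, z j) - (z' i, z' j))"
      by (intro L(2) n z)
    also have "\<dots> \<le> L * (config_dist N z z' + config_dist N z z')"
      using norm_Pair_le[of "z i - z' i" "z j - z' j"] norm_le_config_dist[OF i(1), of z z']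
        norm_le_config_dist[OF i(2), of z z'] by (intro mult_left_mono L(1)) simp
    finally show "\<bar>g (z i, z j) - g (z' i, z' j)\<bar> \<le> L * 2 * config_dist N z z'" by simp
  qed (use L in simp)
qed

lemma sum_axes: "(\<Sum>l\<in>axes N. f l) = (\<Sum>i<N. \<Sum>b\<in>Basis. f (i, b))"
  by (simp add: axes_def sum.cartesian_product case_prod_beta)

context svgd_setting
begin

definition VV :: "'a \<Rightarrow> 'a \<Rightarrow> real" where
  "VV b x = frechet_derivative (\<lambda>x. grad V x \<bullet> b) (at x) b"

lemma Ck_grad_V': "b \<in> Basis \<Longrightarrow> Ck (Suc 1) (\<lambda>x. grad V x \<bullet> b)"
  using Ck_grad_V by (simp add: numeral_2_eq_2)

lemma Ck_VV: "b \<in> Basis \<Longrightarrow> Ck (Suc 0) (VV b)"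
  unfolding VV_def[abs_def] using Ck_partial[OF Ck_grad_V'] by simp

text \<open>Symmetry of the kernel trades a derivative in the first argument for one in the second
  with the points exchanged, so that \<open>k2\<close> serves for both.\<close>

lemma k1_eq: "frechet_derivative (\<lambda>(y, z). k y z) (at (x, y)) (u, 0) = k2 u (y, x)"
proof (rule DERIV_unique)
  show "((\<lambda>s. k y (x + s *\<^sub>R u)) has_real_derivative frechet_derivative (\<lambda>(y, z). k y z) (at (x, y)) (u, 0)) (at 0)"
    using Ck_line_derivative[OF smooth', of "(x, y)" "(u, 0)" 0] by (simp add: kernel_sym[of _ y])
  show "((\<lambda>s. k y (x + s *\<^sub>R u)) has_real_derivative k2 u (y, x)) (at 0)"
    using k_line2[of y x u 0] by simp
qed

lemma grad_kernel: "b \<in> Basis \<Longrightarrow> grad (k x) y \<bullet> b = k2 b (x, y)"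
proof -
  assume b: "b \<in> Basis"
  have "ip (k x) (deriv_repr b y) = ip (deriv_repr b y) (k x)"
    by (rule ip_sym[OF kernel_mem deriv_repr_mem])
  then show ?thesis
    using b by (simp add: grad_inner rkhs_frechet_derivative[OF kernel_mem] ip_deriv_repr_kernel)
qed

lemma laplacian_kernel: "laplacian (k x) y = (\<Sum>b\<in>Basis. k22 b b (x, y))"
  unfolding laplacian_def divergence_def
proof (intro sum.cong refl)
  fix b :: 'a assume b: "b \<in> Basis"
  have g: "((\<lambda>y. (x, y)) has_derivative (\<lambda>h. (0, h))) (at y)"
    by (auto intro!: derivative_eq_intros)
  have "((\<lambda>y. k2 b (x, y)) has_derivative (\<lambda>h. frechet_derivative (k2 b) (at (x, y)) (0, h))) (at y)"
    by (rule has_derivative_compose[OF g Ck_has_derivative[OF Ck_k2'[OF b]]])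
  then show "frechet_derivative (\<lambda>y. grad (k x) y \<bullet> b) (at y) b = k22 b b (x, y)"
    unfolding grad_kernel[OF b] k22_def
    using frechet_derivative_at by metis
qed

lemma Cstar_expand:
  "Cstar V k z = (\<Sum>b\<in>Basis. k2 b (z, z) * (grad V z \<bullet> b) + k z z * VV b z - k22 b b (z, z))"
proof -
  have "grad (k z) z \<bullet> grad V z = (\<Sum>b\<in>Basis. k2 b (z, z) * (grad V z \<bullet> b))"
    by (subst euclidean_inner) (simp add: grad_kernel)
  moreover have "laplacian V z = (\<Sum>b\<in>Basis. VV b z)"
    by (simp add: laplacian_def divergence_def VV_def)
  ultimately show ?thesis
    unfolding Cstar_def laplacian_kernel by (simp add: sum.distrib sum_subtractf sum_distrib_left)
qed

definition drift :: "nat \<Rightarrow> nat \<times> 'a \<Rightarrow> (nat \<Rightarrow> 'a) \<Rightarrow> real" where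
  "drift N l z = (1 / real N) * (\<Sum>j<N. k2 (snd l) (z (fst l), z j) -
     k (z (fst l)) (z j) * (grad V (z j) \<bullet> snd l))"

text \<open>The sum over \<open>j\<close> differentiates each interaction in the first kernel
  argument as if \<open>z j\<close> stayed fixed. For \<open>j = fst l\<close> the second argument
  and \<open>grad V\<close> move as well; the subtracted bracket is this correction, and over the
  basis it adds up to \<open>Cstar\<close> at that particle.\<close>

definition drift_div :: "nat \<Rightarrow> nat \<times> 'a \<Rightarrow> (nat \<Rightarrow> 'a) \<Rightarrow> real" where
  "drift_div N l z = (1 / real N) *
     ((\<Sum>j<N. k12 (snd l) (snd l) (z (fst l), z j) - k2 (snd l) (z j, z (fst l)) * (grad V (z j) \<bullet> snd l)) -
      (k2 (snd l) (z (fst l), z (fst l)) * (grad V (z (fst l)) \<bullet> snd l) +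
        k (z (fst l)) (z (fst l)) * VV (snd l) (z (fst l)) - k22 (snd l) (snd l) (z (fst l), z (fst l))))"

lemma svgd_field_inner:
  assumes "b \<in> Basis"
  shows "svgd_field V k N z i \<bullet> b = drift N (i, b) z"
  using assms
  by (simp add: svgd_field_def drift_def inner_sum_left inner_add_left inner_diff_left grad_kernel sum_subtractf
      right_diff_distrib)

lemma lip_kernel: "i < N \<Longrightarrow> j < N \<Longrightarrow> lip_on_boxes N (\<lambda>z. k (z i) (z j))"
  using lip_on_boxes_comp2[OF smooth'] by simp

lemma lip_drift: "l \<in> axes N \<Longrightarrow> lip_on_boxes N (drift N l)"
  unfolding drift_def[abs_def]
  by (intro lip_on_boxes_mult lip_on_boxes_const lip_on_boxes_sum lip_on_boxes_diff lip_kernel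
      lip_on_boxes_comp2[OF Ck_k2'] lip_on_boxes_comp1[OF Ck_grad_V']) (auto dest: axes_D)

lemma lip_drift_div: "l \<in> axes N \<Longrightarrow> lip_on_boxes N (drift_div N l)"
proof -
  assume l: "l \<in> axes N"
  note b = axes_D[OF l]
  have 1: "Ck (Suc 0) (k12 (snd l) (snd l))" "Ck (Suc 0) (k22 (snd l) (snd l))"
    using Ck_k12 Ck_k22 b by simp_all
  show ?thesis
    unfolding drift_div_def[abs_def] using b
    by (intro lip_on_boxes_mult lip_on_boxes_const lip_on_boxes_sum lip_on_boxes_diff lip_on_boxes_add
        lip_kernel lip_on_boxes_comp2[OF Ck_k2'] lip_on_boxes_comp1[OF Ck_grad_V']
        lip_on_boxes_comp2[OF 1(1)] lip_on_boxes_comp2[OF 1(2)] lip_on_boxes_comp1[OF Ck_VV]) auto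
qed

lemma diagonal_derivative:
  assumes b: "b \<in> Basis"
  shows "((\<lambda>s. k2 b (y + s *\<^sub>R b, y + s *\<^sub>R b) - k (y + s *\<^sub>R b) (y + s *\<^sub>R b) * (grad V (y + s *\<^sub>R b) \<bullet> b))
    has_real_derivative (k12 b b (y, y) - k2 b (y, y) * (grad V y \<bullet> b) -
      (k2 b (y, y) * (grad V y \<bullet> b) + k y y * VV b y - k22 b b (y, y)))) (at 0)"
proof -
  have split: "F (b, b) = F (b, 0) + F (0, b)" if "linear F" for F :: "'a \<times> 'a \<Rightarrow> real"
    using linear_add[OF that, of "(b, 0)" "(0, b)"] by simp
  have 1: "((\<lambda>s. k2 b (y + s *\<^sub>R b, y + s *\<^sub>R b)) has_real_derivative (k12 b b (y, y) + k22 b b (y, y))) (at 0)"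
    using Ck_line_derivative[OF Ck_k2'[OF b], of "(y, y)" "(b, b)" 0]
      split[OF Ck_frechet_linear[OF Ck_k2'[OF b]], of "(y, y)"]
    by (simp add: k12_def k22_def)
  have 2: "((\<lambda>s. k (y + s *\<^sub>R b) (y + s *\<^sub>R b)) has_real_derivative (k2 b (y, y) + k2 b (y, y))) (at 0)"
    using Ck_line_derivative[OF smooth', of "(y, y)" "(b, b)" 0]
      split[OF Ck_frechet_linear[OF smooth'], of "(y, y)"] k1_eq[of y y b]
    by (simp add: k2_def)
  have 3: "((\<lambda>s. grad V (y + s *\<^sub>R b) \<bullet> b) has_real_derivative VV b y) (at 0)"
    using Ck_line_derivative[OF Ck_grad_V'[OF b], of y b 0] by (simp add: VV_def)
  show ?thesis
    by (rule DERIV_cong[OF DERIV_diff[OF 1 DERIV_mult[OF 2 3]]]) (simp add: algebra_simps)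
qed

lemma drift_derivative:
  assumes l: "l \<in> axes N"
  shows "((\<lambda>s. drift N l (shift l s z)) has_real_derivative drift_div N l z) (at 0)"
proof -
  obtain i b where lib: "l = (i, b)" by (cases l)
  then have i: "i < N" and b: "b \<in> Basis" using axes_D[OF l] by auto
  define d where "d = (\<lambda>j. k12 b b (z i, z j) - k2 b (z j, z i) * (grad V (z j) \<bullet> b) -
      (if j = i then k2 b (z i, z i) * (grad V (z i) \<bullet> b) + k (z i) (z i) * VV b (z i) - k22 b b (z i, z i) else 0))"
  have "((\<lambda>s. k2 b (shift l s z i, shift l s z j) -
     k (shift l s z i) (shift l s z j) * (grad V (shift l s z j) \<bullet> b)) has_real_derivative d j) (at 0)" for j
  proof (cases "j = i")
    case True
    then show ?thesis
      using diagonal_derivative[OF b, of "z i"] by (simp add: d_def shift_apply lib)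
  next
    case False
    have 1: "((\<lambda>s. k2 b (z i + s *\<^sub>R b, z j)) has_real_derivative k12 b b (z i, z j)) (at 0)"
      using k2_line1[of b "z i" b "z j" 0] by simp
    have 2: "((\<lambda>s. k (z i + s *\<^sub>R b) (z j)) has_real_derivative k2 b (z j, z i)) (at 0)"
      using k_line2[of "z j" "z i" b 0] by (simp add: kernel_sym[of _ "z j"])
    have "((\<lambda>s. k2 b (z i + s *\<^sub>R b, z j) - k (z i + s *\<^sub>R b) (z j) * (grad V (z j) \<bullet> b))
        has_real_derivative k12 b b (z i, z j) - k2 b (z j, z i) * (grad V (z j) \<bullet> b)) (at 0)"
      by (rule DERIV_diff[OF 1 DERIV_cmult_right[OF 2]])
    then show ?thesis using False by (simp add: d_def shift_apply lib)
  qed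
  then have "((\<lambda>s. (1 / real N) * (\<Sum>j<N. k2 b (shift l s z i, shift l s z j) -
     k (shift l s z i) (shift l s z j) * (grad V (shift l s z j) \<bullet> b))) has_real_derivative
     (1 / real N) * (\<Sum>j<N. d j)) (at 0)"
    by (intro DERIV_cmult DERIV_sum)
  moreover have "(1 / real N) * (\<Sum>j<N. d j) = drift_div N l z"
    using i unfolding drift_div_def d_def lib by (simp add: sum_subtractf)
  ultimately show ?thesis unfolding drift_def lib by simp
qed

lemma axis_field_drift: "axis_field N (drift N) (drift_div N)"
  by standard (rule lip_drift lip_drift_div drift_derivative; assumption)+

text \<open>\<open>A - B\<close> summed over the basis is the Stein kernel at
  \<open>(z i, z j)\<close>, so the double sum is \<open>(real N)\<^sup>2 * ksd_sq N z\<close>, and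
  the prefactor \<open>1 / real N\<close> of the field leaves one power of \<open>N\<close>. The
  left-hand side is the Stein operator of the product target applied to the particle field.\<close>

lemma divergence_identity:
  assumes N: "N > 0"
  shows "(\<Sum>l\<in>axes N. drift_div N l z) - (\<Sum>i<N. grad V (z i) \<bullet> svgd_field V k N z i) =
    real N * ksd_sq N z - (1 / real N) * (\<Sum>i<N. Cstar V k (z i))"
proof -
  define A where "A = (\<lambda>i j b. k12 b b (z i, z j) - k2 b (z j, z i) * (grad V (z j) \<bullet> b))"
  define B where "B = (\<lambda>i j b. (grad V (z i) \<bullet> b) * (k2 b (z i, z j) - k (z i) (z j) * (grad V (z j) \<bullet> b)))"
  have 1: "(\<Sum>l\<in>axes N. drift_div N l z) =
      (1 / real N) * ((\<Sum>i<N. \<Sum>b\<in>Basis. \<Sum>j<N. A i j b) - (\<Sum>i<N. Cstar V k (z i)))"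
    unfolding sum_axes drift_div_def Cstar_expand A_def
    by (simp add: sum_distrib_left[symmetric] sum_divide_distrib[symmetric] sum_subtractf[symmetric])
  have "grad V (z i) \<bullet> svgd_field V k N z i = (1 / real N) * (\<Sum>b\<in>Basis. \<Sum>j<N. B i j b)" for i
  proof -
    have "grad V (z i) \<bullet> svgd_field V k N z i = (\<Sum>b\<in>Basis. (grad V (z i) \<bullet> b) * drift N (i, b) z)"
      by (subst euclidean_inner) (simp add: svgd_field_inner)
    also have "\<dots> = (1 / real N) * (\<Sum>b\<in>Basis. \<Sum>j<N. B i j b)"
      unfolding sum_distrib_left
      by (intro sum.cong refl) (simp add: drift_def B_def sum_distrib_left sum_divide_distrib)
    finally show ?thesis .
  qed
  then have 2: "(\<Sum>i<N. grad V (z i) \<bullet> svgd_field V k N z i) = (1 / real N) * (\<Sum>i<N. \<Sum>b\<in>Basis. \<Sum>j<N. B i j b)"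
    by (simp only: sum_distrib_left)
  have 3: "(\<Sum>b\<in>Basis. A i j b - B i j b) = stein_kernel (z i) (z j)" for i j
    unfolding stein_kernel_def A_def B_def by (intro sum.cong refl) (simp add: algebra_simps)
  have "(\<Sum>i<N. \<Sum>b\<in>Basis. \<Sum>j<N. A i j b) - (\<Sum>i<N. \<Sum>b\<in>Basis. \<Sum>j<N. B i j b) =
      (\<Sum>i<N. \<Sum>b\<in>Basis. \<Sum>j<N. A i j b - B i j b)"
    by (simp only: sum_subtractf)
  also have "\<dots> = (\<Sum>i<N. \<Sum>j<N. \<Sum>b\<in>Basis. A i j b - B i j b)"
    by (intro sum.cong refl sum.swap)
  also have "\<dots> = (real N)\<^sup>2 * ksd_sq N z"
    unfolding 3 ksd_sq_explicit using N by simp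
  finally have 4: "(\<Sum>i<N. \<Sum>b\<in>Basis. \<Sum>j<N. A i j b) - (\<Sum>i<N. \<Sum>b\<in>Basis. \<Sum>j<N. B i j b) =
    (real N)\<^sup>2 * ksd_sq N z" .
  have "(\<Sum>l\<in>axes N. drift_div N l z) - (\<Sum>i<N. grad V (z i) \<bullet> svgd_field V k N z i) =
      (1 / real N) * ((real N)\<^sup>2 * ksd_sq N z) - (1 / real N) * (\<Sum>i<N. Cstar V k (z i))"
    unfolding 1 2 4[symmetric] by (simp add: right_diff_distrib)
  then show ?thesis using N by (simp add: power2_eq_square)
qed

end

section \<open>Particle trajectories and change of measure\<close>

lemma nn_integral_Icc_continuous:
  fixes f :: "real \<Rightarrow> real"
  assumes f: "continuous_on {a..b} f" and nonneg: "\<And>t. t \<in> {a..b} \<Longrightarrow> 0 \<le> f t"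
  shows "(\<integral>\<^sup>+t\<in>{a..b}. ennreal (f t) \<partial>lborel) = ennreal (integral {a..b} f)"
proof -
  have si: "set_integrable lborel {a..b} f" by (rule borel_integrable_atLeastAtMost'[OF f])
  have "(\<integral>\<^sup>+t\<in>{a..b}. ennreal (f t) \<partial>lborel) = (\<integral>\<^sup>+t. ennreal (indicator {a..b} t *\<^sub>R f t) \<partial>lborel)"
    by (intro nn_integral_cong) (auto simp: indicator_def)
  also have "\<dots> = ennreal (\<integral>t. indicator {a..b} t *\<^sub>R f t \<partial>lborel)"
    using si nonneg unfolding set_integrable_def
    by (intro nn_integral_eq_integral) (auto simp: indicator_def)
  also have "(\<integral>t. indicator {a..b} t *\<^sub>R f t \<partial>lborel) = integral {a..b} f"
    using set_borel_integral_eq_integral(2)[OF si] by (simp add: set_lebesgue_integral_def)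
  finally show ?thesis .
qed

context svgd_setting
begin

lemma frechet_V: "frechet_derivative V (at x) v = grad V x \<bullet> v"
proof -
  interpret linear "frechet_derivative V (at x)" by (rule Ck_frechet_linear[OF V_smooth'])
  have "frechet_derivative V (at x) v = frechet_derivative V (at x) (\<Sum>b\<in>Basis. (v \<bullet> b) *\<^sub>R b)"
    by (simp only: euclidean_representation)
  also have "\<dots> = (\<Sum>b\<in>Basis. (v \<bullet> b) * frechet_derivative V (at x) b)"
    by (simp only: sum scale real_scaleR_def)
  also have "\<dots> = grad V x \<bullet> v"
    by (subst euclidean_inner) (simp add: grad_inner mult.commute)
  finally show ?thesis .
qed

lemma drift_restrict: "l \<in> axes N \<Longrightarrow> drift N l (restrict z {..<N}) = drift N l z"
  using axes_D(1)[of l N] by (simp add: drift_def)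

lemma drift_div_restrict: "l \<in> axes N \<Longrightarrow> drift_div N l (restrict z {..<N}) = drift_div N l z"
  using axes_D(1)[of l N] by (simp add: drift_div_def)

lemma ksd_sq_restrict: "ksd_sq N (restrict z {..<N}) = ksd_sq N z"
  by (simp add: ksd_sq_explicit)

lemma solution_continuous:
  assumes "svgd_solution V k N {0..} y" "i < N"
  shows "continuous_on {0..} (\<lambda>t. y t i)"
  using assms by (auto simp: svgd_solution_def continuous_on_eq_continuous_within
      intro!: has_vector_derivative_continuous)

lemma restrict_continuous:
  assumes "\<And>i. i < N \<Longrightarrow> continuous_on S (\<lambda>t. y t i :: 'a)"
  shows "continuous_on S (\<lambda>t. restrict (y t) {..<N})"
proof (rule continuous_on_coordinatewise_then_product)
  fix i
  show "continuous_on S (\<lambda>t. restrict (y t) {..<N} i)"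
    using assms by (cases "i < N") auto
qed

definition log_jac :: "nat \<Rightarrow> (real \<Rightarrow> nat \<Rightarrow> 'a) \<Rightarrow> real \<Rightarrow> real" where
  "log_jac N y t = integral {0..t} (\<lambda>s. \<Sum>l\<in>axes N. drift_div N l (restrict (y s) {..<N}))"

lemma continuous_drift_div_sum:
  assumes "svgd_solution V k N {0..} y"
  shows "continuous_on {0..} (\<lambda>s. \<Sum>l\<in>axes N. drift_div N l (restrict (y s) {..<N}))"
proof (rule continuous_on_sum)
  fix l :: "nat \<times> 'a" assume "l \<in> axes N"
  then have "continuous_on UNIV (drift_div N l)" by (rule lip_on_boxes_continuous[OF lip_drift_div])
  from continuous_on_compose2[OF this restrict_continuous[OF solution_continuous[OF assms]]]
  show "continuous_on {0..} (\<lambda>s. drift_div N l (restrict (y s) {..<N}))" by simp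
qed

lemma log_jac_derivative:
  assumes sol: "svgd_solution V k N {0..} y" and t: "t \<in> {0..T}"
  shows "(log_jac N y has_real_derivative (\<Sum>l\<in>axes N. drift_div N l (restrict (y t) {..<N})))
    (at t within {0..T})"
proof -
  have "continuous_on {0..T} (\<lambda>s. \<Sum>l\<in>axes N. drift_div N l (restrict (y s) {..<N}))"
    by (rule continuous_on_subset[OF continuous_drift_div_sum[OF sol]]) auto
  from integral_has_vector_derivative[OF this t] show ?thesis
    by (simp add: log_jac_def[abs_def] has_real_derivative_iff_has_vector_derivative)
qed

lemma solution_trajectory:
  assumes sol: "svgd_solution V k N {0..} y"
  shows "axis_field.axis_trajectory N (drift N) (drift_div N) T (\<lambda>t. restrict (y t) {..<N}) (log_jac N y)"
  unfolding axis_field.axis_trajectory_def[OF axis_field_drift]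
proof (intro conjI ballI)
  show "log_jac N y 0 = 0" by (simp add: log_jac_def)
  fix t assume t: "t \<in> {0..T}"
  show "restrict (y t) {..<N} \<in> configs N" by (simp add: configs_def)
  show "(log_jac N y has_real_derivative (\<Sum>l\<in>axes N. drift_div N l (restrict (y t) {..<N}))) (at t within {0..T})"
    by (rule log_jac_derivative[OF sol t])
  fix l :: "nat \<times> 'a" assume l: "l \<in> axes N"
  obtain i b where lib: "l = (i, b)" by (cases l)
  then have i: "i < N" and b: "b \<in> Basis" using axes_D[OF l] by auto
  have "((\<lambda>t. y t i) has_vector_derivative svgd_field V k N (y t) i) (at t within {0..})"
    using sol i t by (simp add: svgd_solution_def)
  then have "((\<lambda>t. y t i) has_derivative (\<lambda>h. h *\<^sub>R svgd_field V k N (y t) i)) (at t within {0..T})"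
    unfolding has_vector_derivative_def by (rule has_derivative_subset) auto
  then have "((\<lambda>t. y t i \<bullet> b) has_derivative (\<lambda>h. (h *\<^sub>R svgd_field V k N (y t) i) \<bullet> b)) (at t within {0..T})"
    by (rule has_derivative_inner_left)
  moreover have "(\<lambda>h. (h *\<^sub>R svgd_field V k N (y t) i) \<bullet> b) = (*) (drift N l (restrict (y t) {..<N}))"
    by (simp add: fun_eq_iff svgd_field_inner[OF b] drift_restrict[OF l] lib[symmetric] mult.commute)
  ultimately show "((\<lambda>t. restrict (y t) {..<N} (fst l) \<bullet> snd l) has_real_derivative drift N l (restrict (y t) {..<N}))
      (at t within {0..T})"
    using i by (simp add: lib has_field_derivative_def)
qed

text \<open>The time derivative of \<open>log_jac N y t - (\<Sum>i<N. V (y t i))\<close> is the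
  left-hand side of \<open>divergence_identity\<close>. The potential stands for the logarithm of
  the target, whose normalising constant cancels between the two end points.\<close>

lemma energy_identity:
  assumes N: "N > 0" and sol: "svgd_solution V k N {0..} y" and T: "T \<ge> 0"
  shows "((\<lambda>t. real N * ksd_sq N (y t) - (\<Sum>i<N. Cstar V k (y t i)) / real N) has_integral
    (log_jac N y T - (\<Sum>i<N. V (y T i)) + (\<Sum>i<N. V (y 0 i)))) {0..T}"
proof -
  have "((\<lambda>t. real N * ksd_sq N (y t) - (\<Sum>i<N. Cstar V k (y t i)) / real N) has_integral
    ((log_jac N y T - (\<Sum>i<N. V (y T i))) - (log_jac N y 0 - (\<Sum>i<N. V (y 0 i))))) {0..T}"
  proof (rule fundamental_theorem_of_calculus[OF T])
    fix t assume t: "t \<in> {0..T}"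
    have "((\<lambda>t. V (y t i)) has_real_derivative grad V (y t i) \<bullet> svgd_field V k N (y t) i) (at t within {0..T})"
      if i: "i < N" for i
    proof -
      have "((\<lambda>t. y t i) has_vector_derivative svgd_field V k N (y t) i) (at t within {0..})"
        using sol i t by (simp add: svgd_solution_def)
      then have "((\<lambda>t. y t i) has_derivative (\<lambda>h. h *\<^sub>R svgd_field V k N (y t) i)) (at t within {0..T})"
        unfolding has_vector_derivative_def by (rule has_derivative_subset) auto
      from has_derivative_compose[OF this Ck_has_derivative[OF V_smooth']]
      have "((\<lambda>t. V (y t i)) has_derivative (\<lambda>h. grad V (y t i) \<bullet> (h *\<^sub>R svgd_field V k N (y t) i))) (at t within {0..T})"
        by (simp add: frechet_V)
      moreover have "(\<lambda>h. grad V (y t i) \<bullet> (h *\<^sub>R svgd_field V k N (y t) i)) =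
          (*) (grad V (y t i) \<bullet> svgd_field V k N (y t) i)"
        by (simp add: fun_eq_iff mult.commute)
      ultimately show ?thesis by (simp add: has_field_derivative_def)
    qed
    then have "((\<lambda>t. log_jac N y t - (\<Sum>i<N. V (y t i))) has_real_derivative
        ((\<Sum>l\<in>axes N. drift_div N l (restrict (y t) {..<N})) -
          (\<Sum>i<N. grad V (y t i) \<bullet> svgd_field V k N (y t) i))) (at t within {0..T})"
      by (intro DERIV_diff DERIV_sum log_jac_derivative[OF sol t]) auto
    moreover have "(\<Sum>l\<in>axes N. drift_div N l (restrict (y t) {..<N})) = (\<Sum>l\<in>axes N. drift_div N l (y t))"
      by (intro sum.cong refl drift_div_restrict)
    ultimately show "((\<lambda>t. log_jac N y t - (\<Sum>i<N. V (y t i))) has_vector_derivative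
        real N * ksd_sq N (y t) - (\<Sum>i<N. Cstar V k (y t i)) / real N) (at t within {0..T})"
      using divergence_identity[OF N, of "y t"] by (simp add: has_real_derivative_iff_has_vector_derivative)
  qed
  then show ?thesis by (simp add: log_jac_def algebra_simps)
qed

lemma continuous_Cstar: "continuous_on UNIV (Cstar V k)"
proof -
  have c2: "continuous_on UNIV (k2 b)" "continuous_on UNIV (k22 b b)" "continuous_on UNIV (VV b)" if "b \<in> Basis" for b
    using Ck_continuous[OF Ck_k2[OF that]] Ck_continuous[OF Ck_k22[OF that that]] Ck_continuous[OF Ck_VV[OF that]] .
  have c3: "continuous_on UNIV (\<lambda>z. k z z)"
    using continuous_on_compose2[OF Ck_continuous[OF smooth], of UNIV "\<lambda>z. (z, z)"]
    by (simp add: continuous_on_Pair continuous_on_id)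
  show ?thesis
    unfolding Cstar_expand[abs_def]
    by (intro continuous_on_sum continuous_on_add continuous_on_diff continuous_on_mult c3 c2(3) continuous_grad_V
        continuous_on_compose2[OF c2(1)] continuous_on_compose2[OF c2(2)] continuous_intros) auto
qed

end

section \<open>Measurability of the random trajectories\<close>

locale svgd_ensemble = svgd_setting k H ip V + proc: svgd_process V k N M x p
  for k :: "'a::euclidean_space \<Rightarrow> 'a \<Rightarrow> real" and H ip and V :: "'a \<Rightarrow> real" and N
    and M :: "'w measure" and x p +
  assumes N_pos: "N > 0" and V_int: "integrable lborel (\<lambda>y. exp (- V y))"
begin

sublocale prob_space M by (rule proc.prob)

definition pos :: "real \<Rightarrow> 'w \<Rightarrow> nat \<Rightarrow> 'a" where
  "pos t w = restrict (x t w) {..<N}"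

lemma pos_configs: "pos t w \<in> configs N"
  by (simp add: pos_def configs_def)

lemma pos_measurable: "t \<ge> 0 \<Longrightarrow> pos t \<in> M \<rightarrow>\<^sub>M config_lborel N"
  using distributed_measurable[OF proc.density] by (simp add: pos_def[abs_def])

lemma path_continuous: "w \<in> space M \<Longrightarrow> i < N \<Longrightarrow> continuous_on {0..} (\<lambda>t. x t w i)"
  by (rule solution_continuous[OF proc.dynamics])

lemma coordinate_measurable: "t \<ge> 0 \<Longrightarrow> i < N \<Longrightarrow> (\<lambda>w. x t w i) \<in> borel_measurable M"
  using measurable_compose[OF pos_measurable measurable_config_component, of t i] by (simp add: pos_def)

text \<open>Positions are measurable at each fixed time and paths are continuous, so rounding time
  down to the grid of step \<open>1 / (n + 1)\<close> gives measurable approximations with countably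
  many time values. Grid times are clamped at 0, as both facts hold for nonnegative times.\<close>

lemma joint_measurable: "(\<lambda>q. pos (max 0 (snd q)) (fst q)) \<in> M \<Otimes>\<^sub>M lborel \<rightarrow>\<^sub>M config_lborel N"
proof (rule measurable_into_config_lborel)
  fix i assume i: "i < N"
  define s where "s = (\<lambda>(n::nat) (m::int). max 0 (real_of_int m / real (Suc n)))"
  have "(\<lambda>q. x (max 0 (snd q)) (fst q) i) \<in> borel_measurable (M \<Otimes>\<^sub>M lborel)"
  proof (rule borel_measurable_LIMSEQ_metric)
    fix n
    show "(\<lambda>q. x (s n \<lfloor>real (Suc n) * snd q\<rfloor>) (fst q) i) \<in> borel_measurable (M \<Otimes>\<^sub>M lborel)"
    proof (rule measurable_compose_countable[where f="\<lambda>m q. x (s n m) (fst q) i"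
          and g="\<lambda>q::'w \<times> real. \<lfloor>real (Suc n) * snd q\<rfloor>"])
      fix m :: int
      have "(\<lambda>w. x (s n m) w i) \<in> borel_measurable M"
        by (intro coordinate_measurable i) (simp add: s_def)
      then show "(\<lambda>q. x (s n m) (fst q) i) \<in> borel_measurable (M \<Otimes>\<^sub>M lborel)"
        by (rule measurable_compose[OF measurable_fst])
    qed measurable
  next
    fix q :: "'w \<times> real" assume "q \<in> space (M \<Otimes>\<^sub>M lborel)"
    then have w: "fst q \<in> space M" by (auto simp: space_pair_measure)
    have "(\<lambda>n. real_of_int \<lfloor>real (Suc n) * snd q\<rfloor> / real (Suc n)) \<longlonglongrightarrow> snd q"
    proof (rule tendsto_sandwich)
      show "\<forall>\<^sub>F n in sequentially. snd q - 1 / real (Suc n) \<le> real_of_int \<lfloor>real (Suc n) * snd q\<rfloor> / real (Suc n)"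
      proof (intro always_eventually allI)
        fix n
        have "real (Suc n) * snd q - 1 \<le> real_of_int \<lfloor>real (Suc n) * snd q\<rfloor>" by linarith
        then have "(real (Suc n) * snd q - 1) / real (Suc n) \<le> real_of_int \<lfloor>real (Suc n) * snd q\<rfloor> / real (Suc n)"
          by (intro divide_right_mono) auto
        then show "snd q - 1 / real (Suc n) \<le> real_of_int \<lfloor>real (Suc n) * snd q\<rfloor> / real (Suc n)"
          by (simp add: diff_divide_distrib)
      qed
      show "\<forall>\<^sub>F n in sequentially. real_of_int \<lfloor>real (Suc n) * snd q\<rfloor> / real (Suc n) \<le> snd q"
      proof (intro always_eventually allI)
        fix n
        have "real_of_int \<lfloor>real (Suc n) * snd q\<rfloor> / real (Suc n) \<le> (real (Suc n) * snd q) / real (Suc n)"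
          by (intro divide_right_mono) auto
        then show "real_of_int \<lfloor>real (Suc n) * snd q\<rfloor> / real (Suc n) \<le> snd q" by simp
      qed
      have "(\<lambda>n. 1 / real (Suc n)) \<longlonglongrightarrow> 0"
        using LIMSEQ_inverse_real_of_nat by (simp add: divide_inverse)
      then show "(\<lambda>n. snd q - 1 / real (Suc n)) \<longlonglongrightarrow> snd q"
        using tendsto_diff[OF tendsto_const[of "snd q"]] by fastforce
    qed simp
    then have lim: "(\<lambda>n. s n \<lfloor>real (Suc n) * snd q\<rfloor>) \<longlonglongrightarrow> max 0 (snd q)"
      unfolding s_def by (intro tendsto_max tendsto_const)
    show "(\<lambda>n. x (s n \<lfloor>real (Suc n) * snd q\<rfloor>) (fst q) i) \<longlonglongrightarrow> x (max 0 (snd q)) (fst q) i"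
      by (rule continuous_on_tendsto_compose[OF path_continuous[OF w i] lim]) (auto simp: s_def)
  qed
  then show "(\<lambda>q. pos (max 0 (snd q)) (fst q) i) \<in> borel_measurable (M \<Otimes>\<^sub>M lborel)"
    using i by (simp add: pos_def)
qed (rule pos_configs)

text \<open>\<open>distributed\<close> provides measurability of \<open>ennreal (p t z)\<close>;
  nonnegativity on \<open>configs N\<close> recovers the real function from it.\<close>

lemma density_measurable: "t \<ge> 0 \<Longrightarrow> p t \<in> borel_measurable (config_lborel N)"
proof -
  assume t: "t \<ge> 0"
  have "(\<lambda>z. enn2real (ennreal (p t z))) \<in> borel_measurable (config_lborel N)"
    using distributed_borel_measurable[OF proc.density[OF t]] by measurable
  then show ?thesis
    by (rule measurable_cong[THEN iffD1, rotated]) (use proc.density_nonneg[OF t] in auto)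
qed

text \<open>Along a path the integrand is continuous, so the gauge integral is a Lebesgue integral,
  and the latter depends measurably on \<open>w\<close> by joint measurability.\<close>

lemma log_jac_measurable:
  assumes T: "T \<ge> 0"
  shows "(\<lambda>w. log_jac N (\<lambda>t. x t w) T) \<in> borel_measurable M"
proof -
  define F :: "(nat \<Rightarrow> 'a) \<Rightarrow> real" where "F = (\<lambda>z. \<Sum>l\<in>axes N. drift_div N l z)"
  have F: "F \<in> borel_measurable (config_lborel N)"
    unfolding F_def
    by (intro continuous_measurable_config continuous_on_sum lip_on_boxes_continuous[OF lip_drift_div])
  have eq: "log_jac N (\<lambda>t. x t w) T = (\<integral>s. indicator {0..T} s * F (pos (max 0 s) w) \<partial>lborel)"
    if w: "w \<in> space M" for w
  proof -
    have "continuous_on {0..T} (\<lambda>s. F (pos s w))"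
      unfolding F_def pos_def
      by (rule continuous_on_subset[OF continuous_drift_div_sum[OF proc.dynamics[OF w]]]) auto
    then have "set_integrable lborel {0..T} (\<lambda>s. F (pos s w))" by (rule borel_integrable_atLeastAtMost')
    then have "log_jac N (\<lambda>t. x t w) T = (LINT s:{0..T}|lborel. F (pos s w))"
      unfolding log_jac_def F_def pos_def by (rule set_borel_integral_eq_integral(2)[symmetric])
    also have "\<dots> = (\<integral>s. indicator {0..T} s * F (pos (max 0 s) w) \<partial>lborel)"
      unfolding set_lebesgue_integral_def
      by (intro Bochner_Integration.integral_cong) (auto simp: indicator_def)
    finally show ?thesis .
  qed
  have "(\<lambda>q. indicator {0..T} (snd q) * F (pos (max 0 (snd q)) (fst q))) \<in> borel_measurable (M \<Otimes>\<^sub>M lborel)"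
    by (intro borel_measurable_times measurable_compose[OF joint_measurable F]) measurable
  then have "(\<lambda>w. \<integral>s. indicator {0..T} s * F (pos (max 0 s) w) \<partial>lborel) \<in> borel_measurable M"
    by (intro lborel.borel_measurable_lebesgue_integral) (simp add: case_prod_unfold)
  then show ?thesis
    by (rule measurable_cong[THEN iffD1, rotated]) (simp add: eq)
qed

text \<open>
  Outer regularity extends the inequality from test functions to arbitrary measurable \<open>g\<close>, in particular
  to the density at time \<open>T\<close>.
\<close>

lemma change_of_measure:
  assumes T: "T > 0" and g: "g \<in> borel_measurable (config_lborel N)"
  shows "(\<integral>\<^sup>+w. (ennreal (exp (log_jac N (\<lambda>t. x t w) T)) / ennreal (p 0 (pos 0 w))) * g (pos T w) \<partial>M) \<le>
    (\<integral>\<^sup>+z. g z \<partial>config_lborel N)"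
proof -
  define h where "h = (\<lambda>w. ennreal (exp (log_jac N (\<lambda>t. x t w) T)) / ennreal (p 0 (pos 0 w)))"
  have p0: "(\<lambda>z. ennreal (p 0 z)) \<in> borel_measurable (config_lborel N)"
    using density_measurable[of 0] by simp
  have hm: "h \<in> borel_measurable M"
    unfolding h_def
    by (intro borel_measurable_divide_ennreal measurable_compose[OF _ measurable_ennreal]
        measurable_compose[OF log_jac_measurable borel_measurable_exp] measurable_compose[OF pos_measurable density_measurable])
      (use T in auto)
  have posm: "pos T \<in> M \<rightarrow>\<^sub>M borel"
    using measurable_compose[OF pos_measurable measurable_config_inclusion, of T] T by simp
  \<comment> \<open>The law of the position at time \<open>T\<close> under the weight
    \<open>h\<close>. The claim says that it is dominated by Lebesgue measure on
    configurations.\<close>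
  define \<nu> where "\<nu> = distr (density M h) borel (pos T)"
  have \<nu>I: "(\<integral>\<^sup>+z. f z \<partial>\<nu>) = (\<integral>\<^sup>+w. h w * f (pos T w) \<partial>M)" if f: "f \<in> borel_measurable borel" for f
  proof -
    have "(\<integral>\<^sup>+z. f z \<partial>\<nu>) = (\<integral>\<^sup>+w. f (pos T w) \<partial>density M h)"
      unfolding \<nu>_def using posm f by (intro nn_integral_distr) auto
    also have "\<dots> = (\<integral>\<^sup>+w. h w * f (pos T w) \<partial>M)"
      by (intro nn_integral_density hm measurable_compose[OF posm f])
    finally show ?thesis .
  qed
  interpret axis_field N "drift N" "drift_div N" by (rule axis_field_drift)
  have test: "(\<integral>\<^sup>+z. ennreal (f z) \<partial>\<nu>) \<le> (\<integral>\<^sup>+z. ennreal (f z) \<partial>config_lborel N)"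
    if f: "test_function N f" "\<And>z. 0 \<le> f z" for f
  proof -
    obtain G where G: "G \<in> borel_measurable (config_lborel N)"
      "(\<integral>\<^sup>+z. G z \<partial>config_lborel N) \<le> (\<integral>\<^sup>+z. ennreal (f z) \<partial>config_lborel N)"
      "\<And>X \<Lambda>. axis_trajectory T X \<Lambda> \<Longrightarrow> G (X 0) = ennreal (f (X T) * exp (\<Lambda> T))"
      by (rule liouville_test_function[OF T f]) blast
    have "f \<in> borel_measurable borel"
      using f(1) by (intro borel_measurable_continuous_onI) (simp add: test_function_def)
    then have "(\<integral>\<^sup>+z. ennreal (f z) \<partial>\<nu>) = (\<integral>\<^sup>+w. h w * ennreal (f (pos T w)) \<partial>M)"
      by (intro \<nu>I) simp
    also have "\<dots> = (\<integral>\<^sup>+w. G (pos 0 w) / ennreal (p 0 (pos 0 w)) \<partial>M)"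
    proof (rule nn_integral_cong)
      fix w assume "w \<in> space M"
      from G(3)[OF solution_trajectory[OF proc.dynamics[OF this]]]
      have "G (pos 0 w) = ennreal (exp (log_jac N (\<lambda>t. x t w) T)) * ennreal (f (pos T w))"
        using f(2) by (simp add: pos_def ennreal_mult mult.commute)
      then show "h w * ennreal (f (pos T w)) = G (pos 0 w) / ennreal (p 0 (pos 0 w))"
        by (simp add: h_def divide_ennreal_def mult_ac)
    qed
    also have "\<dots> = (\<integral>\<^sup>+z. ennreal (p 0 z) * (G z / ennreal (p 0 z)) \<partial>config_lborel N)"
      using distributed_nn_integral[OF proc.density[of 0], of "\<lambda>z. G z / ennreal (p 0 z)"] G(1) p0
      by (simp add: pos_def)
    \<comment> \<open>Equality where \<open>p 0 z > 0\<close>. Where the initial density vanishes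
      the left-hand side is 0, because a product with 0 is 0 in \<open>ennreal\<close> whatever the
      quotient.\<close>
    also have "\<dots> \<le> (\<integral>\<^sup>+z. G z \<partial>config_lborel N)"
    proof (rule nn_integral_mono)
      fix z
      show "ennreal (p 0 z) * (G z / ennreal (p 0 z)) \<le> G z"
      proof (cases "p 0 z \<le> 0")
        case True
        then show ?thesis by (simp add: ennreal_neg)
      next
        case False
        then show ?thesis
          by (simp add: ennreal_times_divide ennreal_mult_divide_eq mult.commute)
      qed
    qed
    also note G(2)
    finally show ?thesis .
  qed
  have sets_\<nu>: "sets \<nu> = sets borel" by (simp add: \<nu>_def)
  have "\<nu> \<le> distr (config_lborel N) borel (\<lambda>z. z)"
  proof (subst le_measure)
    show "\<forall>A\<in>sets \<nu>. emeasure \<nu> A \<le> emeasure (distr (config_lborel N) borel (\<lambda>z. z)) A"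
    proof
      fix A assume "A \<in> sets \<nu>"
      then have "A \<in> sets borel" by (simp add: sets_\<nu>)
      then show "emeasure \<nu> A \<le> emeasure (distr (config_lborel N) borel (\<lambda>z. z)) A"
        using emeasure_le_of_test_functions[where \<nu>=\<nu>, OF N_pos sets_\<nu>] test by blast
    qed
  qed (simp add: sets_\<nu>)
  then have le: "(\<integral>\<^sup>+z. f z \<partial>\<nu>) \<le> (\<integral>\<^sup>+z. f z \<partial>distr (config_lborel N) borel (\<lambda>z. z))" for f :: "(nat \<Rightarrow> 'a) \<Rightarrow> ennreal"
    by (intro nn_integral_mono_measure) (simp_all add: \<nu>_def)
  \<comment> \<open>\<open>g\<close> is measurable on extensional configurations, while
    \<open>\<nu>\<close> lives on the Borel sets of the whole function type. Composition with the
    restriction extends \<open>g\<close> without changing it on \<open>configs N\<close>.\<close>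
  define g' where "g' = (\<lambda>z. g (restrict z {..<N}))"
  have "(\<lambda>z. restrict z {..<N}) \<in> borel \<rightarrow>\<^sub>M (config_lborel N :: (nat \<Rightarrow> 'a) measure)"
  proof (rule measurable_into_config_lborel)
    fix i assume "i < N"
    then show "(\<lambda>w. restrict w {..<N} i) \<in> borel_measurable (borel :: (nat \<Rightarrow> 'a) measure)"
      by (simp add: borel_measurable_continuous_onI[OF continuous_on_product_coordinates])
  qed (simp add: configs_def)
  then have g': "g' \<in> borel_measurable borel" unfolding g'_def by (rule measurable_compose[OF _ g])
  have g'g: "g' z = g z" if "z \<in> configs N" for z
    using that by (simp add: g'_def configs_def PiE_restrict)
  have "(\<integral>\<^sup>+w. h w * g (pos T w) \<partial>M) = (\<integral>\<^sup>+w. h w * g' (pos T w) \<partial>M)"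
    using g'g[OF pos_configs] by simp
  also have "\<dots> = (\<integral>\<^sup>+z. g' z \<partial>\<nu>)" by (rule \<nu>I[OF g', symmetric])
  also have "\<dots> \<le> (\<integral>\<^sup>+z. g' z \<partial>distr (config_lborel N) borel (\<lambda>z. z))" by (rule le)
  also have "\<dots> = (\<integral>\<^sup>+z. g' z \<partial>config_lborel N)"
    using g' by (intro nn_integral_distr) auto
  also have "\<dots> = (\<integral>\<^sup>+z. g z \<partial>config_lborel N)"
    by (intro nn_integral_cong) (simp add: g'g)
  finally show ?thesis by (simp add: h_def)
qed

end

section \<open>Entropy inequality\<close>

lemma Cauchy_Schwarz_prob:
  assumes "prob_space M" "f \<in> borel_measurable M"
  shows "(\<integral>\<^sup>+x. f x \<partial>M)\<^sup>2 \<le> (\<integral>\<^sup>+x. (f x)\<^sup>2 \<partial>M)"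
  using Cauchy_Schwarz_nn_integral[OF assms(2), of "\<lambda>_. 1"] prob_space.emeasure_space_1[OF assms(1)]
  by simp

text \<open>The letters \<open>p\<close>, \<open>m\<close> and \<open>kp\<close>, \<open>km\<close>
  stand for the positive and negative parts of the \<open>Cstar\<close> term and of the initial
  entropy. If \<open>p\<close> or \<open>kp\<close> is infinite, the right-hand side is
  \<open>\<infinity>\<close>: \<open>km\<close> is finite, and both
  \<open>\<infinity> - \<infinity>\<close> and \<open>\<infinity> + (- \<infinity>)\<close> are
  \<open>\<infinity>\<close> in \<open>ereal\<close>. Otherwise \<open>le\<close> forces all terms
  to be finite and the claim is real arithmetic.\<close>

lemma entropy_arith_dissipation:
  fixes a m p kp km :: ennreal
  assumes n: "n > 0" and T: "T > 0" and km: "km \<noteq> top"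
    and le: "ennreal n * a + m * ennreal (1 / n) + km \<le> p * ennreal (1 / n) + kp"
  shows "enn2ereal a / ereal T \<le>
    (enn2ereal kp - enn2ereal km) / ereal (n * T) + (enn2ereal p - enn2ereal m) / ereal (n\<^sup>2 * T)"
proof (cases "p = top \<or> kp = top")
  case True
  obtain km' where km': "km = ennreal km'" "km' \<ge> 0" using km by (cases km) auto
  have inf: "(enn2ereal kp - enn2ereal km) / ereal (n * T) + (enn2ereal p - enn2ereal m) / ereal (n\<^sup>2 * T) = \<infinity>"
    using True km' n T by (cases kp; cases p; cases m) (auto simp: enn2ereal_ennreal)
  show ?thesis unfolding inf by simp
next
  case False
  then obtain p' kp' where p': "p = ennreal p'" "p' \<ge> 0" and kp': "kp = ennreal kp'" "kp' \<ge> 0"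
    by (cases p; cases kp) auto
  obtain km' where km': "km = ennreal km'" "km' \<ge> 0" using km by (cases km) auto
  have r: "p * ennreal (1 / n) + kp = ennreal (p' * (1 / n) + kp')"
    using p' kp' n by (simp add: ennreal_mult[symmetric] ennreal_plus[symmetric] del: ennreal_plus)
  have "ennreal n * a \<noteq> top" "m * ennreal (1 / n) \<noteq> top"
    using le unfolding r by (auto simp: top_unique)
  then obtain a' m' where a': "a = ennreal a'" "a' \<ge> 0" and m': "m = ennreal m'" "m' \<ge> 0"
    using n by (cases a; cases m) (auto simp: ennreal_mult_eq_top_iff)
  have l: "ennreal n * a + m * ennreal (1 / n) + km = ennreal (n * a' + m' * (1 / n) + km')"
    using a' m' km' n by (simp add: ennreal_mult[symmetric] ennreal_plus[symmetric] del: ennreal_plus)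
  have "n * a' + m' * (1 / n) + km' \<le> p' * (1 / n) + kp'"
    using le p' kp' n unfolding l r by (subst (asm) ennreal_le_iff) auto
  then have "(n * a' + m' * (1 / n) + km') / (n * T) \<le> (p' * (1 / n) + kp') / (n * T)"
    using n T by (intro divide_right_mono) auto
  then have "a' / T \<le> (kp' - km') / (n * T) + (p' - m') / (n\<^sup>2 * T)"
    using n T by (simp add: add_divide_distrib diff_divide_distrib power2_eq_square)
  then show ?thesis using a' m' p' kp' km' n T by (simp add: enn2ereal_ennreal)
qed

text \<open>The same case distinction, with \<open>tp\<close> and \<open>tm\<close> for the parts of
  the entropy at the final time. Finiteness of \<open>tm\<close> prevents the left-hand side from
  becoming \<open>\<infinity>\<close> as a difference of infinities.\<close>

lemma entropy_arith_growth:
  fixes tp tm m p kp km :: ennreal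
  assumes n: "n > 0" and km: "km \<noteq> top" and tm: "tm \<noteq> top"
    and le: "tp + m * ennreal (1 / n) + km \<le> tm + p * ennreal (1 / n) + kp"
  shows "enn2ereal tp - enn2ereal tm \<le>
    (enn2ereal kp - enn2ereal km) + (enn2ereal p - enn2ereal m) / ereal n"
proof (cases "p = top \<or> kp = top")
  case True
  obtain km' where km': "km = ennreal km'" "km' \<ge> 0" using km by (cases km) auto
  have inf: "(enn2ereal kp - enn2ereal km) + (enn2ereal p - enn2ereal m) / ereal n = \<infinity>"
    using True km' n by (cases kp; cases p; cases m) (auto simp: enn2ereal_ennreal)
  show ?thesis unfolding inf by simp
next
  case False
  then obtain p' kp' where p': "p = ennreal p'" "p' \<ge> 0" and kp': "kp = ennreal kp'" "kp' \<ge> 0"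
    by (cases p; cases kp) auto
  obtain km' where km': "km = ennreal km'" "km' \<ge> 0" using km by (cases km) auto
  obtain tm' where tm': "tm = ennreal tm'" "tm' \<ge> 0" using tm by (cases tm) auto
  have r: "tm + p * ennreal (1 / n) + kp = ennreal (tm' + p' * (1 / n) + kp')"
    using p' kp' tm' n by (simp add: ennreal_mult[symmetric] ennreal_plus[symmetric] del: ennreal_plus)
  have "tp \<noteq> top" "m * ennreal (1 / n) \<noteq> top"
    using le unfolding r by (auto simp: top_unique)
  then obtain tp' m' where tp': "tp = ennreal tp'" "tp' \<ge> 0" and m': "m = ennreal m'" "m' \<ge> 0"
    using n by (cases tp; cases m) (auto simp: ennreal_mult_eq_top_iff)
  have l: "tp + m * ennreal (1 / n) + km = ennreal (tp' + m' * (1 / n) + km')"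
    using tp' m' km' n by (simp add: ennreal_mult[symmetric] ennreal_plus[symmetric] del: ennreal_plus)
  have "tp' + m' * (1 / n) + km' \<le> tm' + p' * (1 / n) + kp'"
    using le p' kp' tm' n unfolding l r by (subst (asm) ennreal_le_iff) auto
  then have "tp' - tm' \<le> (kp' - km') + (p' - m') / n"
    by (simp add: diff_divide_distrib)
  then show ?thesis using tp' tm' m' p' kp' km' n by (simp add: enn2ereal_ennreal)
qed

section \<open>Target density and time integrals along the paths\<close>

context svgd_ensemble
begin

abbreviation Z :: real where "Z \<equiv> (\<integral>y. exp (- V y) \<partial>lborel)"

lemma Z_pos: "Z > 0"
proof -
  have "Z \<noteq> 0"
  proof
    assume "Z = 0"
    then have "AE y in lborel. exp (- V y) = 0"
      using integral_nonneg_eq_0_iff_AE[OF V_int] by simp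
    then have "AE y::'a in lborel. False" by simp
    then have "emeasure lborel (UNIV :: 'a set) = 0"
      by (subst (asm) AE_iff_measurable[of UNIV]) auto
    then show False by simp
  qed
  moreover have "Z \<ge> 0" by (intro Bochner_Integration.integral_nonneg) simp
  ultimately show ?thesis by linarith
qed

lemma prod_target_pos: "prod_target V N z > 0"
  unfolding prod_target_def target_density_def using Z_pos by (intro prod_pos) simp

lemma ln_prod_target: "ln (prod_target V N z) = - (\<Sum>i<N. V (z i)) - real N * ln Z"
proof -
  have "ln (prod_target V N z) = (\<Sum>i<N. ln (target_density V (z i)))"
    unfolding prod_target_def using Z_pos by (intro ln_prod) (auto simp: target_density_def)
  also have "\<dots> = (\<Sum>i<N. - V (z i) - ln Z)"
    unfolding target_density_def using Z_pos by (intro sum.cong refl) (simp add: ln_div)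
  finally show ?thesis by (simp add: sum_subtractf sum_negf)
qed

lemma prod_target_measurable: "prod_target V N \<in> borel_measurable (config_lborel N)"
proof (rule continuous_measurable_config)
  have "continuous_on UNIV (\<lambda>z::nat \<Rightarrow> 'a. V (z i))" for i
    by (rule continuous_on_compose2[OF Ck_continuous[OF V_smooth] continuous_on_product_coordinates]) auto
  then show "continuous_on UNIV (prod_target V N)"
    unfolding prod_target_def[abs_def] target_density_def using Z_pos by (intro continuous_intros) auto
qed

lemma nn_integral_prod_target: "(\<integral>\<^sup>+z. ennreal (prod_target V N z) \<partial>config_lborel N) = 1"
proof -
  interpret product_sigma_finite "\<lambda>_::nat. lborel :: 'a measure" by (rule sigma_finite_config)
  have d: "(\<lambda>y. ennreal (target_density V y)) \<in> borel_measurable lborel"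
    using V_int unfolding target_density_def by measurable
  have 1: "(\<integral>\<^sup>+y. ennreal (target_density V y) \<partial>lborel) = 1"
  proof -
    have "(\<integral>\<^sup>+y. ennreal (target_density V y) \<partial>lborel) = ennreal (\<integral>y. target_density V y \<partial>lborel)"
      using V_int Z_pos unfolding target_density_def
      by (intro nn_integral_eq_integral integrable_divide_zero) auto
    also have "(\<integral>y. target_density V y \<partial>lborel) = 1"
      using Z_pos unfolding target_density_def by simp
    finally show ?thesis by simp
  qed
  have "(\<integral>\<^sup>+z. ennreal (prod_target V N z) \<partial>config_lborel N) =
      (\<integral>\<^sup>+z. (\<Prod>i\<in>{..<N}. ennreal (target_density V (z i))) \<partial>PiM {..<N} (\<lambda>_. lborel))"
    unfolding config_lborel_def prod_target_def
    using Z_pos by (intro nn_integral_cong prod_ennreal[symmetric]) (simp add: target_density_def)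
  also have "\<dots> = (\<Prod>i\<in>{..<N}. (\<integral>\<^sup>+y. ennreal (target_density V y) \<partial>lborel))"
    by (rule product_nn_integral_prod) (use d in auto)
  finally show ?thesis unfolding 1 by simp
qed

text \<open>\<open>ennreal\<close> cuts off negative values, so only the positive part of
  \<open>\<Phi>\<close> is integrated and signed functions enter through two such integrals.
  \<open>max 0 t\<close> leaves the value unchanged and makes the integrand jointly measurable on
  the whole time axis.\<close>

definition time_integral :: "real \<Rightarrow> ((nat \<Rightarrow> 'a) \<Rightarrow> real) \<Rightarrow> 'w \<Rightarrow> ennreal" where
  "time_integral T \<Phi> w = (\<integral>\<^sup>+t\<in>{0..T}. ennreal (\<Phi> (pos (max 0 t) w)) \<partial>lborel)"

lemma time_integrand_measurable:
  assumes "continuous_on UNIV \<Phi>"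
  shows "(\<lambda>q. ennreal (\<Phi> (pos (max 0 (snd q)) (fst q))) * indicator {0..T} (snd q)) \<in> borel_measurable (M \<Otimes>\<^sub>M lborel)"
  by (intro borel_measurable_times_ennreal measurable_compose[OF _ measurable_ennreal]
      measurable_compose[OF joint_measurable continuous_measurable_config] assms) measurable

lemma time_integral_measurable:
  assumes "continuous_on UNIV \<Phi>"
  shows "time_integral T \<Phi> \<in> borel_measurable M"
  unfolding time_integral_def[abs_def]
  using lborel.borel_measurable_nn_integral_fst[OF time_integrand_measurable[OF assms]] by simp

lemma nn_integral_time_integral:
  assumes "continuous_on UNIV \<Phi>"
  shows "(\<integral>\<^sup>+w. time_integral T \<Phi> w \<partial>M) = (\<integral>\<^sup>+t\<in>{0..T}. (\<integral>\<^sup>+w. ennreal (\<Phi> (pos t w)) \<partial>M) \<partial>lborel)"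
proof -
  interpret P: pair_sigma_finite M "lborel :: real measure" ..
  have "(\<integral>\<^sup>+w. time_integral T \<Phi> w \<partial>M) =
      (\<integral>\<^sup>+t. (\<integral>\<^sup>+w. ennreal (\<Phi> (pos (max 0 t) w)) * indicator {0..T} t \<partial>M) \<partial>lborel)"
    unfolding time_integral_def
    using P.Fubini[OF time_integrand_measurable[OF assms, of T]] by simp
  also have "\<dots> = (\<integral>\<^sup>+t\<in>{0..T}. (\<integral>\<^sup>+w. ennreal (\<Phi> (pos t w)) \<partial>M) \<partial>lborel)"
    by (intro nn_integral_cong) (auto simp: indicator_def)
  finally show ?thesis .
qed

definition Cstar_sum :: "(nat \<Rightarrow> 'a) \<Rightarrow> real" where
  "Cstar_sum z = (\<Sum>i<N. Cstar V k (z i))"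

lemma Cstar_sum_pos: "Cstar_sum (pos t w) = (\<Sum>i<N. Cstar V k (x t w i))"
  by (simp add: Cstar_sum_def pos_def)

lemma ksd_sq_pos: "ksd_sq N (pos t w) = ksd_sq N (x t w)"
  by (simp add: pos_def ksd_sq_restrict)

lemma continuous_Cstar_sum: "continuous_on UNIV Cstar_sum"
  unfolding Cstar_sum_def[abs_def]
  by (intro continuous_on_sum continuous_on_compose2[OF continuous_Cstar continuous_on_product_coordinates]) auto

lemma continuous_ksd: "continuous_on UNIV (ksd_sq N)"
  using continuous_ksd_sq[of N UNIV "\<lambda>z. z"] by (simp add: continuous_on_product_coordinates)

lemma time_integral_eq_integral:
  assumes w: "w \<in> space M" and \<Phi>: "continuous_on UNIV \<Phi>"
  shows "continuous_on {0..T} (\<lambda>t. \<Phi> (pos t w))"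
    and "time_integral T \<Phi> w = ennreal (integral {0..T} (\<lambda>t. max 0 (\<Phi> (pos t w))))"
proof -
  have "continuous_on {0..} (\<lambda>t. pos t w)"
    unfolding pos_def by (rule restrict_continuous[OF path_continuous[OF w]])
  then have p: "continuous_on {0..T} (\<lambda>t. pos t w)"
    by (rule continuous_on_subset) auto
  show c: "continuous_on {0..T} (\<lambda>t. \<Phi> (pos t w))"
    by (rule continuous_on_compose2[OF \<Phi> p]) simp
  have "time_integral T \<Phi> w = (\<integral>\<^sup>+t\<in>{0..T}. ennreal (max 0 (\<Phi> (pos t w))) \<partial>lborel)"
    unfolding time_integral_def by (intro nn_integral_cong) (auto simp: indicator_def max_def ennreal_neg)
  also have "\<dots> = ennreal (integral {0..T} (\<lambda>t. max 0 (\<Phi> (pos t w))))"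
    by (rule nn_integral_Icc_continuous[OF continuous_on_max[OF continuous_on_const c]]) simp
  finally show "time_integral T \<Phi> w = ennreal (integral {0..T} (\<lambda>t. max 0 (\<Phi> (pos t w))))" .
qed

text \<open>On a single path everything is continuous on a compact interval, so the parts of
  \<open>Cstar_sum\<close> have finite time integrals and the energy identity can be split among
  them. Only their expectations may be infinite.\<close>

lemma path_energy:
  assumes w: "w \<in> space M" and T: "T \<ge> 0"
  obtains a c c' where "0 \<le> a" "0 \<le> c" "0 \<le> c'" "time_integral T (ksd_sq N) w = ennreal a"
    "time_integral T Cstar_sum w = ennreal c" "time_integral T (\<lambda>z. - Cstar_sum z) w = ennreal c'"
    "real N * a - c / real N + c' / real N =
      log_jac N (\<lambda>t. x t w) T - (\<Sum>i<N. V (x T w i)) + (\<Sum>i<N. V (x 0 w i))"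
    "c - c' = integral {0..T} (\<lambda>t. Cstar_sum (pos t w))"
proof -
  let ?K = "\<lambda>t. max 0 (ksd_sq N (pos t w))" and ?C = "\<lambda>t. max 0 (Cstar_sum (pos t w))"
    and ?C' = "\<lambda>t. max 0 (- Cstar_sum (pos t w))"
  note k = time_integral_eq_integral[OF w continuous_ksd, of T]
  note c = time_integral_eq_integral[OF w continuous_Cstar_sum, of T]
  have cont': "continuous_on UNIV (\<lambda>z. - Cstar_sum z)" by (intro continuous_intros continuous_Cstar_sum)
  note c' = time_integral_eq_integral[OF w cont', of T]
  have ik: "(?K has_integral integral {0..T} ?K) {0..T}"
    by (intro integrable_integral integrable_continuous_real continuous_intros k)
  have ic: "(?C has_integral integral {0..T} ?C) {0..T}"
    by (intro integrable_integral integrable_continuous_real continuous_intros c)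
  have ic': "(?C' has_integral integral {0..T} ?C') {0..T}"
    by (intro integrable_integral integrable_continuous_real continuous_intros c)
  have "((\<lambda>t. real N * ?K t - ?C t / real N + ?C' t / real N) has_integral
      (real N * integral {0..T} ?K - integral {0..T} ?C / real N + integral {0..T} ?C' / real N)) {0..T}"
    by (intro has_integral_add has_integral_diff has_integral_mult_right has_integral_divide ik ic ic')
  moreover have "(\<lambda>t. real N * ?K t - ?C t / real N + ?C' t / real N) =
      (\<lambda>t. real N * ksd_sq N (x t w) - (\<Sum>i<N. Cstar V k (x t w i)) / real N)"
  proof
    fix t
    have "max 0 r - max 0 (- r) = r" for r :: real by auto
    then have "?C t / real N - ?C' t / real N = (\<Sum>i<N. Cstar V k (x t w i)) / real N"
      by (simp only: diff_divide_distrib[symmetric] Cstar_sum_pos)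
    note A = this
    have B: "?K t = ksd_sq N (x t w)" using ksd_sq_nonneg[of N "x t w"] by (simp add: ksd_sq_pos)
    have "real N * ?K t - ?C t / real N + ?C' t / real N = real N * ?K t - (?C t / real N - ?C' t / real N)"
      by simp
    then show "real N * ?K t - ?C t / real N + ?C' t / real N =
        real N * ksd_sq N (x t w) - (\<Sum>i<N. Cstar V k (x t w i)) / real N" unfolding A B .
  qed
  ultimately have I: "((\<lambda>t. real N * ksd_sq N (x t w) - (\<Sum>i<N. Cstar V k (x t w i)) / real N) has_integral
      (real N * integral {0..T} ?K - integral {0..T} ?C / real N + integral {0..T} ?C' / real N)) {0..T}"
    by simp
  have e: "real N * integral {0..T} ?K - integral {0..T} ?C / real N + integral {0..T} ?C' / real N =
      log_jac N (\<lambda>t. x t w) T - (\<Sum>i<N. V (x T w i)) + (\<Sum>i<N. V (x 0 w i))"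
    by (rule has_integral_unique[OF I energy_identity[OF N_pos proc.dynamics[OF w] T]])
  have "((\<lambda>t. ?C t - ?C' t) has_integral (integral {0..T} ?C - integral {0..T} ?C')) {0..T}"
    by (intro has_integral_diff ic ic')
  moreover have "(\<lambda>t. ?C t - ?C' t) = (\<lambda>t. Cstar_sum (pos t w))" by (auto simp: max_def)
  ultimately have "((\<lambda>t. Cstar_sum (pos t w)) has_integral (integral {0..T} ?C - integral {0..T} ?C')) {0..T}"
    by simp
  then have d: "integral {0..T} ?C - integral {0..T} ?C' = integral {0..T} (\<lambda>t. Cstar_sum (pos t w))"
    by (rule integral_unique[symmetric])
  have "0 \<le> integral {0..T} ?K" "0 \<le> integral {0..T} ?C" "0 \<le> integral {0..T} ?C'"
    by (rule has_integral_nonneg[OF ik] has_integral_nonneg[OF ic] has_integral_nonneg[OF ic']; simp)+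
  then show thesis by (rule that[OF _ _ _ k(2) c(2) c'(2) e d])
qed

definition rel_log :: "((nat \<Rightarrow> 'a) \<Rightarrow> real) \<Rightarrow> (nat \<Rightarrow> 'a) \<Rightarrow> real" where
  "rel_log g z = ln (g z / prod_target V N z)"

lemma rel_log_measurable:
  "g \<in> borel_measurable (config_lborel N) \<Longrightarrow> rel_log g \<in> borel_measurable (config_lborel N)"
  unfolding rel_log_def[abs_def]
  by (intro borel_measurable_ln borel_measurable_divide prod_target_measurable)

text \<open>The zero set of a density is null for the law it defines. This justifies splitting
  logarithms of quotients almost surely.\<close>

lemma density_pos_AE: "t \<ge> 0 \<Longrightarrow> AE w in M. 0 < p t (pos t w)"
proof -
  assume t: "t \<ge> 0"
  have m: "(\<lambda>z. ennreal (p t z)) \<in> borel_measurable (config_lborel N)"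
    using density_measurable[OF t] by simp
  have "AE z in density (config_lborel N) (\<lambda>z. ennreal (p t z)). 0 < p t z"
    by (subst AE_density[OF m]) (auto simp: not_less ennreal_neg)
  then have "AE z in distr M (config_lborel N) (pos t). 0 < p t z"
    unfolding distributed_distr_eq_density[OF proc.density[OF t], symmetric] pos_def[abs_def] .
  then show ?thesis
    by (subst (asm) AE_distr_iff)
      (use pos_measurable[OF t] density_measurable[OF t, unfolded borel_measurable_iff_greater] in auto)
qed

text \<open>
  The pathwise identity turns \<open>u = g (x\<^sub>T) J / p\<^sub>0 (x\<^sub>0)\<close> into the relative entropies and the dissipation.
  The claim is \<open>ln u \<le> u - 1\<close> in expectation, with all terms moved to the side where they are
  nonnegative, so that no integrability has to be assumed.
\<close>

lemma entropy_inequality: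
  assumes T: "T > 0" and g: "g \<in> borel_measurable (config_lborel N)"
    and gpos: "AE w in M. 0 < g (pos T w)"
    and gint: "(\<integral>\<^sup>+z. ennreal (g z) \<partial>config_lborel N) \<le> 1"
  shows "(\<integral>\<^sup>+w. ennreal (rel_log g (pos T w)) \<partial>M) + ennreal (real N) * (\<integral>\<^sup>+w. time_integral T (ksd_sq N) w \<partial>M) +
      (\<integral>\<^sup>+w. time_integral T (\<lambda>z. - Cstar_sum z) w \<partial>M) * ennreal (1 / real N) +
      (\<integral>\<^sup>+w. ennreal (- rel_log (p 0) (pos 0 w)) \<partial>M) \<le>
    (\<integral>\<^sup>+w. ennreal (- rel_log g (pos T w)) \<partial>M) +
      (\<integral>\<^sup>+w. time_integral T Cstar_sum w \<partial>M) * ennreal (1 / real N) +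
      (\<integral>\<^sup>+w. ennreal (rel_log (p 0) (pos 0 w)) \<partial>M)"
proof -
  define u where "u = (\<lambda>w. (ennreal (exp (log_jac N (\<lambda>t. x t w) T)) / ennreal (p 0 (pos 0 w))) * ennreal (g (pos T w)))"
  let ?lT = "\<lambda>w. rel_log g (pos T w)" and ?l0 = "\<lambda>w. rel_log (p 0) (pos 0 w)"
  let ?A = "time_integral T (ksd_sq N)" and ?P = "time_integral T Cstar_sum"
    and ?M = "time_integral T (\<lambda>z. - Cstar_sum z)"
  let ?L = "\<lambda>w. ennreal (?lT w) + ennreal (real N) * ?A w + ?M w * ennreal (1 / real N) + ennreal (- ?l0 w)"
  let ?R = "\<lambda>w. ennreal (- ?lT w) + ?P w * ennreal (1 / real N) + ennreal (?l0 w)"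
  have lTm: "?lT \<in> borel_measurable M"
    by (rule measurable_compose[OF pos_measurable rel_log_measurable[OF g]]) (use T in simp)
  have l0m: "?l0 \<in> borel_measurable M"
    by (rule measurable_compose[OF pos_measurable rel_log_measurable[OF density_measurable]]) auto
  have Am: "?A \<in> borel_measurable M" by (rule time_integral_measurable[OF continuous_ksd])
  have Pm: "?P \<in> borel_measurable M" by (rule time_integral_measurable[OF continuous_Cstar_sum])
  have Mm: "?M \<in> borel_measurable M"
    by (intro time_integral_measurable continuous_intros continuous_Cstar_sum)
  have um: "u \<in> borel_measurable M"
    unfolding u_def
    by (intro borel_measurable_times_ennreal borel_measurable_divide_ennreal measurable_compose[OF _ measurable_ennreal]
        measurable_compose[OF log_jac_measurable borel_measurable_exp] measurable_compose[OF pos_measurable density_measurable]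
        measurable_compose[OF pos_measurable g])
      (use T in auto)
  have "AE w in M. ?L w + 1 \<le> ?R w + u w"
    using AE_space gpos density_pos_AE[OF order_refl]
  proof eventually_elim
    case (elim w)
    obtain a c c' where e: "0 \<le> a" "0 \<le> c" "0 \<le> c'" "?A w = ennreal a" "?P w = ennreal c" "?M w = ennreal c'"
      "real N * a - c / real N + c' / real N =
        log_jac N (\<lambda>t. x t w) T - (\<Sum>i<N. V (x T w i)) + (\<Sum>i<N. V (x 0 w i))"
      by (rule path_energy[OF elim(1), of T]) (use T in auto)
    define J where "J = log_jac N (\<lambda>t. x t w) T"
    define U where "U = g (pos T w) * exp J / p 0 (pos 0 w)"
    have U: "U > 0" using elim by (simp add: U_def)
    have uU: "u w = ennreal U"
      using elim unfolding u_def U_def J_def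
      by (simp add: divide_ennreal ennreal_mult'[symmetric] mult.commute)
    have "ln U = ln (g (pos T w)) + J - ln (p 0 (pos 0 w))"
      using elim by (simp add: U_def ln_div ln_mult_pos)
    moreover have "?lT w = ln (g (pos T w)) + (\<Sum>i<N. V (x T w i)) + real N * ln Z"
      using elim prod_target_pos[of "pos T w"] ln_prod_target[of "pos T w"]
      by (simp add: rel_log_def ln_div pos_def)
    moreover have "?l0 w = ln (p 0 (pos 0 w)) + (\<Sum>i<N. V (x 0 w i)) + real N * ln Z"
      using elim prod_target_pos[of "pos 0 w"] ln_prod_target[of "pos 0 w"]
      by (simp add: rel_log_def ln_div pos_def)
    ultimately have "ln U = ?lT w - ?l0 w + (real N * a - c / real N + c' / real N)"
      unfolding e(7) J_def by linarith
    moreover have "ln U \<le> U - 1" using U by (rule ln_le_minus_one)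
    \<comment> \<open>With \<open>max 0 r - max 0 (- r) = r\<close> for each logarithm, this is
      \<open>ln U \<le> U - 1\<close> with nonnegative terms only, as the passage to
      \<open>ennreal\<close> demands.\<close>
    ultimately have le: "max 0 (?lT w) + real N * a + c' * (1 / real N) + max 0 (- ?l0 w) + 1 \<le>
        max 0 (- ?lT w) + c * (1 / real N) + max 0 (?l0 w) + U"
      by (simp add: max_def)
    have mx: "ennreal r = ennreal (max 0 r)" for r by (simp add: max_def ennreal_neg)
    have L: "?L w + 1 = ennreal (max 0 (?lT w) + real N * a + c' * (1 / real N) + max 0 (- ?l0 w) + 1)"
      unfolding e(4) e(6) using e(1-3)
      by (subst mx[of "?lT w"], subst mx[of "- ?l0 w"])
        (simp add: ennreal_mult[symmetric] del: ennreal_max_0)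
    have R: "?R w + u w = ennreal (max 0 (- ?lT w) + c * (1 / real N) + max 0 (?l0 w) + U)"
      unfolding e(5) uU using e(1-3) U
      by (subst mx[of "- ?lT w"], subst mx[of "?l0 w"])
        (simp add: ennreal_mult[symmetric] del: ennreal_max_0)
    show ?case unfolding L R by (rule ennreal_leI[OF le])
  qed
  then have le: "(\<integral>\<^sup>+w. ?L w + 1 \<partial>M) \<le> (\<integral>\<^sup>+w. ?R w + u w \<partial>M)" by (rule nn_integral_mono_AE)
  have en: "(\<lambda>w. ennreal (f w)) \<in> borel_measurable M" if "f \<in> borel_measurable M" for f
    by (rule measurable_compose[OF that measurable_ennreal])
  note lp = en[OF lTm] and ln = en[OF borel_measurable_uminus[OF lTm]]
    and l0p = en[OF l0m] and l0n = en[OF borel_measurable_uminus[OF l0m]]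
    and A' = borel_measurable_times_ennreal[OF borel_measurable_const[of "ennreal (real N)"] Am]
    and P' = borel_measurable_times_ennreal[OF Pm borel_measurable_const[of "ennreal (1 / real N)"]]
    and M' = borel_measurable_times_ennreal[OF Mm borel_measurable_const[of "ennreal (1 / real N)"]]
  note L2 = borel_measurable_add[OF lp A']
  note L3 = borel_measurable_add[OF L2 M']
  note L4 = borel_measurable_add[OF L3 l0n]
  note R2 = borel_measurable_add[OF ln P']
  note R3 = borel_measurable_add[OF R2 l0p]
  have L: "(\<integral>\<^sup>+w. ?L w \<partial>M) = (\<integral>\<^sup>+w. ennreal (?lT w) \<partial>M) + ennreal (real N) * (\<integral>\<^sup>+w. ?A w \<partial>M) +
      (\<integral>\<^sup>+w. ?M w \<partial>M) * ennreal (1 / real N) + (\<integral>\<^sup>+w. ennreal (- ?l0 w) \<partial>M)"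
    unfolding nn_integral_add[OF L3 l0n] nn_integral_add[OF L2 M'] nn_integral_add[OF lp A']
      nn_integral_cmult[OF Am] nn_integral_multc[OF Mm] ..
  have R: "(\<integral>\<^sup>+w. ?R w \<partial>M) = (\<integral>\<^sup>+w. ennreal (- ?lT w) \<partial>M) +
      (\<integral>\<^sup>+w. ?P w \<partial>M) * ennreal (1 / real N) + (\<integral>\<^sup>+w. ennreal (?l0 w) \<partial>M)"
    unfolding nn_integral_add[OF R2 l0p] nn_integral_add[OF ln P'] nn_integral_multc[OF Pm] ..
  have L1: "(\<integral>\<^sup>+w. ?L w + 1 \<partial>M) = (\<integral>\<^sup>+w. ?L w \<partial>M) + 1"
    unfolding nn_integral_add[OF L4 borel_measurable_const] by (simp add: emeasure_space_1)
  have Ru: "(\<integral>\<^sup>+w. ?R w + u w \<partial>M) = (\<integral>\<^sup>+w. ?R w \<partial>M) + (\<integral>\<^sup>+w. u w \<partial>M)"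
    by (rule nn_integral_add[OF R3 um])
  have u1: "(\<integral>\<^sup>+w. u w \<partial>M) \<le> 1"
  proof -
    have "(\<integral>\<^sup>+w. u w \<partial>M) \<le> (\<integral>\<^sup>+z. ennreal (g z) \<partial>config_lborel N)"
      unfolding u_def using g by (intro change_of_measure[OF T]) simp
    then show ?thesis using gint by (rule order_trans)
  qed
  have "(\<integral>\<^sup>+w. ?L w \<partial>M) + 1 \<le> (\<integral>\<^sup>+w. ?R w \<partial>M) + 1"
    using le[unfolded L1 Ru] add_left_mono[OF u1] by (rule order_trans)
  \<comment> \<open>The summand 1 is finite and may be cancelled in \<open>ennreal\<close>; the
    expectations themselves may be infinite.\<close>
  then have "(\<integral>\<^sup>+w. ?L w \<partial>M) \<le> (\<integral>\<^sup>+w. ?R w \<partial>M)"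
    unfolding add.commute[of _ 1] by (subst (asm) ennreal_add_left_cancel_le) auto
  then show ?thesis unfolding L R .
qed

end

section \<open>The bounds\<close>

context svgd_ensemble
begin

lemma nn_integral_density_pos:
  assumes t: "t \<ge> 0" and f: "f \<in> borel_measurable (config_lborel N)"
  shows "(\<integral>\<^sup>+z. ennreal (f z * p t z) \<partial>config_lborel N) = (\<integral>\<^sup>+w. ennreal (f (pos t w)) \<partial>M)"
proof -
  have "(\<integral>\<^sup>+z. ennreal (f z * p t z) \<partial>config_lborel N) =
      (\<integral>\<^sup>+z. ennreal (p t z) * ennreal (f z) \<partial>config_lborel N)"
  proof (rule nn_integral_cong)
    fix z :: "nat \<Rightarrow> 'a" assume "z \<in> space (config_lborel N)"
    then have "0 \<le> p t z" using proc.density_nonneg[OF t] by simp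
    then show "ennreal (f z * p t z) = ennreal (p t z) * ennreal (f z)"
      by (simp add: ennreal_mult'' mult.commute)
  qed
  also have "\<dots> = (\<integral>\<^sup>+w. ennreal (f (restrict (x t w) {..<N})) \<partial>M)"
    by (rule distributed_nn_integral[OF proc.density[OF t] measurable_compose[OF f measurable_ennreal]])
  finally show ?thesis by (simp add: pos_def)
qed

lemma KL_prod_eq:
  assumes t: "t \<ge> 0"
  shows "KL_prod V N (p t) = enn2ereal (\<integral>\<^sup>+w. ennreal (rel_log (p t) (pos t w)) \<partial>M) -
    enn2ereal (\<integral>\<^sup>+w. ennreal (- rel_log (p t) (pos t w)) \<partial>M)"
proof -
  have m: "rel_log (p t) \<in> borel_measurable (config_lborel N)"
    by (rule rel_log_measurable[OF density_measurable[OF t]])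
  have "KL_prod V N (p t) = enn2ereal (\<integral>\<^sup>+z. ennreal (rel_log (p t) z * p t z) \<partial>config_lborel N) -
    enn2ereal (\<integral>\<^sup>+z. ennreal ((- rel_log (p t) z) * p t z) \<partial>config_lborel N)"
    by (simp add: KL_prod_def ext_integral_def rel_log_def)
  then show ?thesis
    unfolding nn_integral_density_pos[OF t m] nn_integral_density_pos[OF t borel_measurable_uminus[OF m]] .
qed

text \<open>From \<open>ln u \<le> u - 1\<close> with \<open>u\<close> the target divided by the
  density, the negative part of the entropy integrand is at most the target, whose integral is 1.
  Hence the relative entropy is never of the form \<open>\<infinity> - \<infinity>\<close>.\<close>

lemma negative_entropy_finite:
  assumes t: "t \<ge> 0"
  shows "(\<integral>\<^sup>+w. ennreal (- rel_log (p t) (pos t w)) \<partial>M) \<noteq> top"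
proof -
  have m: "rel_log (p t) \<in> borel_measurable (config_lborel N)"
    by (rule rel_log_measurable[OF density_measurable[OF t]])
  have "(\<integral>\<^sup>+w. ennreal (- rel_log (p t) (pos t w)) \<partial>M) =
      (\<integral>\<^sup>+z. ennreal ((- rel_log (p t) z) * p t z) \<partial>config_lborel N)"
    by (rule nn_integral_density_pos[OF t borel_measurable_uminus[OF m], symmetric])
  also have "\<dots> \<le> (\<integral>\<^sup>+z. ennreal (prod_target V N z) \<partial>config_lborel N)"
  proof (rule nn_integral_mono)
    fix z :: "nat \<Rightarrow> 'a" assume "z \<in> space (config_lborel N)"
    then have p: "0 \<le> p t z" using proc.density_nonneg[OF t] by simp
    have "(- rel_log (p t) z) * p t z \<le> prod_target V N z"
    proof (cases "p t z = 0")
      case True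
      then show ?thesis using prod_target_pos[of z] by simp
    next
      case False
      then have p: "p t z > 0" using p by simp
      have "- rel_log (p t) z = ln (prod_target V N z / p t z)"
        using p prod_target_pos[of z] by (simp add: rel_log_def ln_div)
      also have "\<dots> \<le> prod_target V N z / p t z"
        using p prod_target_pos[of z] ln_le_minus_one[of "prod_target V N z / p t z"] by simp
      finally show ?thesis using p by (simp add: pos_le_divide_eq)
    qed
    then show "ennreal ((- rel_log (p t) z) * p t z) \<le> ennreal (prod_target V N z)" by (rule ennreal_leI)
  qed
  also have "\<dots> = 1" by (rule nn_integral_prod_target)
  finally show ?thesis by (auto simp: top_unique)
qed

lemma KSD_time_integral:
  "(\<integral>\<^sup>+t\<in>{0..T}. (\<integral>\<^sup>+w. (KSD V H ip (empirical N (x t w)))\<^sup>2 \<partial>M) \<partial>lborel) =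
    (\<integral>\<^sup>+w. time_integral T (ksd_sq N) w \<partial>M)"
  unfolding nn_integral_time_integral[OF continuous_ksd] KSD_empirical_sq ksd_sq_pos ..

lemma time_expectation_Cstar:
  "time_expectation T M (\<lambda>t w. \<Sum>i<N. Cstar V k (x t w i)) =
    enn2ereal (\<integral>\<^sup>+w. time_integral T Cstar_sum w \<partial>M) -
    enn2ereal (\<integral>\<^sup>+w. time_integral T (\<lambda>z. - Cstar_sum z) w \<partial>M)"
  unfolding time_expectation_def nn_integral_time_integral[OF continuous_Cstar_sum]
    nn_integral_time_integral[OF continuous_on_minus[OF continuous_Cstar_sum]] Cstar_sum_pos ..

lemma dissipation_bound:
  assumes T: "T > 0"
  shows "enn2ereal (\<integral>\<^sup>+t\<in>{0..T}. (\<integral>\<^sup>+w. (KSD V H ip (empirical N (x t w)))\<^sup>2 \<partial>M) \<partial>lborel) / ereal T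
    \<le> KL_prod V N (p 0) / ereal (real N * T)
       + time_expectation T M (\<lambda>t w. \<Sum>i<N. Cstar V k (x t w i)) / ereal ((real N)\<^sup>2 * T)"
proof -
  have "rel_log (prod_target V N) z = 0" for z
    using prod_target_pos[of z] by (simp add: rel_log_def)
  then have "ennreal (real N) * (\<integral>\<^sup>+w. time_integral T (ksd_sq N) w \<partial>M) +
      (\<integral>\<^sup>+w. time_integral T (\<lambda>z. - Cstar_sum z) w \<partial>M) * ennreal (1 / real N) +
      (\<integral>\<^sup>+w. ennreal (- rel_log (p 0) (pos 0 w)) \<partial>M) \<le>
      (\<integral>\<^sup>+w. time_integral T Cstar_sum w \<partial>M) * ennreal (1 / real N) +
      (\<integral>\<^sup>+w. ennreal (rel_log (p 0) (pos 0 w)) \<partial>M)"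
    using entropy_inequality[OF T prod_target_measurable] prod_target_pos nn_integral_prod_target by simp
  then show ?thesis
    unfolding KSD_time_integral KL_prod_eq[OF order_refl] time_expectation_Cstar
    using N_pos T negative_entropy_finite[OF order_refl] by (intro entropy_arith_dissipation) auto
qed

lemma entropy_growth:
  assumes T: "T > 0"
  shows "KL_prod V N (p T) \<le> KL_prod V N (p 0)
       + time_expectation T M (\<lambda>t w. \<Sum>i<N. Cstar V k (x t w i)) / ereal (real N)"
proof -
  have T0: "0 \<le> T" using T by simp
  have "(\<integral>\<^sup>+z. ennreal (p T z) \<partial>config_lborel N) = 1"
    using nn_integral_density_pos[OF T0, of "\<lambda>_. 1"] by (simp add: emeasure_space_1)
  then have full: "(\<integral>\<^sup>+w. ennreal (rel_log (p T) (pos T w)) \<partial>M) + ennreal (real N) * (\<integral>\<^sup>+w. time_integral T (ksd_sq N) w \<partial>M) +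
      (\<integral>\<^sup>+w. time_integral T (\<lambda>z. - Cstar_sum z) w \<partial>M) * ennreal (1 / real N) +
      (\<integral>\<^sup>+w. ennreal (- rel_log (p 0) (pos 0 w)) \<partial>M) \<le>
    (\<integral>\<^sup>+w. ennreal (- rel_log (p T) (pos T w)) \<partial>M) +
      (\<integral>\<^sup>+w. time_integral T Cstar_sum w \<partial>M) * ennreal (1 / real N) +
      (\<integral>\<^sup>+w. ennreal (rel_log (p 0) (pos 0 w)) \<partial>M)"
    by (intro entropy_inequality[OF T density_measurable[OF T0] density_pos_AE[OF T0]]) simp
  \<comment> \<open>The dissipation is nonnegative and is discarded.\<close>
  have part: "(\<integral>\<^sup>+w. ennreal (rel_log (p T) (pos T w)) \<partial>M) +
      (\<integral>\<^sup>+w. time_integral T (\<lambda>z. - Cstar_sum z) w \<partial>M) * ennreal (1 / real N) +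
      (\<integral>\<^sup>+w. ennreal (- rel_log (p 0) (pos 0 w)) \<partial>M) \<le>
    (\<integral>\<^sup>+w. ennreal (rel_log (p T) (pos T w)) \<partial>M) + ennreal (real N) * (\<integral>\<^sup>+w. time_integral T (ksd_sq N) w \<partial>M) +
      (\<integral>\<^sup>+w. time_integral T (\<lambda>z. - Cstar_sum z) w \<partial>M) * ennreal (1 / real N) +
      (\<integral>\<^sup>+w. ennreal (- rel_log (p 0) (pos 0 w)) \<partial>M)"
    by (intro add_mono order_refl) simp
  show ?thesis
    unfolding KL_prod_eq[OF order_refl] KL_prod_eq[OF T0] time_expectation_Cstar
    using N_pos negative_entropy_finite[OF order_refl] negative_entropy_finite[OF T0]
    by (intro entropy_arith_growth order_trans[OF part full]) auto
qed

text \<open>Cauchy-Schwarz for the expectation and then for the time average on each path.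
  Monotonicity of the integral first replaces the discrepancy of the averaged measure by the
  measurable bound \<open>B\<close>, the time average of the discrepancies.\<close>

lemma averaged_KSD_bound:
  "(\<integral>\<^sup>+w. KSD V H ip (averaged_empirical N (\<lambda>t. x t w)) \<partial>M)\<^sup>2 \<le>
    (\<integral>\<^sup>+t\<in>{0..real N}. (\<integral>\<^sup>+w. (KSD V H ip (empirical N (x t w)))\<^sup>2 \<partial>M) \<partial>lborel) / ennreal (real N)"
proof -
  let ?U = "uniform_measure lborel {0..real N}"
  define s where "s = (\<lambda>w t. ennreal (sqrt (ksd_sq N (x (max 0 (min (real N) t)) w))))"
  define B where "B = (\<lambda>w. time_integral (real N) (\<lambda>z. sqrt (ksd_sq N z)) w / ennreal (real N))"
  have sm: "s w \<in> borel_measurable lborel" if w: "w \<in> space M" for w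
  proof -
    have "continuous_on UNIV (\<lambda>t. x (max 0 (min (real N) t)) w i)" if "i < N" for i
      by (rule continuous_on_compose2[OF path_continuous[OF w that]]) (auto intro!: continuous_intros)
    then have "continuous_on UNIV (\<lambda>t. sqrt (ksd_sq N (x (max 0 (min (real N) t)) w)))"
      by (intro continuous_on_real_sqrt continuous_ksd_sq)
    then have "(\<lambda>t. sqrt (ksd_sq N (x (max 0 (min (real N) t)) w))) \<in> borel_measurable borel"
      by (rule borel_measurable_continuous_onI)
    then show ?thesis unfolding s_def by (simp add: measurable_compose[OF _ measurable_ennreal])
  qed
  have unif: "(\<integral>\<^sup>+t. f t \<partial>?U) = (\<integral>\<^sup>+t\<in>{0..real N}. f t \<partial>lborel) / ennreal (real N)"
    if "f \<in> borel_measurable lborel" for f :: "real \<Rightarrow> ennreal"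
    using nn_integral_uniform_measure[OF that, of "{0..real N}"] by simp
  have csq: "continuous_on UNIV (\<lambda>z. sqrt (ksd_sq N z))" by (intro continuous_on_real_sqrt continuous_ksd)
  have Bm: "B \<in> borel_measurable M"
    unfolding B_def by (intro borel_measurable_divide_ennreal time_integral_measurable csq) simp
  have Bs: "B w = (\<integral>\<^sup>+t. s w t \<partial>?U)" if w: "w \<in> space M" for w
    unfolding unif[OF sm[OF w]] unfolding B_def time_integral_def s_def
    by (intro arg_cong2[where f="(/)"] nn_integral_cong refl) (auto simp: indicator_def ksd_sq_pos)
  have KB: "KSD V H ip (averaged_empirical N (\<lambda>t. x t w)) \<le> B w" if w: "w \<in> space M" for w
    unfolding Bs[OF w] s_def by (rule KSD_averaged_empirical_le[OF N_pos path_continuous[OF w]])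
  have Bsq: "(B w)\<^sup>2 \<le> time_integral (real N) (ksd_sq N) w / ennreal (real N)" if w: "w \<in> space M" for w
  proof -
    have mU: "s w \<in> borel_measurable ?U"
      using sm[OF w] measurable_cong_sets[of ?U lborel "borel :: ennreal measure" borel] by simp
    have "(B w)\<^sup>2 \<le> (\<integral>\<^sup>+t. (s w t)\<^sup>2 \<partial>?U)"
      unfolding Bs[OF w] by (rule Cauchy_Schwarz_prob[OF prob_space_unif[OF N_pos] mU])
    also have "\<dots> = (\<integral>\<^sup>+t\<in>{0..real N}. (s w t)\<^sup>2 \<partial>lborel) / ennreal (real N)"
      by (rule unif) (unfold power2_eq_square, intro borel_measurable_times_ennreal sm w)
    also have "\<dots> = time_integral (real N) (ksd_sq N) w / ennreal (real N)"
      unfolding time_integral_def s_def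
      by (intro arg_cong2[where f="(/)"] nn_integral_cong refl)
        (auto simp: indicator_def ksd_sq_pos ennreal_power ksd_sq_nonneg)
    finally show ?thesis .
  qed
  have "(\<integral>\<^sup>+w. KSD V H ip (averaged_empirical N (\<lambda>t. x t w)) \<partial>M) \<le> (\<integral>\<^sup>+w. B w \<partial>M)"
    by (intro nn_integral_mono KB)
  then have "(\<integral>\<^sup>+w. KSD V H ip (averaged_empirical N (\<lambda>t. x t w)) \<partial>M)\<^sup>2 \<le> (\<integral>\<^sup>+w. B w \<partial>M)\<^sup>2"
    by (intro power_mono) auto
  also have "\<dots> \<le> (\<integral>\<^sup>+w. (B w)\<^sup>2 \<partial>M)" by (rule Cauchy_Schwarz_prob[OF prob_space_axioms Bm])
  also have "\<dots> \<le> (\<integral>\<^sup>+w. time_integral (real N) (ksd_sq N) w / ennreal (real N) \<partial>M)"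
    by (intro nn_integral_mono Bsq)
  also have "\<dots> = (\<integral>\<^sup>+w. time_integral (real N) (ksd_sq N) w \<partial>M) / ennreal (real N)"
    by (intro nn_integral_divide time_integral_measurable continuous_ksd)
  finally show ?thesis unfolding KSD_time_integral .
qed

text \<open>On each path the integral of \<open>Cstar_sum\<close> is at most
  \<open>T * (real N * c)\<close>. Taking expectations of the two parts separately needs the
  positive part to be finite, which the upper bound \<open>c\<close> also provides.\<close>

lemma time_expectation_Cstar_le:
  assumes c: "\<And>z. Cstar V k z \<le> c" and T: "T > 0"
  shows "time_expectation T M (\<lambda>t w. \<Sum>i<N. Cstar V k (x t w i)) \<le> ereal (T * (real N * c))"
proof -
  define K where "K = T * (real N * c)"
  let ?P = "time_integral T Cstar_sum" and ?M = "time_integral T (\<lambda>z. - Cstar_sum z)"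
  have Cstar_sum_le: "Cstar_sum z \<le> real N * c" for z
    unfolding Cstar_sum_def using sum_mono[of "{..<N}" "\<lambda>i. Cstar V k (z i)" "\<lambda>_. c"] c by simp
  have Pm: "?P \<in> borel_measurable M" by (rule time_integral_measurable[OF continuous_Cstar_sum])
  have Mm: "?M \<in> borel_measurable M"
    by (rule time_integral_measurable[OF continuous_on_minus[OF continuous_Cstar_sum]])
  \<comment> \<open>\<open>K\<close> may have either sign: its negative part stands on the left and
    its positive part on the right.\<close>
  have "?P w + ennreal (- K) \<le> ?M w + ennreal K" if w: "w \<in> space M" for w
  proof -
    obtain a q q' where e: "0 \<le> q" "0 \<le> q'" "?P w = ennreal q" "?M w = ennreal q'"
      "q - q' = integral {0..T} (\<lambda>t. Cstar_sum (pos t w))"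
      by (rule path_energy[OF w, of T]) (use T in auto)
    have "integral {0..T} (\<lambda>t. Cstar_sum (pos t w)) \<le> integral {0..T} (\<lambda>t. real N * c)"
    proof (rule integral_le)
      show "(\<lambda>t. Cstar_sum (pos t w)) integrable_on {0..T}"
        by (intro integrable_continuous_real time_integral_eq_integral(1) w continuous_Cstar_sum)
      fix t
      show "Cstar_sum (pos t w) \<le> real N * c" by (rule Cstar_sum_le)
    qed (intro integrable_continuous_real continuous_on_const)
    then have "q - q' \<le> K" using e(5) T by (simp add: K_def mult.left_commute)
    then have "q + max 0 (- K) \<le> q' + max 0 K" by (auto simp: max_def)
    then have "ennreal (q + max 0 (- K)) \<le> ennreal (q' + max 0 K)" by (rule ennreal_leI)
    then show ?thesis unfolding e(3,4) using e(1,2) by simp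
  qed
  then have "(\<integral>\<^sup>+w. ?P w + ennreal (- K) \<partial>M) \<le> (\<integral>\<^sup>+w. ?M w + ennreal K \<partial>M)"
    by (rule nn_integral_mono)
  then have le: "(\<integral>\<^sup>+w. ?P w \<partial>M) + ennreal (- K) \<le> (\<integral>\<^sup>+w. ?M w \<partial>M) + ennreal K"
    unfolding nn_integral_add[OF Pm borel_measurable_const] nn_integral_add[OF Mm borel_measurable_const]
    by (simp add: emeasure_space_1)
  \<comment> \<open>A bound by a constant makes the expectation of the positive part finite and
    excludes the case \<open>\<infinity> - \<infinity>\<close>.\<close>
  have "?P w \<le> ennreal (T * max 0 (real N * c))" if w: "w \<in> space M" for w
  proof -
    have "integral {0..T} (\<lambda>t. max 0 (Cstar_sum (pos t w))) \<le> integral {0..T} (\<lambda>t. max 0 (real N * c))"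
    proof (rule integral_le)
      show "(\<lambda>t. max 0 (Cstar_sum (pos t w))) integrable_on {0..T}"
        by (intro integrable_continuous_real continuous_on_max continuous_on_const
            time_integral_eq_integral(1) w continuous_Cstar_sum)
      show "max 0 (Cstar_sum (pos t w)) \<le> max 0 (real N * c)" for t
        using Cstar_sum_le by (rule max.mono[OF order_refl])
    qed (intro integrable_continuous_real continuous_on_const)
    then show ?thesis
      unfolding time_integral_eq_integral(2)[OF w continuous_Cstar_sum] using T by (intro ennreal_leI) simp
  qed
  then have "(\<integral>\<^sup>+w. ?P w \<partial>M) \<le> (\<integral>\<^sup>+w. ennreal (T * max 0 (real N * c)) \<partial>M)"
    by (rule nn_integral_mono)
  then have P_fin: "(\<integral>\<^sup>+w. ?P w \<partial>M) \<noteq> top"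
    by (auto simp: emeasure_space_1 top_unique)
  have arith: "enn2ereal P - enn2ereal Q \<le> ereal K"
    if le: "P + ennreal (- K) \<le> Q + ennreal K" and P: "P \<noteq> top" for P Q
  proof (cases "Q = top")
    case True
    then show ?thesis using P by (cases P) (auto simp: enn2ereal_ennreal)
  next
    case False
    then obtain q where q: "Q = ennreal q" "q \<ge> 0" by (cases Q) auto
    obtain r where r: "P = ennreal r" "r \<ge> 0" using P by (cases P) auto
    have "ennreal (r + max 0 (- K)) \<le> ennreal (q + max 0 K)"
      using le q r by simp
    then have "r + max 0 (- K) \<le> q + max 0 K" using q by (subst (asm) ennreal_le_iff) auto
    then have "r - q \<le> K" by (auto simp: max_def split: if_splits)
    then show ?thesis using q r by (simp add: enn2ereal_ennreal)
  qed
  show ?thesis unfolding time_expectation_Cstar K_def[symmetric] by (rule arith[OF le P_fin])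
qed

end

theorem theorem1:
  fixes V :: "'a::euclidean_space \<Rightarrow> real"
    and k :: "'a \<Rightarrow> 'a \<Rightarrow> real"
    and H :: "('a \<Rightarrow> real) set"
    and ip :: "('a \<Rightarrow> real) \<Rightarrow> ('a \<Rightarrow> real) \<Rightarrow> real"
    and M :: "nat \<Rightarrow> 'w measure"
    and x :: "nat \<Rightarrow> real \<Rightarrow> 'w \<Rightarrow> nat \<Rightarrow> 'a"
    and p :: "nat \<Rightarrow> real \<Rightarrow> (nat \<Rightarrow> 'a) \<Rightarrow> real"
  assumes "Ck 3 V"
    and "integrable lborel (\<lambda>y. exp (- V y))"
    and "Ck 3 (\<lambda>(y, z). k y z)"
    and "pos_def_kernel k"
    and "rkhs k H ip"
  shows
    "(\<forall>N\<ge>1. svgd_process V k N (M N) (x N) (p N) \<longrightarrow> (\<forall>T>0.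
        enn2ereal (\<integral>\<^sup>+t\<in>{0..T}.
            (\<integral>\<^sup>+w. (KSD V H ip (empirical N (x N t w)))\<^sup>2 \<partial>M N) \<partial>lborel) / ereal T
          \<le> KL_prod V N (p N 0) / ereal (real N * T)
             + time_expectation T (M N) (\<lambda>t w. \<Sum>i<N. Cstar V k (x N t w i))
                 / ereal ((real N)\<^sup>2 * T)
      \<and> KL_prod V N (p N T)
          \<le> KL_prod V N (p N 0)
             + time_expectation T (M N) (\<lambda>t w. \<Sum>i<N. Cstar V k (x N t w i)) / ereal (real N)))
     \<and>
     ((\<forall>N\<ge>1. svgd_process V k N (M N) (x N) (p N)) \<longrightarrow>
      (SUP z. ereal (Cstar V k z)) < \<infinity> \<longrightarrow>
      limsup (\<lambda>N. KL_prod V N (p N 0) / ereal (real N)) < \<infinity> \<longrightarrow>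
      (\<forall>N\<ge>1.
        (\<integral>\<^sup>+w. KSD V H ip (averaged_empirical N (\<lambda>t. x N t w)) \<partial>M N)\<^sup>2
          \<le> (\<integral>\<^sup>+t\<in>{0..real N}.
               (\<integral>\<^sup>+w. (KSD V H ip (empirical N (x N t w)))\<^sup>2 \<partial>M N) \<partial>lborel) / ennreal (real N)
      \<and> enn2ereal ((\<integral>\<^sup>+t\<in>{0..real N}.
               (\<integral>\<^sup>+w. (KSD V H ip (empirical N (x N t w)))\<^sup>2 \<partial>M N) \<partial>lborel) / ennreal (real N))
          \<le> ((SUP L\<in>{1..}. KL_prod V L (p L 0) / ereal (real L)) + (SUP z. ereal (Cstar V k z)))
              / ereal (real N)))"
proof -
  have ens: "svgd_ensemble k H ip V N (M N) (x N) (p N)"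
    if "N \<ge> 1" "svgd_process V k N (M N) (x N) (p N)" for N
    using that assms
    by (intro svgd_ensemble.intro svgd_setting.intro smooth_rkhs.intro smooth_rkhs_axioms.intro
        svgd_setting_axioms.intro svgd_ensemble_axioms.intro) auto
  show ?thesis
  proof (intro conjI allI impI)
    fix N :: nat and T :: real assume "1 \<le> N" "svgd_process V k N (M N) (x N) (p N)" and T: "0 < T"
    then interpret E: svgd_ensemble k H ip V N "M N" "x N" "p N" by (intro ens)
    show "enn2ereal (\<integral>\<^sup>+t\<in>{0..T}.
            (\<integral>\<^sup>+w. (KSD V H ip (empirical N (x N t w)))\<^sup>2 \<partial>M N) \<partial>lborel) / ereal T
          \<le> KL_prod V N (p N 0) / ereal (real N * T)
             + time_expectation T (M N) (\<lambda>t w. \<Sum>i<N. Cstar V k (x N t w i))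
                 / ereal ((real N)\<^sup>2 * T)"
      by (rule E.dissipation_bound[OF T])
    show "KL_prod V N (p N T)
          \<le> KL_prod V N (p N 0)
             + time_expectation T (M N) (\<lambda>t w. \<Sum>i<N. Cstar V k (x N t w i)) / ereal (real N)"
      by (rule E.entropy_growth[OF T])
  next
    fix N :: nat
    assume proc: "\<forall>N\<ge>1. svgd_process V k N (M N) (x N) (p N)" and N: "1 \<le> N"
      and fin: "(SUP z. ereal (Cstar V k z)) < \<infinity>"
    interpret E: svgd_ensemble k H ip V N "M N" "x N" "p N" using proc N by (intro ens) auto
    show "(\<integral>\<^sup>+w. KSD V H ip (averaged_empirical N (\<lambda>t. x N t w)) \<partial>M N)\<^sup>2
          \<le> (\<integral>\<^sup>+t\<in>{0..real N}.
               (\<integral>\<^sup>+w. (KSD V H ip (empirical N (x N t w)))\<^sup>2 \<partial>M N) \<partial>lborel) / ennreal (real N)"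
      by (rule E.averaged_KSD_bound)
    have n: "real N > 0" using N by simp
    let ?A = "\<integral>\<^sup>+t\<in>{0..real N}. (\<integral>\<^sup>+w. (KSD V H ip (empirical N (x N t w)))\<^sup>2 \<partial>M N) \<partial>lborel"
    let ?KL = "KL_prod V N (p N 0)"
    let ?TE = "time_expectation (real N) (M N) (\<lambda>t w. \<Sum>i<N. Cstar V k (x N t w i))"
    let ?S = "SUP L\<in>{1..}. KL_prod V L (p L 0) / ereal (real L)"
    have le: "ereal (Cstar V k z) \<le> (SUP z. ereal (Cstar V k z))" for z by (rule SUP_upper) simp
    have "(SUP z. ereal (Cstar V k z)) \<noteq> - \<infinity>" using le[of 0] by auto
    then obtain c where c: "(SUP z. ereal (Cstar V k z)) = ereal c"
      using fin by (cases "SUP z. ereal (Cstar V k z)") auto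
    have "Cstar V k z \<le> c" for z using le[of z] unfolding c by simp
    then have TE: "?TE \<le> ereal (real N * (real N * c))" by (rule E.time_expectation_Cstar_le[OF _ n])
    have KL: "?KL / ereal (real N) \<le> ?S" using N by (intro SUP_upper) simp
    have "enn2ereal (?A / ennreal (real N)) = enn2ereal ?A / ereal (real N)"
      using n by (cases ?A) (auto simp: divide_ennreal enn2ereal_ennreal ennreal_top_divide)
    \<comment> \<open>With the horizon \<open>T = N\<close> the entropy has the denominator
      \<open>N * N\<close>, and the \<open>Cstar\<close> term, at most \<open>N * N * c\<close>, the
      denominator \<open>N\<^sup>2 * N\<close>. After the bound of \<open>?KL / N\<close> by
      \<open>?S\<close>, both terms carry the factor \<open>1 / N\<close>.\<close>
    also have "\<dots> \<le> ?KL / ereal (real N * real N) + ?TE / ereal ((real N)\<^sup>2 * real N)"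
      by (rule E.dissipation_bound[OF n])
    also have "\<dots> \<le> ?S / ereal (real N) + ereal c / ereal (real N)"
    proof (rule add_mono)
      have "?KL / ereal (real N * real N) = (?KL / ereal (real N)) / ereal (real N)"
        using n by (cases ?KL) auto
      also have "\<dots> \<le> ?S / ereal (real N)"
        using KL n by (intro ereal_divide_right_mono) auto
      finally show "?KL / ereal (real N * real N) \<le> ?S / ereal (real N)" .
      have "?TE / ereal ((real N)\<^sup>2 * real N) \<le> ereal (real N * (real N * c)) / ereal ((real N)\<^sup>2 * real N)"
        using TE n by (intro ereal_divide_right_mono) auto
      also have "\<dots> = ereal c / ereal (real N)"
        using n by (simp add: power2_eq_square)
      finally show "?TE / ereal ((real N)\<^sup>2 * real N) \<le> ereal c / ereal (real N)" .
    qed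
    also have "\<dots> = (?S + ereal c) / ereal (real N)"
      using n by (cases ?S) (auto simp: add_divide_distrib)
    finally show "enn2ereal (?A / ennreal (real N)) \<le>
        (?S + (SUP z. ereal (Cstar V k z))) / ereal (real N)" unfolding c .
  qed
qed

end
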